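(* Let $N\ge 3$, $p>2$ and $K\in\mathbb{N}$ (so $K\ge 1$). For $\alpha>\alpha_p$ let $u_\alpha$ denote the unique radial solution of the Hénon problem $$-\Delta u=|x|^\alpha|u|^{p-2}u\ \text{ in }\mathbf{B},\qquad u=0\ \text{ on }\partial\mathbf{B},$$ with precisely $K$ nodal domains and $u_\alpha(0)>0$, regarded as a function of $r=|x|\in[0,1]$, and define $$U_\alpha:[0,\infty)\to\mathbb{R},\qquad U_\alpha(t)=(N+\alpha)^{-\frac{2}{p-2}}\,u_\alpha\bigl(e^{-\frac{t}{N+\alpha}}\bigr).$$ Then $U_\alpha\to(-1)^{K-1}U_\infty$ uniformly on $[0,\infty)$ as $\alpha\to\infty$, where $U_\infty\in C^2([0,\infty))$ is characterized as the unique bounded solution of the limit problem $$-U''=e^{-t}|U|^{p-2}U\ \text{ in }[0,\infty),\qquad U(0)=0,$$ with $U'(0)>0$ and with precisely $K-1$ zeros in $(0,\infty)$.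
   Context: $\mathbf{B}\subset\mathbb{R}^N$ is the open unit ball, and $\alpha_p:=\max\{\frac{(N-2)p-2N}{2},0\}$. It is a known fact that for every $p>2$, $K\in\mathbb{N}$ and $\alpha>\alpha_p$ the boundary value problem $-\Delta u=|x|^\alpha|u|^{p-2}u$ in $\mathbf{B}$, $u=0$ on $\partial\mathbf{B}$, has a unique radial solution $u_\alpha\in C^2(\overline{\mathbf{B}})$ with precisely $K$ nodal domains (i.e. $K-1$ zeros in the radial variable $r\in(0,1)$) and $u_\alpha(0)>0$. *)

theory Defs
  imports "HOL-Analysis.Analysis"
begin

definition partial_deriv :: "'a::euclidean_space \<Rightarrow> ('a \<Rightarrow> real) \<Rightarrow> 'a \<Rightarrow> real" where
  "partial_deriv i u x = deriv (\<lambda>t. u (x + t *\<^sub>R i)) 0"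

definition laplacian :: "('a::euclidean_space \<Rightarrow> real) \<Rightarrow> 'a \<Rightarrow> real" where
  "laplacian u x = (\<Sum>i\<in>Basis. partial_deriv i (partial_deriv i u) x)"

text \<open>The space \<open>C\<^sup>2\<close> of the closure of an open set \<open>S\<close>: \<open>u\<close> is continuous on the closure and twice
  differentiable in \<open>S\<close>, and all partial derivatives of order one and two extend continuously from
  \<open>S\<close> to its closure (hence they are in particular continuous in \<open>S\<close>). Values of \<open>u\<close> outside
  the closure play no role.\<close>

definition extends_continuously :: "'a::euclidean_space set \<Rightarrow> ('a \<Rightarrow> real) \<Rightarrow> bool" where
  "extends_continuously S f \<longleftrightarrow> (\<exists>g. continuous_on (closure S) g \<and> (\<forall>x\<in>S. g x = f x))"

definition C2_closure :: "'a::euclidean_space set \<Rightarrow> ('a \<Rightarrow> real) \<Rightarrow> bool" where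
  "C2_closure S u \<longleftrightarrow>
     continuous_on (closure S) u \<and>
     (\<forall>x\<in>S. u differentiable (at x)) \<and>
     (\<forall>i\<in>Basis. extends_continuously S (partial_deriv i u) \<and>
        (\<forall>x\<in>S. partial_deriv i u differentiable (at x)) \<and>
        (\<forall>j\<in>Basis. extends_continuously S (partial_deriv j (partial_deriv i u))))"

definition radial_on_ball :: "('a::euclidean_space \<Rightarrow> real) \<Rightarrow> bool" where
  "radial_on_ball u \<longleftrightarrow> (\<forall>x\<in>cball 0 1. \<forall>y\<in>cball 0 1. norm x = norm y \<longrightarrow> u x = u y)"

text \<open>A radial \<open>u\<close> regarded as a function of \<open>r = norm x\<close>; for \<open>0 \<le> r \<le> 1\<close> the choice of the unit
  vector is immaterial.\<close>

definition radial_profile :: "('a::euclidean_space \<Rightarrow> real) \<Rightarrow> real \<Rightarrow> real" where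
  "radial_profile u r = u (r *\<^sub>R (SOME e. e \<in> Basis))"

definition nodal_domains :: "('a::euclidean_space \<Rightarrow> real) \<Rightarrow> 'a set set" where
  "nodal_domains u = components {x \<in> ball 0 1. u x \<noteq> 0}"

text \<open>For \<open>K \<ge> 1\<close> the condition on \<open>card\<close> includes finiteness of the set of nodal domains.\<close>

definition henon_radial_solution ::
    "real \<Rightarrow> real \<Rightarrow> nat \<Rightarrow> ('a::euclidean_space \<Rightarrow> real) \<Rightarrow> bool" where
  "henon_radial_solution p \<alpha> K u \<longleftrightarrow>
     C2_closure (ball 0 1) u \<and>
     radial_on_ball u \<and>
     (\<forall>x\<in>ball 0 1. - laplacian u x = norm x powr \<alpha> * \<bar>u x\<bar> powr (p - 2) * u x) \<and>
     (\<forall>x\<in>sphere 0 1. u x = 0) \<and>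
     card (nodal_domains u) = K \<and>
     u 0 > 0"

definition alpha_crit :: "nat \<Rightarrow> real \<Rightarrow> real" where
  "alpha_crit N p = max (((real N - 2) * p - 2 * real N) / 2) 0"

definition henon_rescaled :: "real \<Rightarrow> real \<Rightarrow> ('a::euclidean_space \<Rightarrow> real) \<Rightarrow> real \<Rightarrow> real" where
  "henon_rescaled p \<alpha> u t =
     (real DIM('a) + \<alpha>) powr (- 2 / (p - 2)) *
     radial_profile u (exp (- t / (real DIM('a) + \<alpha>)))"

text \<open>Derivatives at the endpoint \<open>0\<close> are one-sided. Finiteness of the zero set is stated
  separately because \<open>card\<close> of an infinite set is \<open>0\<close>, which matters for \<open>K = 1\<close>.\<close>

definition limit_solution :: "real \<Rightarrow> nat \<Rightarrow> (real \<Rightarrow> real) \<Rightarrow> bool" where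
  "limit_solution p K U \<longleftrightarrow>
     (\<exists>U' U''.
        (\<forall>t\<ge>0. (U has_real_derivative U' t) (at t within {0..})) \<and>
        (\<forall>t\<ge>0. (U' has_real_derivative U'' t) (at t within {0..})) \<and>
        continuous_on {0..} U'' \<and>
        (\<forall>t\<ge>0. - U'' t = exp (- t) * \<bar>U t\<bar> powr (p - 2) * U t) \<and>
        U' 0 > 0) \<and>
     U 0 = 0 \<and>
     bounded (U ` {0..}) \<and>
     finite {t. t > 0 \<and> U t = 0} \<and>
     card {t. t > 0 \<and> U t = 0} = K - 1"

end

theory Submission
  imports Defs
begin

text \<open>In the variable \<open>t = - (N + \<alpha>) ln r\<close> the radial equation becomes
  \<open>- (e\<^bsup>-\<gamma>t\<^esup> U')' = e\<^bsup>-t\<^esup> |U|\<^bsup>p-2\<^esup> U\<close> on \<open>[0,\<infinity>)\<close> with \<open>\<gamma> = (N - 2) / (N + \<alpha>) \<rightarrow> 0\<close>, and the limit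
  problem is the case \<open>\<gamma> = 0\<close>. For fixed \<open>\<gamma>\<close> the equation is invariant under
  \<open>U \<mapsto> c U(\<cdot> + s)\<close> for \<open>c = e\<^bsup>-(1-\<gamma>)s/(p-2)\<^esup>\<close>, so every bounded solution is up to sign a rescaled
  shift of the one with limit \<open>1\<close> at infinity, and prescribing \<open>U(0) = 0\<close> and the number of zeros amounts
  to selecting one of the zeros of this profile. For \<open>\<gamma> = 0\<close> the profile \<open>W\<close> exists on the whole line,
  has simple zeros and oscillates as \<open>t \<rightarrow> -\<infinity>\<close>, which yields \<open>U\<^sub>\<infinity>\<close>. A Gronwall estimate starting at
  infinity shows that the profiles for small \<open>\<gamma>\<close> are \<open>C\<^sup>1\<close>-close to \<open>W\<close> on half-lines; since the zeros
  of \<open>W\<close> are simple, the selected zeros and hence the rescaled solutions converge.\<close>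

section \<open>The odd power nonlinearity\<close>

text \<open>The obstacle is that the height \<open>u \<alpha> 0\<close> is unknown, so there is no a
  priori scale for the rescaled solutions. Normalising the limit at infinity to 1 turns this unknown
  into the position z of the boundary zero. The normalised solution lives only on [z,\<infinity>)
  and z might escape, so the comparison constants must not depend on z, and z is pinned down by
  counting: far to the left of the wanted zero of \<open>W\<close>, closeness to \<open>W\<close>
  would create too many zeros; far to the right there would be room for too few.

  Working from infinity is also forced by the perturbation itself: e^(\<gamma>t) - 1 is unbounded
  for every \<gamma> > 0, and only the decay of the derivative makes the error of order \<gamma>.
  The momentum P = e^(-\<gamma>t) V' is used because for |V| \<le> 1 it satisfies |P| \<le> e^(-t)
  whatever \<gamma> is.

  The sign (-1)^(K-1) arises because the rescaled solutions are positive at infinity while U' > 0 is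
  required at 0, with K - 1 simple zeros in between.\<close>

definition signed_powr :: "real \<Rightarrow> real \<Rightarrow> real" where
  "signed_powr q w = \<bar>w\<bar> powr q * w"

lemma signed_powr_minus [simp]: "signed_powr q (- w) = - signed_powr q w"
  by (simp add: signed_powr_def)

lemma signed_powr_zero [simp]: "signed_powr q 0 = 0"
  by (simp add: signed_powr_def)

lemma signed_powr_mult: "c \<ge> 0 \<Longrightarrow> signed_powr q (c * w) = c powr q * c * signed_powr q w"
  by (simp add: signed_powr_def abs_mult powr_mult)

lemma signed_powr_pos: "w > 0 \<Longrightarrow> signed_powr q w > 0"
  by (simp add: signed_powr_def)

lemma continuous_on_signed_powr [continuous_intros]:
  assumes "q > 0" "continuous_on S h"
  shows "continuous_on S (\<lambda>x. signed_powr q (h x))"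
  unfolding signed_powr_def using assms
  by (intro continuous_on_mult continuous_on_powr' continuous_on_rabs continuous_on_const) auto

lemma signed_powr_abs_le:
  assumes "q \<ge> 0" "\<bar>w\<bar> \<le> M"
  shows "\<bar>signed_powr q w\<bar> \<le> M powr q * M"
  using assms unfolding signed_powr_def abs_mult
  by (intro mult_mono) (auto intro!: powr_mono2)

lemma signed_powr_mono: "q \<ge> 0 \<Longrightarrow> 0 \<le> x \<Longrightarrow> x \<le> y \<Longrightarrow> signed_powr q x \<le> signed_powr q y"
  unfolding signed_powr_def by (intro mult_mono) (auto intro!: powr_mono2)

lemma DERIV_abs_powr:
  assumes "q > 0"
  shows "((\<lambda>w. \<bar>w\<bar> powr (q + 2) / (q + 2)) has_real_derivative signed_powr q w) (at w)"
proof -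
  consider "w > 0" | "w < 0" | "w = 0" by linarith
  then show ?thesis
  proof cases
    case 1
    have "((\<lambda>w. w powr (q + 2) / (q + 2)) has_real_derivative (q + 2) * w powr (q + 2 - 1) / (q + 2)) (at w)"
      by (intro DERIV_cdivide has_real_derivative_powr 1)
    moreover have "(q + 2) * w powr (q + 2 - 1) / (q + 2) = signed_powr q w"
      using 1 assms powr_add[of w 1 q] by (simp add: signed_powr_def)
    ultimately have "((\<lambda>w. w powr (q + 2) / (q + 2)) has_real_derivative signed_powr q w) (at w)"
      by simp
    moreover have "\<forall>\<^sub>F x in nhds w. \<bar>x\<bar> powr (q + 2) / (q + 2) = x powr (q + 2) / (q + 2)"
      by (rule eventually_mono[OF eventually_nhds_in_open[of "{0<..}" w]]) (use 1 in auto)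
    ultimately show ?thesis by (subst DERIV_cong_ev[OF refl _ refl])
  next
    case 2
    have "((\<lambda>w. (-w) powr (q + 2) / (q + 2)) has_real_derivative
        (q + 2) * (-w) powr (q + 2 - 1) * (-1) / (q + 2)) (at w)"
      using 2 by (intro DERIV_cdivide DERIV_chain2[of "\<lambda>w. w powr (q + 2)"] has_real_derivative_powr)
        (auto intro!: derivative_eq_intros)
    moreover have "(q + 2) * (-w) powr (q + 2 - 1) * (-1) / (q + 2) = signed_powr q w"
      using 2 assms powr_add[of "-w" 1 q] by (simp add: signed_powr_def)
    ultimately have "((\<lambda>w. (-w) powr (q + 2) / (q + 2)) has_real_derivative signed_powr q w) (at w)"
      by simp
    moreover have "\<forall>\<^sub>F x in nhds w. \<bar>x\<bar> powr (q + 2) / (q + 2) = (-x) powr (q + 2) / (q + 2)"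
      by (rule eventually_mono[OF eventually_nhds_in_open[of "{..<0}" w]]) (use 2 in auto)
    ultimately show ?thesis by (subst DERIV_cong_ev[OF refl _ refl])
  next
    case 3
    \<comment> \<open>At 0 the difference quotient has modulus |h|^(q+1) / (q+2), so the derivative
      there is 0.\<close>
    have "((\<lambda>h. \<bar>h\<bar> powr (q + 1) / (q + 2)) \<longlongrightarrow> 0) (at 0)"
      using assms by (auto intro!: tendsto_eq_intros)
    then have "((\<lambda>h. \<bar>h\<bar> powr (q + 2) / (q + 2) / h) \<longlongrightarrow> 0) (at 0)"
    proof (rule tendsto_rabs_zero_cancel[OF tendsto_cong[THEN iffD1, OF _ tendsto_rabs_zero], rotated])
      show "\<forall>\<^sub>F x in at 0. \<bar>\<bar>x\<bar> powr (q + 1) / (q + 2)\<bar> = \<bar>\<bar>x\<bar> powr (q + 2) / (q + 2) / x\<bar>"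
        by (auto simp: eventually_at_filter powr_add powr_numeral abs_mult power2_eq_square abs_divide)
    qed
    then show ?thesis using 3 assms by (simp add: DERIV_def)
  qed
qed

text \<open>On one side of 0 the derivative (q+1) z^q is at most q+1; across 0 the bound
  \<open>small\<close> replaces the mean value theorem, which sidesteps differentiation at
  0.\<close>

lemma signed_powr_Lipschitz:
  assumes q: "q > 0" and "\<bar>x\<bar> \<le> 1" "\<bar>y\<bar> \<le> 1"
  shows "\<bar>signed_powr q x - signed_powr q y\<bar> \<le> (q + 1) * \<bar>x - y\<bar>"
proof -
  have pos: "\<bar>signed_powr q x - signed_powr q y\<bar> \<le> (q + 1) * \<bar>x - y\<bar>"
    if "0 < y" "y \<le> x" "x \<le> 1" for x y
  proof (cases "x = y")
    case False
    have "\<exists>z>y. z < x \<and> signed_powr q x - signed_powr q y = (x - y) * ((q + 1) * z powr q)"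
    proof (rule MVT2)
      show "y < x" using that False by simp
      fix w assume "y \<le> w" "w \<le> x"
      then have w: "w > 0" using that by simp
      have "((\<lambda>w. w powr (q + 1)) has_real_derivative (q + 1) * w powr q) (at w)"
        using w by (auto intro!: derivative_eq_intros)
      moreover have "\<forall>\<^sub>F x in nhds w. signed_powr q x = x powr (q + 1)"
        by (rule eventually_mono[OF eventually_nhds_in_open[of "{0<..}" w]])
          (use w in \<open>auto simp: signed_powr_def powr_add\<close>)
      ultimately show "(signed_powr q has_real_derivative (q + 1) * w powr q) (at w)"
        by (subst DERIV_cong_ev[OF refl _ refl])
    qed
    then obtain z where z: "y < z" "z < x"
      "signed_powr q x - signed_powr q y = (x - y) * ((q + 1) * z powr q)" by auto
    have "z powr q \<le> 1" using z that q by (intro powr_le1) auto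
    then show ?thesis using z that q
      by (auto simp: abs_mult mult_left_le intro!: mult_left_mono)
  qed simp
  have small: "\<bar>signed_powr q w\<bar> \<le> \<bar>w\<bar>" if "\<bar>w\<bar> \<le> 1" for w
    using that powr_le1[of q "\<bar>w\<bar>"] q by (simp add: signed_powr_def abs_mult mult_left_le_one_le)
  have opp: "\<bar>signed_powr q x - signed_powr q y\<bar> \<le> (q + 1) * \<bar>x - y\<bar>"
    if "0 \<le> x" "y \<le> 0" "\<bar>x\<bar> \<le> 1" "\<bar>y\<bar> \<le> 1" for x y
  proof -
    have "\<bar>signed_powr q x - signed_powr q y\<bar> \<le> 1 * \<bar>x - y\<bar>"
      using small[OF that(3)] small[OF that(4)] that by (simp add: abs_if split: if_splits)
    also have "\<dots> \<le> (q + 1) * \<bar>x - y\<bar>" using q by (intro mult_right_mono) auto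
    finally show ?thesis .
  qed
  consider "0 < y" "y \<le> x" | "0 < x" "x \<le> y" | "0 \<le> x" "y \<le> 0" | "0 \<le> y" "x \<le> 0"
    | "y < 0" "x \<le> y" | "x < 0" "y \<le> x" by linarith
  then show ?thesis
  proof cases
    case 1 then show ?thesis using pos assms by simp
  next
    case 2 then show ?thesis using pos[of x y] assms by (simp add: abs_minus_commute)
  next
    case 3 then show ?thesis using opp assms by simp
  next
    case 4 then show ?thesis using opp[of y x] assms by (simp add: abs_minus_commute)
  next
    case 5
    then have "\<bar>signed_powr q (-x) - signed_powr q (-y)\<bar> \<le> (q + 1) * \<bar>(-x) - (-y)\<bar>"
      using pos[of "-y" "-x"] assms by simp
    then show ?thesis by (simp add: abs_minus_commute)
  next
    case 6
    then have "\<bar>signed_powr q (-y) - signed_powr q (-x)\<bar> \<le> (q + 1) * \<bar>(-y) - (-x)\<bar>"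
      using pos[of "-x" "-y"] assms by simp
    then show ?thesis by (simp add: abs_minus_commute)
  qed
qed

section \<open>The Emden--Fowler equation near infinity\<close>

text \<open>Infinity plays the role of the initial point: the decay, energy and comparison estimates
  all apply this to a monotone quantity with known limit.\<close>

lemma DERIV_nonneg_imp_le_limit:
  fixes h :: "real \<Rightarrow> real"
  assumes d: "\<And>t. t > T \<Longrightarrow> (h has_real_derivative h' t) (at t)"
    and n: "\<And>t. t > T \<Longrightarrow> h' t \<ge> 0" and l: "(h \<longlongrightarrow> l) at_top" and t: "t > T"
  shows "h t \<le> l"
proof (rule tendsto_lowerbound[OF l])
  show "\<forall>\<^sub>F x in at_top. h t \<le> h x"
    using eventually_ge_at_top[of t]
  proof eventually_elim
    case (elim x)
    show ?case
    proof (rule DERIV_nonneg_imp_nondecreasing[OF elim])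
      fix s assume "t \<le> s" "s \<le> x"
      then have "T < s" using t by simp
      with d n show "\<exists>y. (h has_real_derivative y) (at s) \<and> 0 \<le> y" by blast
    qed
  qed
qed auto

text \<open>The equation \<open>- (e\<^bsup>-\<gamma>t\<^esup> V')' = e\<^bsup>-t\<^esup> g V\<close> as a first-order system with \<open>P = e\<^bsup>-\<gamma>t\<^esup> V'\<close>.\<close>

definition emden :: "(real \<Rightarrow> real) \<Rightarrow> real \<Rightarrow> real \<Rightarrow> (real \<Rightarrow> real) \<Rightarrow> (real \<Rightarrow> real) \<Rightarrow> real \<Rightarrow> bool" where
  "emden g \<gamma> T V P a \<longleftrightarrow>
     (\<forall>t>T. (V has_real_derivative exp (\<gamma> * t) * P t) (at t) \<and>
            (P has_real_derivative - (exp (- t) * g (V t))) (at t)) \<and>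
     (V \<longlongrightarrow> a) at_top \<and> (P \<longlongrightarrow> 0) at_top"

lemma emden_mono: "emden g \<gamma> T V P a \<Longrightarrow> T \<le> T' \<Longrightarrow> emden g \<gamma> T' V P a"
  by (auto simp: emden_def)

lemma tendsto_exp_neg_mult_at_top:
  fixes c :: real
  assumes "c > 0"
  shows "((\<lambda>t. exp (- (c * t))) \<longlongrightarrow> 0) at_top"
proof -
  have "filterlim (\<lambda>t. c * t) at_top at_top"
    using assms by (intro filterlim_tendsto_pos_mult_at_top[OF tendsto_const]) (auto simp: filterlim_ident)
  then have "filterlim (\<lambda>t. - (c * t)) at_bot at_top"
    by (rule filterlim_uminus_at_top[THEN iffD1])
  then show ?thesis by (rule filterlim_compose[OF exp_at_bot])
qed

text \<open>Integration of |P'| \<le> F e^(-t) from infinity, in derivative form: P - F e^(-t) and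
  -P - F e^(-t) are both nondecreasing with limit 0.\<close>

lemma emden_decay:
  assumes e: "emden g \<gamma> T V P a" and b: "\<And>t. t > T \<Longrightarrow> \<bar>g (V t)\<bar> \<le> F" and t: "t > T"
  shows "\<bar>P t\<bar> \<le> F * exp (- t)"
proof -
  have ex: "((\<lambda>t. F * exp (- t)) \<longlongrightarrow> 0) at_top"
    using tendsto_mult_right_zero[OF tendsto_exp_neg_mult_at_top[of 1], of F] by simp
  have P: "(P \<longlongrightarrow> 0) at_top" using e by (simp add: emden_def)
  have F: "exp (-t) * (g (V t)) \<le> exp (-t) * F" "exp (-t) * (- F) \<le> exp (-t) * (g (V t))"
    if "t > T" for t
  proof -
    have "g (V t) \<le> F" "- F \<le> g (V t)" using b[OF that] by linarith+
    then show "exp (-t) * (g (V t)) \<le> exp (-t) * F" "exp (-t) * (- F) \<le> exp (-t) * (g (V t))"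
      by (intro mult_left_mono; simp)+
  qed
  have "P t - F * exp (- t) \<le> 0 - 0"
  proof (rule DERIV_nonneg_imp_le_limit[where T = T and h = "\<lambda>t. P t - F * exp (- t)"])
    show "((\<lambda>t. P t - F * exp (- t)) \<longlongrightarrow> 0 - 0) at_top" by (intro tendsto_diff P ex)
    fix s assume "s > T"
    then show "((\<lambda>t. P t - F * exp (- t)) has_real_derivative - (exp (- s) * g (V s)) + F * exp (- s)) (at s)"
      using e by (auto simp: emden_def intro!: derivative_eq_intros)
    show "0 \<le> - (exp (- s) * g (V s)) + F * exp (- s)" using F[OF \<open>s > T\<close>] by (simp add: mult.commute)
  qed fact
  moreover have "- P t - F * exp (- t) \<le> - 0 - 0"
  proof (rule DERIV_nonneg_imp_le_limit[where T = T and h = "\<lambda>t. - P t - F * exp (- t)"])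
    show "((\<lambda>t. - P t - F * exp (- t)) \<longlongrightarrow> - 0 - 0) at_top" by (intro tendsto_diff tendsto_minus P ex)
    fix s assume "s > T"
    then show "((\<lambda>t. - P t - F * exp (- t)) has_real_derivative (exp (- s) * g (V s)) + F * exp (- s)) (at s)"
      using e by (auto simp: emden_def intro!: derivative_eq_intros)
    show "0 \<le> (exp (- s) * g (V s)) + F * exp (- s)" using F[OF \<open>s > T\<close>] by (simp add: mult.commute)
  qed fact
  ultimately show ?thesis by linarith
qed

text \<open>The energy \<open>e\<^bsup>(1+\<gamma>)t\<^esup> P\<^sup>2 / 2 + G V\<close> is nondecreasing and tends to \<open>G a\<close>.\<close>

lemma emden_energy:
  assumes e: "emden g \<gamma> T V P a" and b: "\<And>t. t > T \<Longrightarrow> \<bar>g (V t)\<bar> \<le> F"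
    and G: "\<And>w. (G has_real_derivative g w) (at w)" and \<gamma>: "0 \<le> \<gamma>" "\<gamma> < 1" and t: "t > T"
  shows "G (V t) \<le> G a"
proof -
  define E where "E t = exp ((1 + \<gamma>) * t) * (P t)\<^sup>2 / 2 + G (V t)" for t
  have "E t \<le> 0 / 2 + G a"
  proof (rule DERIV_nonneg_imp_le_limit[where T = T and h = E])
    \<comment> \<open>The decay of \<open>P\<close> bounds this term by F^2 e^(-(1-\<gamma>)t),
      which is where \<gamma> < 1 enters.\<close>
    have "((\<lambda>t. exp ((1 + \<gamma>) * t) * (P t)\<^sup>2) \<longlongrightarrow> 0) at_top"
    proof (rule Lim_null_comparison)
      show "\<forall>\<^sub>F t in at_top. norm (exp ((1 + \<gamma>) * t) * (P t)\<^sup>2) \<le> F\<^sup>2 * exp (- ((1 - \<gamma>) * t))"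
        using eventually_gt_at_top[of T]
      proof eventually_elim
        case (elim t)
        have "(P t)\<^sup>2 \<le> (F * exp (- t))\<^sup>2" using emden_decay[OF e b elim] by (metis abs_ge_zero power2_abs power_mono)
        then have "exp ((1 + \<gamma>) * t) * (P t)\<^sup>2 \<le> exp ((1 + \<gamma>) * t) * (F * exp (- t))\<^sup>2" by simp
        also have "\<dots> = F\<^sup>2 * (exp ((1 + \<gamma>) * t) * (exp (- t))\<^sup>2)" by (simp add: power_mult_distrib)
        also have "exp ((1 + \<gamma>) * t) * (exp (- t))\<^sup>2 = exp (- ((1 - \<gamma>) * t))"
          by (simp add: exp_double[symmetric] mult_exp_exp algebra_simps)
        finally show ?case by simp
      qed
      show "((\<lambda>t. F\<^sup>2 * exp (- ((1 - \<gamma>) * t))) \<longlongrightarrow> 0) at_top"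
        using \<gamma> by (intro tendsto_mult_right_zero tendsto_exp_neg_mult_at_top) simp
    qed
    moreover have "((\<lambda>t. G (V t)) \<longlongrightarrow> G a) at_top"
      using e DERIV_isCont[OF G] by (auto simp: emden_def intro: isCont_tendsto_compose)
    ultimately show "(E \<longlongrightarrow> 0 / 2 + G a) at_top" unfolding E_def by (intro tendsto_intros) auto
    fix s assume s: "s > T"
    have dV: "(V has_real_derivative exp (\<gamma> * s) * P s) (at s)"
      and dP: "(P has_real_derivative - (exp (- s) * g (V s))) (at s)"
      using e s by (auto simp: emden_def)
    have dG: "((\<lambda>s. G (V s)) has_real_derivative g (V s) * (exp (\<gamma> * s) * P s)) (at s)"
      by (rule DERIV_chain2[OF G dV])
    \<comment> \<open>The exponent 1+\<gamma> is dictated by cancellation: the factor e^(-t) in P'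
      turns the weight into e^(\<gamma>t), so the cross term cancels the derivative of
      \<open>G (V s)\<close>.\<close>
    have "((\<lambda>t. exp ((1 + \<gamma>) * t) * (P t)\<^sup>2) has_real_derivative
        (1 + \<gamma>) * exp ((1 + \<gamma>) * s) * (P s)\<^sup>2 - 2 * (exp (\<gamma> * s) * g (V s) * P s)) (at s)"
      by (rule derivative_eq_intros dP refl)+ (simp add: algebra_simps exp_add exp_minus)
    from DERIV_add[OF DERIV_cdivide[OF this, of 2] dG]
    show "(E has_real_derivative (1 + \<gamma>) / 2 * exp ((1 + \<gamma>) * s) * (P s)\<^sup>2) (at s)"
      unfolding E_def
      by (rule DERIV_cong) (simp add: algebra_simps diff_divide_distrib)
    show "0 \<le> (1 + \<gamma>) / 2 * exp ((1 + \<gamma>) * s) * (P s)\<^sup>2" using \<gamma> by simp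
  qed fact
  moreover have "exp ((1 + \<gamma>) * t) * (P t)\<^sup>2 / 2 \<ge> 0" by simp
  ultimately show ?thesis unfolding E_def by linarith
qed

text \<open>Any a priori bound \<open>M\<close> improves itself to the limit value, because the
  potential |w|^(q+2) / (q+2) increases with |w|. After normalisation to limit 1 all solutions lie
  in [-1,1], where the nonlinearity is Lipschitz.\<close>

lemma emden_abs_le:
  assumes e: "emden (signed_powr q) \<gamma> T V P a" and b: "\<And>t. t > T \<Longrightarrow> \<bar>V t\<bar> \<le> M"
    and q: "q > 0" and \<gamma>: "0 \<le> \<gamma>" "\<gamma> < 1" and t: "t > T"
  shows "\<bar>V t\<bar> \<le> \<bar>a\<bar>"
proof -
  have "\<bar>V t\<bar> powr (q + 2) / (q + 2) \<le> \<bar>a\<bar> powr (q + 2) / (q + 2)"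
    using q by (intro emden_energy[OF e signed_powr_abs_le[OF _ b] DERIV_abs_powr \<gamma> t]) auto
  then have "\<bar>V t\<bar> powr (q + 2) \<le> \<bar>a\<bar> powr (q + 2)"
    using q by (simp add: divide_le_cancel)
  then show ?thesis using q powr_less_mono2[of "q+2" "\<bar>a\<bar>" "\<bar>V t\<bar>"] by linarith
qed

section \<open>Comparison of solutions from infinity\<close>

lemma abs_exp_minus_one_le: "\<bar>exp x - 1\<bar> \<le> \<bar>x\<bar> * exp \<bar>x\<bar>" for x :: real
proof (cases "x \<ge> 0")
  case True
  have "1 - x \<le> exp (- x)" using exp_ge_add_one_self[of "-x"] by simp
  then have "exp x * (1 - x) \<le> exp x * exp (-x)" by (intro mult_left_mono) auto
  then show ?thesis using True by (simp add: mult_exp_exp algebra_simps)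
next
  case False
  have "1 + x \<le> exp x" by simp
  moreover have "exp x < 1" using False by simp
  moreover have "- x * 1 \<le> - x * exp (- x)" using False by (intro mult_left_mono) auto
  ultimately have "1 - exp x \<le> - x * exp (- x)" by linarith
  then show ?thesis using False by simp
qed

text \<open>Although e^(\<gamma>t) - 1 is not small for large t, multiplied by the decay e^(-t) of
  the momentum it is \<gamma> times an integrable function.\<close>

lemma abs_exp_mult_minus_one_le:
  fixes T :: real
  obtains C where "C \<ge> 0"
    "\<And>\<gamma> t. 0 \<le> \<gamma> \<Longrightarrow> \<gamma> \<le> 1/4 \<Longrightarrow> T \<le> t \<Longrightarrow> \<bar>exp (\<gamma> * t) - 1\<bar> * exp (- t) \<le> \<gamma> * C * exp (- t / 2)"
proof
  \<comment> \<open>The 4 serves t \<ge> 0: t \<le> 4 e^(t/4) and e^(\<gamma>t) \<le> e^(t/4)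
    together absorb e^(-t/2), whence \<gamma> \<le> 1/4. The second summand serves T \<le> t <
    0.\<close>
  define C where "C = 4 + \<bar>T\<bar> * exp \<bar>T\<bar> * exp (\<bar>T\<bar> / 2)"
  show "C \<ge> 0" by (auto simp: C_def)
  fix \<gamma> t :: real assume \<gamma>: "0 \<le> \<gamma>" "\<gamma> \<le> 1/4" and t: "T \<le> t"
  have "\<bar>exp (\<gamma> * t) - 1\<bar> * exp (- t) \<le> (\<bar>\<gamma> * t\<bar> * exp \<bar>\<gamma> * t\<bar>) * exp (- t)"
    by (intro mult_right_mono abs_exp_minus_one_le) auto
  also have "\<dots> = \<gamma> * ((\<bar>t\<bar> * exp (\<gamma> * \<bar>t\<bar>) * exp (- t / 2)) * exp (- t / 2))"
    using \<gamma> by (simp add: abs_mult mult_exp_exp)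
  also have "\<bar>t\<bar> * exp (\<gamma> * \<bar>t\<bar>) * exp (- t / 2) \<le> C"
  proof (cases "t \<ge> 0")
    case True
    have "t / 4 \<le> exp (t / 4)" using exp_ge_add_one_self[of "t/4"] by linarith
    then have "t \<le> 4 * exp (t / 4)" by simp
    moreover have "exp (\<gamma> * t) \<le> exp (t / 4)" using True \<gamma> mult_right_mono[of \<gamma> "1/4" t] by simp
    ultimately have "t * exp (\<gamma> * t) * exp (- t / 2) \<le> (4 * exp (t / 4)) * exp (t / 4) * exp (- t / 2)"
      using True by (intro mult_right_mono mult_mono) auto
    also have "\<dots> = 4" by (simp add: mult_exp_exp)
    also have "\<dots> \<le> C" by (auto simp: C_def)
    finally show ?thesis using True by simp
  next
    case False
    have "\<gamma> * \<bar>t\<bar> \<le> 1 * \<bar>T\<bar>" using \<gamma> t False by (intro mult_mono) auto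
    then have "\<bar>t\<bar> * exp (\<gamma> * \<bar>t\<bar>) * exp (- t / 2) \<le> \<bar>T\<bar> * exp \<bar>T\<bar> * exp (\<bar>T\<bar> / 2)"
      using t False by (intro mult_mono mult_nonneg_nonneg) auto
    then show ?thesis unfolding C_def by linarith
  qed
  then have "\<gamma> * ((\<bar>t\<bar> * exp (\<gamma> * \<bar>t\<bar>) * exp (- t / 2)) * exp (- t / 2)) \<le> \<gamma> * (C * exp (- t / 2))"
    using \<gamma> by (intro mult_left_mono mult_right_mono) auto
  finally show "\<bar>exp (\<gamma> * t) - 1\<bar> * exp (- t) \<le> \<gamma> * C * exp (- t / 2)" by simp
qed

text \<open>The weighted distance \<open>Q = (V - W)\<^sup>2 + e\<^sup>t (P - R)\<^sup>2\<close> tends to \<open>0\<close> at infinity and satisfies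
  \<open>Q' \<ge> - e\<^bsup>-t/2\<^esup> (B Q + \<gamma> C)\<close>, so Gronwall's argument can be run backwards from infinity. The weight
  \<open>e\<^sup>t\<close> is needed for the term \<open>(V - W)(P - R)\<close> to be integrable.\<close>

lemma emden_comparison:
  fixes g :: "real \<Rightarrow> real" and T L :: real
  assumes L: "L \<ge> 0"
  shows "\<exists>C\<ge>0. \<forall>\<gamma> T' V P W R a. 0 \<le> \<gamma> \<and> \<gamma> \<le> 1/4 \<and> T \<le> T' \<and> emden g \<gamma> T' V P a \<and> emden g 0 T' W R a \<and>
       (\<forall>t>T'. \<bar>g (V t)\<bar> \<le> 1 \<and> \<bar>g (W t)\<bar> \<le> 1 \<and> \<bar>g (V t) - g (W t)\<bar> \<le> L * \<bar>V t - W t\<bar>) \<longrightarrow>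
       (\<forall>t>T'. (V t - W t)\<^sup>2 + exp t * (P t - R t)\<^sup>2 \<le> \<gamma> * C)"
proof -
  obtain C where C: "C \<ge> 0" "\<And>\<gamma> t. 0 \<le> \<gamma> \<Longrightarrow> \<gamma> \<le> 1/4 \<Longrightarrow> T \<le> t \<Longrightarrow>
      \<bar>exp (\<gamma> * t) - 1\<bar> * exp (- t) \<le> \<gamma> * C * exp (- t / 2)"
    using abs_exp_mult_minus_one_le[of T] by blast
  \<comment> \<open>\<open>B\<close> collects the coefficients of \<open>Q\<close> in the
    differential inequality: 1 + L from the two cross terms, C from \<open>\<eta> * Q t\<close> with
    \<gamma> \<le> 1. In \<open>D\<close>, the factor 2 C e^(-T/2) is the integral of the
    inhomogeneity per unit of \<gamma>, and the last exponential undoes the integrating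
    factor.\<close>
  define B where "B = 1 + L + C"
  define D where "D = 2 * C * exp (- T / 2) * exp (2 * B * exp (- T / 2))"
  have B: "B \<ge> 0" using L C by (simp add: B_def)
  have main: "(V t - W t)\<^sup>2 + exp t * (P t - R t)\<^sup>2 \<le> \<gamma> * D"
    if \<gamma>: "0 \<le> \<gamma>" "\<gamma> \<le> 1/4" and T': "T \<le> T'" and eV: "emden g \<gamma> T' V P a" and eW: "emden g 0 T' W R a"
      and gV: "\<And>t. t > T' \<Longrightarrow> \<bar>g (V t)\<bar> \<le> 1" and gW: "\<And>t. t > T' \<Longrightarrow> \<bar>g (W t)\<bar> \<le> 1"
      and lip: "\<And>t. t > T' \<Longrightarrow> \<bar>g (V t) - g (W t)\<bar> \<le> L * \<bar>V t - W t\<bar>" and t: "t > T'"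
    for \<gamma> T' V P W R a t
  proof -
    define Q where "Q t = (V t - W t)\<^sup>2 + exp t * (P t - R t)\<^sup>2" for t
    define Q' where "Q' t = 2 * (V t - W t) * (exp (\<gamma> * t) * P t - R t) + exp t * (P t - R t)\<^sup>2
        - 2 * (P t - R t) * (g (V t) - g (W t))" for t
    have dQ: "(Q has_real_derivative Q' t) (at t)" if "t > T'" for t
    proof -
      have d: "(V has_real_derivative exp (\<gamma> * t) * P t) (at t)"
        "(P has_real_derivative - (exp (- t) * g (V t))) (at t)"
        "(W has_real_derivative R t) (at t)"
        "(R has_real_derivative - (exp (- t) * g (W t))) (at t)"
        using eV eW that by (auto simp: emden_def)
      show ?thesis unfolding Q_def Q'_def
        by (rule derivative_eq_intros d refl)+ (simp add: exp_minus field_simps)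
    qed
    have decP: "\<bar>P t\<bar> \<le> exp (- t)" and decR: "\<bar>R t\<bar> \<le> exp (- t)" if "t > T'" for t
      using emden_decay[OF eV gV that] emden_decay[OF eW gW that] by auto
    have Q'_ge: "Q' t \<ge> - (B * exp (- t / 2) * Q t + \<gamma> * C * exp (- t / 2))" if "t > T'" for t
    proof -
      define \<phi> where "\<phi> = \<bar>V t - W t\<bar>"
      define \<psi> where "\<psi> = \<bar>P t - R t\<bar>"
      define \<eta> where "\<eta> = \<gamma> * C * exp (- t / 2)"
      have nn: "\<phi> \<ge> 0" "\<psi> \<ge> 0" "\<eta> \<ge> 0" using \<gamma> C by (auto simp: \<phi>_def \<psi>_def \<eta>_def)
      have Q: "Q t = \<phi>\<^sup>2 + exp t * \<psi>\<^sup>2" by (simp add: Q_def \<phi>_def \<psi>_def)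
      have prod: "2 * (\<phi> * \<psi>) \<le> exp (- t / 2) * Q t"
      proof -
        have "0 \<le> (\<phi> - exp (t / 2) * \<psi>)\<^sup>2" by simp
        also have "\<dots> = \<phi>\<^sup>2 + exp t * \<psi>\<^sup>2 - exp (t / 2) * (2 * (\<phi> * \<psi>))"
          by (simp add: power2_diff power_mult_distrib exp_double[symmetric])
        finally have "exp (t / 2) * (2 * (\<phi> * \<psi>)) \<le> Q t" by (simp add: Q)
        then have "exp (- t / 2) * (exp (t / 2) * (2 * (\<phi> * \<psi>))) \<le> exp (- t / 2) * Q t"
          by (intro mult_left_mono) auto
        then show ?thesis by (simp add: mult_exp_exp mult.assoc[symmetric])
      qed
      have "\<bar>exp (\<gamma> * t) * P t - R t\<bar> \<le> \<psi> + \<bar>(exp (\<gamma> * t) - 1) * P t\<bar>"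
        unfolding \<psi>_def by (simp add: algebra_simps)
      also have "\<bar>(exp (\<gamma> * t) - 1) * P t\<bar> \<le> \<bar>exp (\<gamma> * t) - 1\<bar> * exp (- t)"
        unfolding abs_mult by (intro mult_left_mono decP that) auto
      also have "\<dots> \<le> \<eta>" unfolding \<eta>_def using C \<gamma> that T' by auto
      finally have "\<bar>(V t - W t) * (exp (\<gamma> * t) * P t - R t)\<bar> \<le> \<phi> * (\<psi> + \<eta>)"
        unfolding abs_mult \<phi>_def by (intro mult_left_mono) auto
      moreover have "\<bar>(P t - R t) * (g (V t) - g (W t))\<bar> \<le> \<psi> * (L * \<phi>)"
        unfolding abs_mult \<phi>_def \<psi>_def using lip[OF that] by (intro mult_left_mono) auto
      moreover have "exp t * (P t - R t)\<^sup>2 \<ge> 0" by simp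
      ultimately have "Q' t \<ge> - (2 * (\<phi> * (\<psi> + \<eta>)) + 2 * (\<psi> * (L * \<phi>)))"
        unfolding Q'_def by linarith
      moreover have "2 * (\<phi> * (\<psi> + \<eta>)) + 2 * (\<psi> * (L * \<phi>)) = (1 + L) * (2 * (\<phi> * \<psi>)) + \<eta> * (2 * \<phi>)"
        by (simp add: algebra_simps)
      moreover have "(1 + L) * (2 * (\<phi> * \<psi>)) \<le> (1 + L) * (exp (- t / 2) * Q t)"
        using L prod by (intro mult_left_mono) auto
      moreover have "\<eta> * (2 * \<phi>) \<le> \<eta> * (Q t + 1)"
      proof -
        have "0 \<le> (\<phi> - 1)\<^sup>2" by simp
        then have "2 * \<phi> \<le> \<phi>\<^sup>2 + 1" by (simp add: power2_diff)
        moreover have "0 \<le> exp t * \<psi>\<^sup>2" by simp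
        ultimately have "2 * \<phi> \<le> Q t + 1" unfolding Q by linarith
        then show ?thesis using nn by (intro mult_left_mono) auto
      qed
      moreover have "\<eta> * Q t \<le> C * exp (- t / 2) * Q t"
      proof -
        have "0 \<le> Q t" by (simp add: Q)
        moreover have "\<gamma> * C \<le> 1 * C" using \<gamma> C by (intro mult_right_mono) auto
        ultimately show ?thesis unfolding \<eta>_def by (intro mult_right_mono) auto
      qed
      ultimately show ?thesis unfolding B_def \<eta>_def by (simp add: algebra_simps)
    qed
    \<comment> \<open>\<open>H\<close> is the integrating factor, H' = B e^(-t/2) H. As H \<le> 1,
      the subtracted term of \<open>S\<close> absorbs the inhomogeneity, so \<open>S\<close> is
      nondecreasing with limit 0.\<close>
    define H where "H t = exp (- (2 * B * exp (- t / 2)))" for t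
    define S where "S t = Q t * H t - 2 * \<gamma> * C * exp (- t / 2)" for t
    have e2: "((\<lambda>t::real. exp (- t / 2)) \<longlongrightarrow> 0) at_top"
      using tendsto_exp_neg_mult_at_top[of "1/2"] by simp
    have "S t \<le> 0 * exp (- (2 * B * 0)) - 2 * \<gamma> * C * 0"
    proof (rule DERIV_nonneg_imp_le_limit[where T = T' and h = S])
      have "((\<lambda>t. exp t * (P t - R t)\<^sup>2) \<longlongrightarrow> 0) at_top"
      proof (rule Lim_null_comparison)
        show "\<forall>\<^sub>F t in at_top. norm (exp t * (P t - R t)\<^sup>2) \<le> 4 * exp (- (1 * t))"
          using eventually_gt_at_top[of T']
        proof eventually_elim
          case (elim t)
          have "\<bar>P t - R t\<bar> \<le> 2 * exp (- t)" using decP[OF elim] decR[OF elim] by linarith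
          then have "(P t - R t)\<^sup>2 \<le> (2 * exp (- t))\<^sup>2" by (metis abs_ge_zero power2_abs power_mono)
          then have "exp t * (P t - R t)\<^sup>2 \<le> exp t * (2 * exp (- t))\<^sup>2" by simp
          also have "\<dots> = 4 * exp (- t)" by (simp add: power2_eq_square exp_minus field_simps)
          finally show ?case by simp
        qed
        show "((\<lambda>t::real. 4 * exp (- (1 * t))) \<longlongrightarrow> 0) at_top"
          by (intro tendsto_mult_right_zero tendsto_exp_neg_mult_at_top) simp
      qed
      moreover have "((\<lambda>t. (V t - W t)\<^sup>2) \<longlongrightarrow> (a - a)\<^sup>2) at_top"
        using eV eW by (intro tendsto_intros) (auto simp: emden_def)
      ultimately have "(Q \<longlongrightarrow> (a - a)\<^sup>2 + 0) at_top" unfolding Q_def by (intro tendsto_add)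
      then have "(Q \<longlongrightarrow> 0) at_top" by simp
      then show "(S \<longlongrightarrow> 0 * exp (- (2 * B * 0)) - 2 * \<gamma> * C * 0) at_top"
        unfolding S_def H_def by (intro tendsto_intros e2)
      fix s assume s: "s > T'"
      have dH: "(H has_real_derivative H s * (B * exp (- s / 2))) (at s)"
        unfolding H_def by (auto intro!: derivative_eq_intros)
      show "(S has_real_derivative (Q' s + B * exp (- s / 2) * Q s) * H s + \<gamma> * C * exp (- s / 2)) (at s)"
        unfolding S_def by (auto intro!: derivative_eq_intros dQ[OF s] dH simp: algebra_simps)
      have "- (\<gamma> * C * exp (- s / 2)) * H s \<le> (Q' s + B * exp (- s / 2) * Q s) * H s"
        using Q'_ge[OF s] by (intro mult_right_mono) (auto simp: H_def)
      moreover have "\<gamma> * C * exp (- s / 2) * H s \<le> \<gamma> * C * exp (- s / 2) * 1"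
        using \<gamma> C B by (intro mult_left_mono) (auto simp: H_def)
      ultimately show "0 \<le> (Q' s + B * exp (- s / 2) * Q s) * H s + \<gamma> * C * exp (- s / 2)" by simp
    qed fact
    then have "Q t * H t \<le> 2 * \<gamma> * C * exp (- t / 2)" by (simp add: S_def)
    then have "Q t * H t * exp (2 * B * exp (- t / 2)) \<le> 2 * \<gamma> * C * exp (- t / 2) * exp (2 * B * exp (- t / 2))"
      by (intro mult_right_mono) auto
    then have "Q t \<le> 2 * \<gamma> * C * exp (- t / 2) * exp (2 * B * exp (- t / 2))"
      by (simp add: H_def mult.assoc mult_exp_exp)
    also have "\<dots> \<le> 2 * \<gamma> * C * exp (- T / 2) * exp (2 * B * exp (- T / 2))"
      using t T' \<gamma> C B by (intro mult_mono mult_left_mono iffD2[OF exp_le_cancel_iff]) auto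
    finally show ?thesis unfolding Q_def D_def by (simp add: mult_ac)
  qed
  have "D \<ge> 0" using C by (simp add: D_def)
  then show ?thesis by (intro exI[of _ D]) (auto intro!: main)
qed

text \<open>The constant depends on \<open>q\<close> and the lower bound \<open>T\<close> alone, not
  on the actual start \<open>T'\<close>: when the estimate is applied, the starting zeros are not
  yet under control.\<close>

lemma signed_powr_comparison:
  fixes q T :: real
  assumes q: "q > 0"
  shows "\<exists>C\<ge>0. \<forall>\<gamma> T' V P W R a. 0 \<le> \<gamma> \<and> \<gamma> \<le> 1/4 \<and> T \<le> T' \<and> emden (signed_powr q) \<gamma> T' V P a \<and>
       emden (signed_powr q) 0 T' W R a \<and> (\<forall>t>T'. \<bar>V t\<bar> \<le> 1 \<and> \<bar>W t\<bar> \<le> 1) \<longrightarrow>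
       (\<forall>t>T'. (V t - W t)\<^sup>2 + exp t * (P t - R t)\<^sup>2 \<le> \<gamma> * C)"
proof -
  have sp: "\<bar>signed_powr q x\<bar> \<le> 1" if "\<bar>x\<bar> \<le> 1" for x
    using signed_powr_abs_le[of q x 1] q that by simp
  have "0 \<le> q + 1" using q by simp
  from emden_comparison[OF this, where g = "signed_powr q" and T = T]
  obtain C where "C \<ge> 0" and C: "\<And>\<gamma> T' V P W R a. 0 \<le> \<gamma> \<and> \<gamma> \<le> 1/4 \<and> T \<le> T' \<and> emden (signed_powr q) \<gamma> T' V P a \<and>
       emden (signed_powr q) 0 T' W R a \<and>
       (\<forall>t>T'. \<bar>signed_powr q (V t)\<bar> \<le> 1 \<and> \<bar>signed_powr q (W t)\<bar> \<le> 1 \<and>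
          \<bar>signed_powr q (V t) - signed_powr q (W t)\<bar> \<le> (q + 1) * \<bar>V t - W t\<bar>) \<longrightarrow>
       (\<forall>t>T'. (V t - W t)\<^sup>2 + exp t * (P t - R t)\<^sup>2 \<le> \<gamma> * C)"
    by blast
  show ?thesis
  proof (intro exI[of _ C] conjI allI impI \<open>C \<ge> 0\<close>, elim conjE)
    fix \<gamma> T' V P W R a t
    assume "0 \<le> \<gamma>" "\<gamma> \<le> 1/4" "T \<le> T'" "emden (signed_powr q) \<gamma> T' V P a" "emden (signed_powr q) 0 T' W R a"
      "\<forall>t>T'. \<bar>V t\<bar> \<le> 1 \<and> \<bar>W t\<bar> \<le> 1" "T' < t"
    then show "(V t - W t)\<^sup>2 + exp t * (P t - R t)\<^sup>2 \<le> \<gamma> * C"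
      using C[of \<gamma> T' V P a W R] sp signed_powr_Lipschitz[OF q] by blast
  qed
qed

text \<open>For \<gamma> = 0 the right-hand side of the comparison estimate vanishes.\<close>

lemma emden_unique:
  assumes q: "q > 0" and eV: "emden (signed_powr q) 0 T V P 1" and eW: "emden (signed_powr q) 0 T W R 1"
    and V: "\<And>t. t > T \<Longrightarrow> \<bar>V t\<bar> \<le> 1" and W: "\<And>t. t > T \<Longrightarrow> \<bar>W t\<bar> \<le> 1" and t: "t > T"
  shows "V t = W t"
proof -
  have "(V t - W t)\<^sup>2 + exp t * (P t - R t)\<^sup>2 \<le> 0"
    using signed_powr_comparison[OF q, of T] assms by (metis mult_zero_left order_refl zero_le_divide_1_iff zero_le_numeral)
  moreover have "exp t * (P t - R t)\<^sup>2 \<ge> 0" by simp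
  ultimately have "(V t - W t)\<^sup>2 \<le> 0" by linarith
  then show ?thesis by simp
qed

section \<open>The limit profile and its zeros\<close>

text \<open>In the variable \<open>x = e\<^bsup>-t\<^esup>\<close> the problem \<open>- W'' = e\<^bsup>-t\<^esup> g W\<close>, \<open>W(\<infinity>) = 1\<close> reads
  \<open>(x y')' = - g y\<close>, \<open>y(0) = 1\<close>, that is \<open>y' x = - \<integral>\<^sub>0\<^sup>1 g (y (\<theta> x)) d\<theta>\<close>. The fixed point is
  sought in the form \<open>y x = e\<^bsup>k|x|\<^esup> z x\<close> with bounded \<open>z\<close>, which makes the integral operator a contraction.\<close>

lemma emden_fixed_point:
  fixes g :: "real \<Rightarrow> real" and L :: real
  assumes L: "L > 0" and g: "continuous_on UNIV g" and g1: "\<And>x. \<bar>g x\<bar> \<le> 1"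
    and lip: "\<And>x y. \<bar>g x - g y\<bar> \<le> L * \<bar>x - y\<bar>"
  obtains y :: "real \<Rightarrow> real" where "continuous_on UNIV y"
    "\<And>x. x \<ge> 0 \<Longrightarrow> y x = 1 - integral {0..x} (\<lambda>s. integral {0..1} (\<lambda>\<theta>. g (y (\<theta> * s))))"
proof -
  \<comment> \<open>The integral of L e^(ks) over [0,x] is at most (L/k) e^(kx), so this choice
    gives the contraction factor 1/2.\<close>
  define k where "k = 2 * L"
  have k: "k > 0" using L by (simp add: k_def)
  define m where "m z s = integral {0..1} (\<lambda>\<theta>. g (exp (k * \<bar>\<theta> * s\<bar>) * z (\<theta> * s)))" for z s
  \<comment> \<open>Using |x| extends the problem evenly to the whole line, so Banach's theorem can
    be applied on the bounded continuous functions on the reals.\<close>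
  define \<Phi> where "\<Phi> z x = exp (- (k * \<bar>x\<bar>)) * (1 - integral {0..\<bar>x\<bar>} (m z))" for z x
  have cont_y: "continuous_on S (\<lambda>x. g (exp (k * \<bar>h x\<bar>) * z (h x)))"
    if "continuous_on UNIV z" "continuous_on S h" for z h and S :: "'b::topological_space set"
    by (intro continuous_intros continuous_on_compose2[OF g] continuous_on_compose2[OF that(1)] that(2)) auto
  have cont_m: "continuous_on S (m z)" if "continuous_on UNIV z" for z S
  proof -
    have "continuous_on UNIV (\<lambda>s. integral (cbox 0 1) (\<lambda>\<theta>. g (exp (k * \<bar>\<theta> * s\<bar>) * z (\<theta> * s))))"
      by (rule integral_continuous_on_param) (auto simp: split_def intro!: cont_y[OF that] continuous_intros)
    then show ?thesis unfolding m_def by (auto intro: continuous_on_subset)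
  qed
  have int_y: "(\<lambda>\<theta>. g (exp (k * \<bar>\<theta> * s\<bar>) * z (\<theta> * s))) integrable_on {0..1}" if "continuous_on UNIV z" for z s
    by (intro integrable_continuous_interval cont_y[OF that] continuous_intros)
  have int_m: "m z integrable_on {a..b}" if "continuous_on UNIV z" for z a b
    by (intro integrable_continuous_interval cont_m[OF that])
  have m1: "\<bar>m z s\<bar> \<le> 1" if "continuous_on UNIV z" for z s
  proof -
    have "norm (m z s) \<le> integral {0..1::real} (\<lambda>\<theta>. 1::real)" unfolding m_def
      using g1 by (intro integral_norm_bound_integral int_y[OF that]) auto
    then show ?thesis by simp
  qed
  have bc: "\<Phi> z \<in> bcontfun" if z: "continuous_on UNIV z" for z
  proof (rule bcontfun_normI)
    have *: "continuous_on {0..} (\<lambda>x. integral {0..x} (m z))"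
      unfolding continuous_on_eq_continuous_within
    proof (rule ballI)
      fix x :: real assume "x \<in> {0..}"
      then have "continuous (at x within {0..x+1}) (\<lambda>x. integral {0..x} (m z))"
        using indefinite_integral_continuous_1[OF int_m[OF z, of 0 "x+1"]]
        by (simp add: continuous_on_eq_continuous_within)
      moreover have "at x within {0..x+1} = at x within {0..}"
        by (rule at_within_nhd[where S = "{..<x+1}"]) auto
      ultimately show "continuous (at x within {0..}) (\<lambda>x. integral {0..x} (m z))"
        by (simp add: continuous_within)
    qed
    show "continuous_on UNIV (\<Phi> z)" unfolding \<Phi>_def
      by (intro continuous_intros continuous_on_compose2[OF *]) auto
    fix x :: real
    have "norm (integral {0..\<bar>x\<bar>} (m z)) \<le> integral {0..\<bar>x\<bar>} (\<lambda>_. 1::real)"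
      using m1[OF z] by (intro integral_norm_bound_integral int_m[OF z]) auto
    then have "\<bar>1 - integral {0..\<bar>x\<bar>} (m z)\<bar> \<le> 1 + \<bar>x\<bar>" by simp
    moreover have "1 + k * \<bar>x\<bar> \<le> exp (k * \<bar>x\<bar>)" by simp
    then have "(1 + 1/k) * (1 + k * \<bar>x\<bar>) \<le> (1 + 1/k) * exp (k * \<bar>x\<bar>)" using k by (intro mult_left_mono) auto
    then have "1 + \<bar>x\<bar> + (k * \<bar>x\<bar> + 1/k) \<le> (1 + 1/k) * exp (k * \<bar>x\<bar>)" using k by (simp add: field_simps)
    then have "1 + \<bar>x\<bar> \<le> (1 + 1/k) * exp (k * \<bar>x\<bar>)" using k
      by (smt (verit) abs_ge_zero divide_nonneg_nonneg mult_nonneg_nonneg)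
    ultimately have "\<bar>1 - integral {0..\<bar>x\<bar>} (m z)\<bar> \<le> (1 + 1/k) * exp (k * \<bar>x\<bar>)" by linarith
    then have "exp (- (k * \<bar>x\<bar>)) * \<bar>1 - integral {0..\<bar>x\<bar>} (m z)\<bar> \<le> exp (- (k * \<bar>x\<bar>)) * ((1 + 1/k) * exp (k * \<bar>x\<bar>))"
      by (intro mult_left_mono) auto
    then show "norm (\<Phi> z x) \<le> 1 + 1/k" by (simp add: \<Phi>_def abs_mult exp_minus field_simps)
  qed
  define F where "F z = Bcontfun (\<Phi> (apply_bcontfun z))" for z
  have cz: "continuous_on UNIV (apply_bcontfun z)" for z :: "real \<Rightarrow>\<^sub>C real"
    using apply_bcontfun[of z] by (simp add: bcontfun_def)
  have F: "apply_bcontfun (F z) = \<Phi> (apply_bcontfun z)" for z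
    unfolding F_def by (intro Bcontfun_inverse bc cz)
  have contr: "dist (F z) (F w) \<le> (1/2) * dist z w" for z w
  proof (rule dist_bound)
    fix x :: real
    define d where "d = dist z w"
    have d: "\<bar>z x - w x\<bar> \<le> d" for x using dist_bounded[of z x w] by (simp add: d_def dist_real_def)
    have mm: "\<bar>m z s - m w s\<bar> \<le> L * (exp (k * s) * d)" if "s \<ge> 0" for s
    proof -
      have "norm (m z s - m w s) = norm (integral {0..1} (\<lambda>\<theta>. g (exp (k * \<bar>\<theta> * s\<bar>) * z (\<theta> * s)) - g (exp (k * \<bar>\<theta> * s\<bar>) * w (\<theta> * s))))"
        unfolding m_def by (simp add: Henstock_Kurzweil_Integration.integral_diff[OF int_y[OF cz] int_y[OF cz]])
      also have "\<dots> \<le> integral {0..1::real} (\<lambda>\<theta>. L * (exp (k * s) * d))"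
      proof (intro integral_norm_bound_integral integrable_diff int_y cz)
        fix \<theta> :: real assume \<theta>: "\<theta> \<in> {0..1}"
        have "norm (g (exp (k * \<bar>\<theta> * s\<bar>) * z (\<theta> * s)) - g (exp (k * \<bar>\<theta> * s\<bar>) * w (\<theta> * s)))
            \<le> L * \<bar>exp (k * \<bar>\<theta> * s\<bar>) * z (\<theta> * s) - exp (k * \<bar>\<theta> * s\<bar>) * w (\<theta> * s)\<bar>"
          using lip by simp
        also have "\<bar>exp (k * \<bar>\<theta> * s\<bar>) * z (\<theta> * s) - exp (k * \<bar>\<theta> * s\<bar>) * w (\<theta> * s)\<bar>
            = exp (k * \<bar>\<theta> * s\<bar>) * \<bar>z (\<theta> * s) - w (\<theta> * s)\<bar>"
          by (simp add: abs_mult right_diff_distrib[symmetric])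
        also have "\<dots> \<le> exp (k * s) * d"
          using \<theta> that k by (intro mult_mono d) (auto simp: abs_mult mult_left_le_one_le)
        finally show "norm (g (exp (k * \<bar>\<theta> * s\<bar>) * z (\<theta> * s)) - g (exp (k * \<bar>\<theta> * s\<bar>) * w (\<theta> * s)))
           \<le> L * (exp (k * s) * d)" using L by simp
      qed auto
      finally show ?thesis by simp
    qed
    have hi: "((\<lambda>s. L * (exp (k * s) * d)) has_integral L / k * d * exp (k * \<bar>x\<bar>) - L / k * d * exp (k * 0)) {0..\<bar>x\<bar>}"
      using k by (intro fundamental_theorem_of_calculus)
        (auto intro!: derivative_eq_intros simp: has_real_derivative_iff_has_vector_derivative[symmetric])
    have "\<Phi> z x - \<Phi> w x = - exp (- (k * \<bar>x\<bar>)) * integral {0..\<bar>x\<bar>} (\<lambda>s. m z s - m w s)"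
      unfolding \<Phi>_def by (simp add: Henstock_Kurzweil_Integration.integral_diff[OF int_m[OF cz] int_m[OF cz]] algebra_simps)
    then have "dist (\<Phi> z x) (\<Phi> w x) = exp (- (k * \<bar>x\<bar>)) * norm (integral {0..\<bar>x\<bar>} (\<lambda>s. m z s - m w s))"
      by (simp add: dist_real_def abs_mult)
    also have "norm (integral {0..\<bar>x\<bar>} (\<lambda>s. m z s - m w s)) \<le> integral {0..\<bar>x\<bar>} (\<lambda>s. L * (exp (k * s) * d))"
      using mm hi by (intro integral_norm_bound_integral integrable_diff int_m cz) auto
    also have "\<dots> = L / k * d * exp (k * \<bar>x\<bar>) - L / k * d * exp (k * 0)"
      using hi by (rule integral_unique)
    also have "\<dots> \<le> L / k * d * exp (k * \<bar>x\<bar>)" using L k by (simp add: d_def)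
    finally have "dist (\<Phi> z x) (\<Phi> w x) \<le> exp (- (k * \<bar>x\<bar>)) * (L / k * d * exp (k * \<bar>x\<bar>))" by simp
    also have "\<dots> = 1/2 * d" using L by (simp add: k_def exp_minus field_simps)
    finally show "dist (F z x) (F w x) \<le> 1/2 * dist z w" by (simp add: F d_def)
  qed
  obtain z where z: "F z = z"
    using banach_fix_type[of "1/2" F] contr by auto
  define y where "y x = exp (k * \<bar>x\<bar>) * z x" for x
  show thesis
  proof (rule that[of y])
    show "continuous_on UNIV y" unfolding y_def by (intro continuous_intros cz)
    fix x :: real assume "x \<ge> 0"
    have "y x = exp (k * \<bar>x\<bar>) * \<Phi> z x" unfolding y_def using F[of z] z by simp
    also have "\<dots> = 1 - integral {0..x} (m z)" using \<open>x \<ge> 0\<close> by (simp add: \<Phi>_def exp_minus)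
    finally show "y x = 1 - integral {0..x} (\<lambda>s. integral {0..1} (\<lambda>\<theta>. g (y (\<theta> * s))))"
      unfolding m_def y_def .
  qed
qed

text \<open>Undoes the substitution x = e^(-t). The momentum is \<open>I\<close> at e^(-t):
  rescaling the average \<open>m\<close> gives x y'(x) = - I(x), and \<open>I\<close> has the
  derivative g(y(x)) directly, so \<open>m\<close> itself need not be differentiated.\<close>

lemma emden_exists:
  fixes g :: "real \<Rightarrow> real" and L :: real
  assumes L: "L > 0" and g: "continuous_on UNIV g" and g1: "\<And>x. \<bar>g x\<bar> \<le> 1"
    and lip: "\<And>x y. \<bar>g x - g y\<bar> \<le> L * \<bar>x - y\<bar>"
  obtains W R where "\<And>T. emden g 0 T W R 1"
proof -
  obtain y :: "real \<Rightarrow> real" where y: "continuous_on UNIV y" and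
    eq: "\<And>x. x \<ge> 0 \<Longrightarrow> y x = 1 - integral {0..x} (\<lambda>s. integral {0..1} (\<lambda>\<theta>. g (y (\<theta> * s))))"
    using emden_fixed_point[OF assms] by blast
  define m where "m s = integral {0..1} (\<lambda>\<theta>. g (y (\<theta> * s)))" for s
  define I where "I x = integral {0..x} (\<lambda>s. g (y s))" for x
  have eqm: "y x = 1 - integral {0..x} m" if "x \<ge> 0" for x
    using eq[OF that] by (simp add: m_def[abs_def])
  have cgy: "continuous_on S (\<lambda>x. g (y (h x)))" if "continuous_on S h" for h and S :: "'b::topological_space set"
    by (intro continuous_on_compose2[OF g] continuous_on_compose2[OF y] that) auto
  have cm: "continuous_on S m" for S
  proof -
    have "continuous_on UNIV (\<lambda>s. integral (cbox 0 1) (\<lambda>\<theta>. g (y (\<theta> * s))))"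
      by (rule integral_continuous_on_param) (auto simp: split_def intro!: cgy continuous_intros)
    then show ?thesis unfolding m_def by (auto intro: continuous_on_subset)
  qed
  have I: "x * m x = I x" if "x > 0" for x
  proof -
    have "((\<lambda>s. g (y s)) has_integral I x) {0..x}" unfolding I_def
      by (intro integrable_integral integrable_continuous_interval cgy continuous_intros)
    from has_integral_stretch_real[OF this, of x] that
    have "((\<lambda>\<theta>. g (y (x * \<theta>))) has_integral 1 / x * I x) ((\<lambda>s. s / x) ` {0..x})" by simp
    also have "(\<lambda>s. s / x) ` {0..x} = {0..1}"
      using that by (auto simp: image_iff intro!: bexI[of _ "_ * x"])
    finally have "m x = 1 / x * I x" unfolding m_def by (simp add: integral_unique mult.commute)
    then show ?thesis using that by simp
  qed
  have at: "at x within {0..x+1} = at x" if "x > 0" for x :: real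
    using that by (intro at_within_interior) auto
  have dy: "(y has_real_derivative - m x) (at x)" if "x > 0" for x
  proof -
    have "((\<lambda>x. 1 - integral {0..x} m) has_real_derivative 0 - m x) (at x)"
      using integral_has_real_derivative[OF cm, of x 0 "x+1"] that
      by (intro DERIV_diff DERIV_const) (auto simp: at)
    moreover have "\<forall>\<^sub>F x in nhds x. y x = 1 - integral {0..x} m"
      by (rule eventually_mono[OF eventually_nhds_in_open[of "{0<..}" x]])
        (use that in \<open>auto simp: eqm\<close>)
    ultimately show ?thesis by (subst DERIV_cong_ev[OF refl _ refl]) auto
  qed
  have dI: "(I has_real_derivative g (y x)) (at x)" if "x > 0" for x
    using integral_has_real_derivative[OF cgy[OF continuous_on_id], of x 0 "x+1"] that
    unfolding I_def by (auto simp: at)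
  have ex: "((\<lambda>t::real. exp (- t)) \<longlongrightarrow> 0) at_top"
    using tendsto_exp_neg_mult_at_top[of 1] by simp
  show thesis
  proof (rule that[of "\<lambda>t. y (exp (- t))" "\<lambda>t. I (exp (- t))"], unfold emden_def, intro conjI allI impI)
    fix t :: real
    have "((\<lambda>t. y (exp (- t))) has_real_derivative - m (exp (- t)) * (- exp (- t))) (at t)"
      by (rule DERIV_chain2[OF dy]) (auto intro!: derivative_eq_intros)
    also have "- m (exp (- t)) * (- exp (- t)) = I (exp (- t))"
      using I[of "exp (- t)"] by (simp add: mult.commute)
    finally show "((\<lambda>t. y (exp (- t))) has_real_derivative exp (0 * t) * I (exp (- t))) (at t)" by simp
    have "((\<lambda>t. I (exp (- t))) has_real_derivative g (y (exp (- t))) * (- exp (- t))) (at t)"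
      by (rule DERIV_chain2[OF dI]) (auto intro!: derivative_eq_intros)
    then show "((\<lambda>t. I (exp (- t))) has_real_derivative - (exp (- t) * g (y (exp (- t))))) (at t)"
      by (simp add: mult.commute)
  next
    have "y 0 = 1" using eq[of 0] by simp
    moreover have "isCont y 0" using y by (simp add: continuous_on_eq_continuous_at)
    ultimately show "((\<lambda>t. y (exp (- t))) \<longlongrightarrow> 1) at_top"
      using isCont_tendsto_compose[OF _ ex, of y] by simp
    show "((\<lambda>t. I (exp (- t))) \<longlongrightarrow> 0) at_top"
    proof (rule Lim_null_comparison[OF _ ex], rule always_eventually, rule allI)
      fix t :: real
      have "norm (I (exp (- t))) \<le> integral {0..exp (- t)} (\<lambda>_. 1::real)" unfolding I_def
        using g1 by (intro integral_norm_bound_integral integrable_continuous_interval cgy continuous_intros) auto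
      then show "norm (I (exp (- t))) \<le> exp (- t)" by simp
    qed
  qed
qed

lemma continuous_imp_antiderivative:
  fixes g :: "real \<Rightarrow> real"
  assumes "continuous_on UNIV g"
  obtains G where "\<And>x. (G has_real_derivative g x) (at x)"
  using einterval_antiderivative[of "-\<infinity>" \<infinity> g] assms
  by (auto simp: continuous_on_eq_continuous_at has_real_derivative_iff_has_vector_derivative)

text \<open>The nonlinearity is truncated outside \<open>[-1,1]\<close> to make it globally Lipschitz; by the energy
  bound the solution never leaves this interval.\<close>

lemma emden_profile_exists:
  assumes q: "q > 0"
  obtains W R where "\<And>T. emden (signed_powr q) 0 T W R 1" "\<And>t. \<bar>W t\<bar> \<le> 1"
proof -
  define c where "c x = max (-1) (min 1 x)" for x :: real
  define g where "g x = signed_powr q (c x)" for x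
  have c: "\<bar>c x\<bar> \<le> 1" "\<bar>c x - c y\<bar> \<le> \<bar>x - y\<bar>" for x y by (auto simp: c_def)
  have c_minus: "c (- x) = - c x" for x by (auto simp: c_def)
  have gc: "continuous_on UNIV g" unfolding g_def c_def by (intro continuous_intros q)
  have g1: "\<bar>g x\<bar> \<le> 1" for x
    using signed_powr_abs_le[of q "c x" 1] q c by (simp add: g_def)
  have lip: "\<bar>g x - g y\<bar> \<le> (q + 1) * \<bar>x - y\<bar>" for x y
  proof -
    have "\<bar>g x - g y\<bar> \<le> (q + 1) * \<bar>c x - c y\<bar>"
      unfolding g_def by (intro signed_powr_Lipschitz q c)
    also have "\<dots> \<le> (q + 1) * \<bar>x - y\<bar>" using q c by (intro mult_left_mono) auto
    finally show ?thesis .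
  qed
  obtain W R where WR: "\<And>T. emden g 0 T W R 1"
    using emden_exists[of "q + 1" g] q gc g1 lip by auto
  obtain G where G: "\<And>x. (G has_real_derivative g x) (at x)"
    using continuous_imp_antiderivative[OF gc] by blast
  \<comment> \<open>The truncated potential is not explicit, but it is even and strictly increasing
    beyond 1; this is enough to turn G(W t) \<le> G 1 into |W t| \<le> 1.\<close>
  have G_minus: "G (- x) = G x" for x
  proof -
    have "((\<lambda>x. G (- x) - G x) has_real_derivative 0) (at x)" for x
    proof -
      have "((\<lambda>x. G (- x)) has_real_derivative g (- x) * (- 1)) (at x)"
        by (rule DERIV_chain2[OF G]) (auto intro!: derivative_eq_intros)
      from DERIV_diff[OF this G[of x]] show ?thesis by (simp add: g_def c_minus)
    qed
    then have "(\<lambda>x. G (- x) - G x) x = (\<lambda>x. G (- x) - G x) 0"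
      by (intro DERIV_isconst_all) auto
    then show ?thesis by simp
  qed
  have G_less: "G 1 < G x" if "x > 1" for x
  proof (rule DERIV_pos_imp_increasing[OF that])
    fix w :: real assume "1 \<le> w" "w \<le> x"
    then show "\<exists>y. (G has_real_derivative y) (at w) \<and> 0 < y"
      using G[of w] by (intro exI[of _ "g w"]) (auto simp: g_def c_def signed_powr_def)
  qed
  have W: "\<bar>W t\<bar> \<le> 1" for t
  proof (rule ccontr)
    assume "\<not> \<bar>W t\<bar> \<le> 1"
    then have "G 1 < G \<bar>W t\<bar>" by (intro G_less) auto
    also have "G \<bar>W t\<bar> = G (W t)" using G_minus[of "W t"] by (auto simp: abs_if)
    also have "G (W t) \<le> G 1"
      by (rule emden_energy[OF WR[of "t - 1"] g1 G]) auto
    finally show False by simp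
  qed
  have "c (W t) = W t" for t
  proof -
    have "-1 \<le> W t" "W t \<le> 1" using W[of t] by linarith+
    then show ?thesis by (simp add: c_def)
  qed
  then have "emden (signed_powr q) 0 T W R 1" for T
    using WR[of T] by (simp add: emden_def g_def)
  then show thesis using that W by blast
qed

section \<open>Simplicity, finiteness and oscillation of the zeros\<close>

text \<open>Forward Gronwall for V^2 + P^2 from vanishing Cauchy data. It is used in contrapositive
  form: a nonzero limit at infinity makes every zero simple and excludes vanishing on an
  interval.\<close>

lemma emden_zero_imp_limit_zero:
  assumes e: "emden (signed_powr q) \<gamma> T V P a" and q: "q > 0" and \<gamma>: "\<gamma> \<ge> 0"
    and M: "\<And>t. t > T \<Longrightarrow> \<bar>V t\<bar> \<le> M" and z: "z > T" "V z = 0" "P z = 0"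
  shows "a = 0"
proof -
  have V0: "V t = 0" if t: "z < t" for t
  proof -
    \<comment> \<open>Both coefficients of the linear bound on [z,t]: e^(\<gamma>s) is largest at t,
      e^(-s) is largest at z, and the nonlinearity is at most M^q |V|.\<close>
    define B where "B = exp (\<gamma> * t) + exp (- z) * M powr q"
    define Q where "Q s = (V s)\<^sup>2 + (P s)\<^sup>2" for s
    have "Q t * exp (- (B * t)) \<le> Q z * exp (- (B * z))"
    proof (rule DERIV_nonpos_imp_nonincreasing[of z t "\<lambda>s. Q s * exp (- (B * s))"])
      show "z \<le> t" using t by simp
      fix s assume s: "z \<le> s" "s \<le> t"
      have d: "(V has_real_derivative exp (\<gamma> * s) * P s) (at s)"
          "(P has_real_derivative - (exp (- s) * signed_powr q (V s))) (at s)"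
        using e s z by (auto simp: emden_def)
      define Q' where "Q' = 2 * (exp (\<gamma> * s) * (V s * P s)) - 2 * (exp (- s) * (signed_powr q (V s) * P s))"
      have "((\<lambda>s. Q s * exp (- (B * s))) has_real_derivative (Q' - B * Q s) * exp (- (B * s))) (at s)"
        unfolding Q_def Q'_def by (auto intro!: derivative_eq_intros d simp: algebra_simps)
      moreover have "Q' \<le> B * Q s"
      proof -
        have 1: "2 * \<bar>V s * P s\<bar> \<le> Q s"
          using sum_squares_bound[of "\<bar>V s\<bar>" "\<bar>P s\<bar>"] by (simp add: Q_def abs_mult)
        have "exp (\<gamma> * s) * (V s * P s) \<le> exp (\<gamma> * t) * \<bar>V s * P s\<bar>"
          using s \<gamma> by (intro order_trans[OF mult_left_mono[OF abs_ge_self] mult_right_mono])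
            (auto intro: mult_left_mono)
        moreover have "exp (- s) * (- (signed_powr q (V s) * P s)) \<le> exp (- z) * (M powr q * \<bar>V s * P s\<bar>)"
        proof -
          have "- (signed_powr q (V s) * P s) \<le> \<bar>signed_powr q (V s)\<bar> * \<bar>P s\<bar>"
            by (simp add: abs_mult[symmetric])
          also have "\<dots> = \<bar>V s\<bar> powr q * \<bar>V s * P s\<bar>" by (simp add: signed_powr_def abs_mult)
          also have "\<dots> \<le> M powr q * \<bar>V s * P s\<bar>"
            using M[of s] s z q by (intro mult_right_mono powr_mono2) auto
          finally have "exp (- s) * (- (signed_powr q (V s) * P s)) \<le> exp (- s) * (M powr q * \<bar>V s * P s\<bar>)"
            by (intro mult_left_mono) auto
          also have "\<dots> \<le> exp (- z) * (M powr q * \<bar>V s * P s\<bar>)"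
            using s by (intro mult_right_mono) auto
          finally show ?thesis .
        qed
        ultimately have "Q' \<le> B * (2 * \<bar>V s * P s\<bar>)" unfolding Q'_def B_def by (simp add: algebra_simps)
        also have "\<dots> \<le> B * Q s" using 1 by (intro mult_left_mono) (auto simp: B_def)
        finally show ?thesis .
      qed
      ultimately show "\<exists>y. ((\<lambda>s. Q s * exp (- (B * s))) has_real_derivative y) (at s) \<and> y \<le> 0"
        by (intro exI[of _ "(Q' - B * Q s) * exp (- (B * s))"]) (auto simp: mult_le_0_iff)
    qed
    then have "Q t \<le> 0" using z by (simp add: Q_def mult_le_0_iff)
    moreover have "(V t)\<^sup>2 \<le> Q t" by (simp add: Q_def)
    ultimately have "(V t)\<^sup>2 \<le> 0" by linarith
    then show ?thesis by simp
  qed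
  have "(V \<longlongrightarrow> 0) at_top"
    by (rule tendsto_eventually[OF eventually_mono[OF eventually_gt_at_top[of z] V0]])
  then show ?thesis using e tendsto_unique[of at_top V a 0] by (auto simp: emden_def)
qed

text \<open>The function leaves \<open>a\<close> upwards and reaches \<open>b\<close> from below, so
  it changes sign in between. For the profile this forces the slopes at neighbouring zeros to
  alternate.\<close>

lemma zero_between:
  fixes f f' :: "real \<Rightarrow> real"
  assumes d: "\<And>t. (f has_real_derivative f' t) (at t)"
    and "a < b" "f a = 0" "f b = 0" "f' a > 0" "f' b > 0"
  shows "\<exists>c>a. c < b \<and> f c = 0"
proof -
  obtain d1 where d1: "d1 > 0" "\<And>h. 0 < h \<Longrightarrow> h < d1 \<Longrightarrow> f a < f (a + h)"
    using DERIV_pos_inc_right[OF d \<open>f' a > 0\<close>] by auto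
  obtain d2 where d2: "d2 > 0" "\<And>h. 0 < h \<Longrightarrow> h < d2 \<Longrightarrow> f (b - h) < f b"
    using DERIV_pos_inc_left[OF d \<open>f' b > 0\<close>] by auto
  define h where "h = Min {d1 / 2, d2 / 2, (b - a) / 3}"
  have h: "0 < h" "h < d1" "h < d2" "2 * h < b - a"
    using d1(1) d2(1) \<open>a < b\<close> by (auto simp: h_def min_def)
  have "\<exists>x\<ge>a + h. x \<le> b - h \<and> f x = 0"
  proof (rule IVT2')
    show "f (b - h) \<le> 0" "0 \<le> f (a + h)" using d1(2)[of h] d2(2)[of h] h assms by auto
    show "continuous_on {a + h..b - h} f"
      by (intro continuous_at_imp_continuous_on ballI DERIV_isCont[OF d])
  qed (use h in auto)
  then obtain x where "a + h \<le> x" "x \<le> b - h" "f x = 0" by blast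
  then show ?thesis using h by (intro exI[of _ x]) auto
qed

text \<open>The profile for \<gamma> = 0 with its derivative \<open>R\<close>. As it oscillates to
  the left, its zeros are always counted to the right of a given point.\<close>

locale emden_profile =
  fixes q :: real and W R :: "real \<Rightarrow> real"
  assumes q: "q > 0" and emden: "\<And>T. emden (signed_powr q) 0 T W R 1" and W_le: "\<And>t. \<bar>W t\<bar> \<le> 1"
begin

lemma DERIV_W: "(W has_real_derivative R t) (at t)"
  and DERIV_R: "(R has_real_derivative - (exp (- t) * signed_powr q (W t))) (at t)"
  using emden[of "t - 1"] by (auto simp: emden_def)

lemma isCont_W: "isCont W t" and isCont_R: "isCont R t"
  using DERIV_W DERIV_R by (blast intro: DERIV_isCont)+

lemma W_tendsto: "(W \<longlongrightarrow> 1) at_top"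
  using emden[of 0] by (simp add: emden_def)

lemma R_le: "\<bar>R t\<bar> \<le> exp (- t)"
  using emden_decay[OF emden[of "t - 1"], of 1 t] signed_powr_abs_le[OF _ W_le] q by auto

text \<open>The derivative bound e^(-T) holds on the entire half-line, so shifts of \<open>W\<close>
  converge uniformly there.\<close>

lemma W_Lipschitz:
  assumes "T \<le> s" "T \<le> t"
  shows "\<bar>W s - W t\<bar> \<le> exp (- T) * \<bar>s - t\<bar>"
proof -
  have *: "\<bar>W t - W s\<bar> \<le> exp (- T) * \<bar>t - s\<bar>" if st: "T \<le> s" "s < t" for s t
  proof -
    have "\<exists>z>s. z < t \<and> W t - W s = (t - s) * R z"
      by (rule MVT2) (use st DERIV_W in auto)
    then obtain z where z: "s < z" "W t - W s = (t - s) * R z" by auto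
    have "\<bar>R z\<bar> \<le> exp (- T)" using R_le[of z] z st by (smt (verit) exp_le_cancel_iff)
    then show ?thesis using z st by (simp add: abs_mult mult.commute mult_left_mono)
  qed
  consider "s < t" | "s = t" | "t < s" by linarith
  then show ?thesis using *[of s t] *[of t s] assms by cases (auto simp: abs_minus_commute)
qed

lemma W_zero_simple: "W z = 0 \<Longrightarrow> R z \<noteq> 0"
  using emden_zero_imp_limit_zero[OF emden[of "z - 1"] q _ W_le] by fastforce

lemma W_eventually_pos: obtains T where "\<And>t. t \<ge> T \<Longrightarrow> W t > 1/2"
  using order_tendstoD(1)[OF W_tendsto, of "1/2"] by (auto simp: eventually_at_top_linorder)

text \<open>Positivity near infinity confines the zeros to a compact interval, and an accumulation
  point would be a zero of vanishing slope.\<close>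

lemma finite_W_zeros: "finite {t. t \<ge> T \<and> W t = 0}"
proof -
  obtain T1 where T1: "\<And>t. t \<ge> T1 \<Longrightarrow> W t > 1/2" using W_eventually_pos by blast
  have "finite ({T..T1} \<inter> {t. W t = 0})"
  proof (rule finite_not_islimpt_in_compact)
    fix z
    show "\<not> z islimpt {t. W t = 0}"
    proof
      assume lim: "z islimpt {t. W t = 0}"
      have "closed (W -` {0})"
        by (intro continuous_closed_vimage closed_singleton isCont_W)
      then have z: "W z = 0" using lim by (auto simp: closed_limpt vimage_def)
      have "((\<lambda>t. (W t - W z) / (t - z)) \<longlongrightarrow> R z) (at z)"
        using DERIV_W by (simp add: has_field_derivative_iff)
      then have "\<forall>\<^sub>F t in at z. (W t - W z) / (t - z) \<noteq> 0"
        using W_zero_simple[OF z] by (rule tendsto_imp_eventually_ne)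
      then have "\<forall>\<^sub>F t in at z. W t \<noteq> 0" by eventually_elim (use z in auto)
      then show False using lim by (auto simp: islimpt_iff_eventually)
    qed
  qed auto
  moreover have "{t. t \<ge> T \<and> W t = 0} \<subseteq> {T..T1} \<inter> {t. W t = 0}"
  proof
    fix t assume "t \<in> {t. t \<ge> T \<and> W t = 0}"
    then show "t \<in> {T..T1} \<inter> {t. W t = 0}" using T1[of t] by (cases "T1 \<le> t") auto
  qed
  ultimately show ?thesis by (rule finite_subset[rotated])
qed

lemma finite_W_zeros': "finite {t. t > T \<and> W t = 0}"
  by (rule finite_subset[OF _ finite_W_zeros[of T]]) auto

end

text \<open>A positive concave function on a half-line \<open>(-\<infinity>, T]\<close> is nonincreasing, hence bounded below there
  by a positive constant; the equation then forces the derivative up to infinity.\<close>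

lemma emden_no_positive_end:
  assumes q: "q > 0"
    and dW: "\<And>t. (W has_real_derivative R t) (at t)"
    and dR: "\<And>t. (R has_real_derivative - (exp (- t) * signed_powr q (W t))) (at t)"
  shows "\<exists>t<T. W t \<le> 0"
proof (rule ccontr)
  assume "\<not> ?thesis"
  then have pos: "W t > 0" if "t < T" for t using that by force
  have R_dec: "R t \<le> R s" if "s \<le> t" "t < T" for s t
  proof (rule DERIV_nonpos_imp_nonincreasing[OF \<open>s \<le> t\<close>])
    fix x assume "s \<le> x" "x \<le> t"
    then have "0 < signed_powr q (W x)" using pos that by (intro signed_powr_pos) auto
    then show "\<exists>y. (R has_real_derivative y) (at x) \<and> y \<le> 0"
      using dR[of x] by (intro exI[of _ "- (exp (- x) * signed_powr q (W x))"]) auto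
  qed
  have R_nonpos: "R t \<le> 0" if "t < T" for t
  proof (rule ccontr)
    assume "\<not> R t \<le> 0"
    then have Rt: "R t > 0" by simp
    \<comment> \<open>The tangent at \<open>t\<close> takes the value - R t at this point, and by
      concavity the graph lies below the tangent.\<close>
    define s where "s = t - W t / R t - 1"
    have "W t / R t > 0" using Rt pos[OF that] by simp
    then have st: "s < t" by (simp add: s_def)
    have "W s - R t * s \<le> W t - R t * t"
    proof (rule DERIV_nonneg_imp_nondecreasing[of s t "\<lambda>x. W x - R t * x"])
      show "s \<le> t" using st by simp
      fix x assume x: "s \<le> x" "x \<le> t"
      have "((\<lambda>x. W x - R t * x) has_real_derivative R x - R t) (at x)"
        by (auto intro!: derivative_eq_intros dW)
      then show "\<exists>y. ((\<lambda>x. W x - R t * x) has_real_derivative y) (at x) \<and> 0 \<le> y"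
        using R_dec[OF x(2) that] by (intro exI[of _ "R x - R t"]) auto
    qed
    also have "R t * s = R t * t - W t - R t" using Rt by (simp add: s_def field_simps)
    ultimately have "W s \<le> - R t" by simp
    then show False using pos[of s] st that Rt by simp
  qed
  \<comment> \<open>b \<le> 0 ensures e^(-x) \<ge> 1 on the left of \<open>b\<close>, so that R'
    \<le> - c there.\<close>
  define b where "b = min (T - 1) 0"
  define c where "c = signed_powr q (W b)"
  have b: "b < T" "b \<le> 0" by (auto simp: b_def)
  have c: "c > 0" unfolding c_def by (intro signed_powr_pos pos b)
  have Wb: "W b \<le> W t" if "t \<le> b" for t
  proof (rule DERIV_nonpos_imp_nonincreasing[OF that])
    fix x assume "t \<le> x" "x \<le> b"
    then show "\<exists>y. (W has_real_derivative y) (at x) \<and> y \<le> 0"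
      using dW[of x] R_nonpos[of x] b by (intro exI[of _ "R x"]) auto
  qed
  \<comment> \<open>Going back from \<open>b\<close> by (1 - R b) / c at rate at least c lifts
    \<open>R\<close> to 1, against \<open>R_nonpos\<close>.\<close>
  define s where "s = b + (R b - 1) / c"
  have s: "s < b" using R_nonpos[OF b(1)] c by (simp add: s_def divide_neg_pos)
  have "R b + c * b \<le> R s + c * s"
  proof (rule DERIV_nonpos_imp_nonincreasing[of s b "\<lambda>x. R x + c * x"])
    show "s \<le> b" using s by simp
    fix x assume x: "s \<le> x" "x \<le> b"
    have "((\<lambda>x. R x + c * x) has_real_derivative - (exp (- x) * signed_powr q (W x)) + c) (at x)"
      by (auto intro!: derivative_eq_intros dR)
    moreover have "1 * c \<le> exp (- x) * signed_powr q (W x)"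
      unfolding c_def using x b q pos[of b] Wb[OF x(2)] c
      by (intro mult_mono signed_powr_mono) (auto simp: c_def)
    ultimately show "\<exists>y. ((\<lambda>x. R x + c * x) has_real_derivative y) (at x) \<and> y \<le> 0"
      by (intro exI[of _ "- (exp (- x) * signed_powr q (W x)) + c"]) auto
  qed
  then have "R b + c * (b - s) \<le> R s" by (simp add: algebra_simps)
  moreover have "c * (b - s) = 1 - R b" using c by (simp add: s_def)
  ultimately have "R s \<ge> 1" by simp
  then show False using R_nonpos[of s] s b by simp
qed

context emden_profile
begin

text \<open>The equation is odd, so the previous lemma applies to - W as well: neither sign can
  persist towards the left.\<close>

lemma W_oscillates: "\<exists>z<T. W z = 0"
proof -
  obtain t where t: "t < T" "W t \<le> 0"
    using emden_no_positive_end[OF q DERIV_W DERIV_R, of T] by auto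
  have "\<exists>s<t. - W s \<le> 0"
    by (rule emden_no_positive_end[OF q, of "\<lambda>t. - W t" "\<lambda>t. - R t"])
      (use DERIV_minus[OF DERIV_W] DERIV_minus[OF DERIV_R] in auto)
  then obtain s where s: "s < t" "W s \<ge> 0" by auto
  have "\<exists>x\<ge>s. x \<le> t \<and> W x = 0"
    using s t by (intro IVT2' continuous_at_imp_continuous_on ballI isCont_W) auto
  then obtain x where "x \<le> t" "W x = 0" by blast
  then show ?thesis using t by (intro exI[of _ x]) simp
qed

text \<open>The rightmost zero has positive slope because W tends to 1. Each induction step moves to
  the next zero on the left, where the slope must switch sign, as equal signs would enclose a
  further zero.\<close>

lemma W_nth_zero: "\<exists>z. W z = 0 \<and> card {t. t > z \<and> W t = 0} = n \<and> (-1) ^ n * R z > 0"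
proof (induction n)
  case 0
  obtain z1 where z1: "W z1 = 0" using W_oscillates[of 0] by auto
  define Z where "Z = {t. t \<ge> z1 \<and> W t = 0}"
  have Z: "finite Z" "z1 \<in> Z" using finite_W_zeros z1 by (auto simp: Z_def)
  define z where "z = Max Z"
  have "z \<in> Z" unfolding z_def using Z by (intro Max_in) auto
  then have z: "W z = 0" by (simp add: Z_def)
  have no: "W t \<noteq> 0" if "t > z" for t
  proof
    assume "W t = 0"
    then have "t \<in> Z" using that \<open>z \<in> Z\<close> by (auto simp: Z_def)
    then show False using that Max_ge[OF Z(1)] by (fastforce simp: z_def)
  qed
  have "R z > 0"
  proof (rule ccontr)
    assume "\<not> R z > 0"
    then have "R z < 0" using W_zero_simple[OF z] by simp
    then obtain d where d: "d > 0" "\<And>h. 0 < h \<Longrightarrow> h < d \<Longrightarrow> W z > W (z + h)"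
      using DERIV_neg_dec_right[OF DERIV_W] by blast
    obtain T1 where T1: "\<And>t. t \<ge> T1 \<Longrightarrow> W t > 1/2" using W_eventually_pos by blast
    define s where "s = z + d / 2"
    have "W s < 0" "z < s" using d(2)[of "d/2"] d z by (auto simp: s_def)
    moreover have "W (max s T1) > 0" using T1[of "max s T1"] by simp
    ultimately have "\<exists>x\<ge>s. x \<le> max s T1 \<and> W x = 0"
      by (intro IVT' continuous_at_imp_continuous_on ballI isCont_W) auto
    then show False using no \<open>z < s\<close> by force
  qed
  have no_zeros: "{t. t > z \<and> W t = 0} = {}" using no by auto
  show ?case
    by (rule exI[of _ z], unfold no_zeros) (simp add: z \<open>R z > 0\<close>)
next
  case (Suc n)
  then obtain z where z: "W z = 0" "card {t. t > z \<and> W t = 0} = n" "(-1) ^ n * R z > 0" by blast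
  obtain z1 where z1: "z1 < z" "W z1 = 0" using W_oscillates[of z] by auto
  define Z where "Z = {t. t \<ge> z1 \<and> W t = 0} \<inter> {..<z}"
  have Z: "finite Z" "z1 \<in> Z" using finite_W_zeros z1 by (auto simp: Z_def)
  define z' where "z' = Max Z"
  have "z' \<in> Z" unfolding z'_def using Z by (intro Max_in) auto
  then have z': "W z' = 0" "z' < z" by (auto simp: Z_def)
  have no: "W t \<noteq> 0" if "t > z'" "t < z" for t
  proof
    assume "W t = 0"
    then have "t \<in> Z" using that \<open>z' \<in> Z\<close> by (auto simp: Z_def)
    then show False using that Max_ge[OF Z(1)] by (fastforce simp: z'_def)
  qed
  have "{t. t > z' \<and> W t = 0} = insert z {t. t > z \<and> W t = 0}"
    using no z z' by (auto simp: not_less_iff_gr_or_eq) (metis linorder_neqE_linordered_idom)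
  then have "card {t. t > z' \<and> W t = 0} = Suc n" using finite_W_zeros'[of z] z by simp
  moreover have "(-1) ^ Suc n * R z' > 0"
  proof (rule ccontr)
    assume "\<not> ?thesis"
    then have "(-1) ^ n * R z' \<ge> 0" by simp
    moreover have "(-1) ^ n * R z' \<noteq> 0" using W_zero_simple[OF z'(1)] by simp
    ultimately have "(-1) ^ n * R z' > 0" by linarith
    then have "\<exists>c>z'. c < z \<and> (-1) ^ n * W c = 0"
      using z z' by (intro zero_between[of _ "\<lambda>t. (-1) ^ n * R t"] DERIV_cmult DERIV_W) auto
    then obtain c where "z' < c" "c < z" "W c = 0" by auto
    then show False using no by simp
  qed
  ultimately show ?case using z' by blast
qed

text \<open>The number of zeros to the right drops strictly from one zero to a later one, so it
  labels the zeros.\<close>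

lemma W_zero_unique:
  assumes "W y = 0" "W z = 0" "card {t. t > y \<and> W t = 0} = card {t. t > z \<and> W t = 0}"
  shows "y = z"
proof -
  have *: "card {t. t > z \<and> W t = 0} < card {t. t > y \<and> W t = 0}" if "y < z" "W z = 0" for y z
    using that by (intro psubset_card_mono finite_W_zeros') auto
  show ?thesis using *[of y z] *[of z y] assms by (cases y z rule: linorder_cases) auto
qed

end

subsection \<open>Stability of the zeros\<close>

context emden_profile
begin

text \<open>Near each zero continuity keeps \<open>R\<close> within half of its nonzero value;
  finiteness of \<open>Z\<close> makes radius and bound uniform.\<close>

lemma zero_nbhd:
  assumes Z: "finite Z" "\<And>y. y \<in> Z \<Longrightarrow> W y = 0" and "e > 0"
  obtains \<delta> m where "0 < \<delta>" "\<delta> < e" "m > 0"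
    "\<And>y t. y \<in> Z \<Longrightarrow> \<bar>t - y\<bar> \<le> \<delta> \<Longrightarrow> R t * sgn (R y) \<ge> m"
proof -
  have "\<exists>d>0. \<forall>t. \<bar>t - y\<bar> < d \<longrightarrow> \<bar>R t - R y\<bar> < \<bar>R y\<bar> / 2" if "y \<in> Z" for y
  proof -
    have "\<bar>R y\<bar> / 2 > 0" using W_zero_simple[OF Z(2)[OF that]] by simp
    then show ?thesis using isCont_R[of y] by (simp only: continuous_at_eps_delta dist_real_def)
  qed
  then obtain d where d: "\<And>y. y \<in> Z \<Longrightarrow> d y > 0"
    "\<And>y t. y \<in> Z \<Longrightarrow> \<bar>t - y\<bar> < d y \<Longrightarrow> \<bar>R t - R y\<bar> < \<bar>R y\<bar> / 2"
    by metis
  define \<delta> where "\<delta> = Min (insert e (d ` Z)) / 2"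
  define m where "m = Min (insert 1 ((\<lambda>y. \<bar>R y\<bar> / 2) ` Z))"
  have "0 < Min (insert e (d ` Z))" using Z(1) d(1) \<open>e > 0\<close> by (subst Min_gr_iff) auto
  then have \<delta>: "0 < \<delta>" by (simp add: \<delta>_def)
  have "Min (insert e (d ` Z)) \<le> e" "\<And>y. y \<in> Z \<Longrightarrow> Min (insert e (d ` Z)) \<le> d y" using Z(1) by auto
  then have \<delta>': "\<delta> < e" "\<And>y. y \<in> Z \<Longrightarrow> \<delta> < d y" using \<delta> unfolding \<delta>_def by force+
  have m: "m > 0" unfolding m_def using Z W_zero_simple by (subst Min_gr_iff) auto
  have m': "m \<le> \<bar>R y\<bar> / 2" if "y \<in> Z" for y unfolding m_def using Z(1) that by (intro Min_le) auto
  show thesis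
  proof (rule that[OF \<delta> \<delta>'(1) m])
    fix y t assume y: "y \<in> Z" and t: "\<bar>t - y\<bar> \<le> \<delta>"
    have "\<bar>t - y\<bar> < d y" using t \<delta>'(2)[OF y] by simp
    then have "\<bar>R t - R y\<bar> < \<bar>R y\<bar> / 2" by (rule d(2)[OF y])
    then show "m \<le> R t * sgn (R y)" using m'[OF y] by (auto simp: sgn_if abs_if split: if_splits)
  qed
qed

text \<open>Up to \<open>T1\<close> by compactness of the complement of the neighbourhoods, beyond
  it because W > 1/2.\<close>

lemma W_away_from_zeros:
  assumes "\<delta> > 0"
  obtains m where "m > 0" "\<And>t. t \<ge> T \<Longrightarrow> \<bar>W t\<bar> \<ge> m \<or> (\<exists>y. W y = 0 \<and> y \<ge> T \<and> \<bar>t - y\<bar> \<le> \<delta>)"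
proof -
  obtain T1 where T1: "\<And>t. t \<ge> T1 \<Longrightarrow> W t > 1/2" using W_eventually_pos by blast
  define K where "K = {T..T1} - (\<Union>y\<in>{y. W y = 0 \<and> y \<ge> T}. ball y \<delta>)"
  have K: "compact K" unfolding K_def by (intro compact_diff open_UN) auto
  have "\<exists>m>0. \<forall>t\<in>K. m \<le> \<bar>W t\<bar>"
  proof (cases "K = {}")
    case False
    have "continuous_on K (\<lambda>t. \<bar>W t\<bar>)"
      by (intro continuous_on_rabs continuous_at_imp_continuous_on ballI isCont_W)
    from continuous_attains_inf[OF K False this]
    obtain s where s: "s \<in> K" "\<And>t. t \<in> K \<Longrightarrow> \<bar>W s\<bar> \<le> \<bar>W t\<bar>" by blast
    have "W s \<noteq> 0" using s(1) assms by (force simp: K_def)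
    then show ?thesis using s(2) by (intro exI[of _ "\<bar>W s\<bar>"]) auto
  qed (auto intro: exI[of _ 1])
  then obtain m where m: "m > 0" "\<And>t. t \<in> K \<Longrightarrow> m \<le> \<bar>W t\<bar>" by blast
  show thesis
  proof (rule that[of "min m (1/2)"])
    show "0 < min m (1/2)" using m by simp
    fix t assume t: "t \<ge> T"
    show "min m (1/2) \<le> \<bar>W t\<bar> \<or> (\<exists>y. W y = 0 \<and> T \<le> y \<and> \<bar>t - y\<bar> \<le> \<delta>)"
    proof (cases "t \<in> K")
      case True then show ?thesis using m(2)[of t] by auto
    next
      case False
      show ?thesis
      proof (cases "t \<le> T1")
        case True
        then obtain y where "W y = 0" "T \<le> y" "t \<in> ball y \<delta>" using False t by (auto simp: K_def)
        then show ?thesis by (intro disjI2 exI[of _ y]) (auto simp: dist_real_def)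
      next
        case False
        then have "W t > 1/2" by (intro T1) auto
        then have "min m (1/2) \<le> \<bar>W t\<bar>" by linarith
        then show ?thesis ..
      qed
    qed
  qed
qed

text \<open>Leaves room on the left of \<open>z\<close> without admitting another zero, so that a
  perturbed zero can be compared with \<open>W\<close> on both sides of \<open>z\<close>.\<close>

lemma zero_gap: obtains T where "T < z" "\<And>t. T \<le> t \<Longrightarrow> t < z \<Longrightarrow> W t \<noteq> 0"
proof -
  define S where "S = insert (z - 1) {t. t \<ge> z - 1 \<and> W t = 0 \<and> t < z}"
  have S: "finite S" unfolding S_def
    by (auto intro: finite_subset[OF _ finite_W_zeros[of "z - 1"]])
  have "Max S \<in> S" using S by (intro Max_in) (auto simp: S_def)
  then have mx: "Max S < z" by (auto simp: S_def)
  show thesis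
  proof (rule that[of "(Max S + z) / 2"])
    show "(Max S + z) / 2 < z" using mx by simp
    fix t assume t: "(Max S + z) / 2 \<le> t" "t < z"
    have "z - 1 \<le> Max S" using S by (intro Max_ge) (auto simp: S_def)
    moreover have "Max S < t" using t mx by simp
    ultimately show "W t \<noteq> 0" using Max_ge[OF S, of t] t by (force simp: S_def)
  qed
qed

text \<open>A counting argument: \<open>V\<close> has n + 1 zeros including its starting point, and
  so has \<open>W\<close> on [T,\<infinity>). Closeness matches the two sets one to one up to
  \<delta>, so the leftmost zeros correspond. \<eta> is chosen before \<gamma>, \<open>z\<close> and
  \<open>V\<close>.\<close>

lemma zero_perturbation:
  assumes z0: "W z0 = 0" "card {t. t > z0 \<and> W t = 0} = n"
    and T: "T < z0" "\<And>t. T \<le> t \<Longrightarrow> t < z0 \<Longrightarrow> W t \<noteq> 0" and "\<epsilon> > 0"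
  obtains \<eta> where "\<eta> > 0"
    "\<And>\<gamma> z V P. continuous_on {z..} V \<Longrightarrow> V z = 0 \<Longrightarrow>
      (\<And>t. t > z \<Longrightarrow> (V has_real_derivative exp (\<gamma> * t) * P t) (at t)) \<Longrightarrow>
      finite {t. t > z \<and> V t = 0} \<Longrightarrow> card {t. t > z \<and> V t = 0} = n \<Longrightarrow>
      (\<And>t. t > z \<Longrightarrow> t > T \<Longrightarrow> \<bar>V t - W t\<bar> \<le> \<eta> \<and> \<bar>P t - R t\<bar> \<le> \<eta>) \<Longrightarrow> \<bar>z - z0\<bar> < \<epsilon>"
proof -
  define Z where "Z = {t. t \<ge> T \<and> W t = 0}"
  have finZ: "finite Z" unfolding Z_def by (rule finite_W_zeros)
  have Z_ge: "y \<ge> z0" if "y \<in> Z" for y using that T by (force simp: Z_def)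
  have "z0 \<in> Z" using z0 T by (auto simp: Z_def)
  have "Z = insert z0 {t. t > z0 \<and> W t = 0}" using Z_ge z0 T by (force simp: Z_def)
  then have cardZ: "card Z = Suc n" using z0 finite_W_zeros' by simp
  obtain \<delta> m1 where \<delta>: "0 < \<delta>" "\<delta> < min \<epsilon> (z0 - T)" and m1: "m1 > 0"
    and RZ: "\<And>y t. y \<in> Z \<Longrightarrow> \<bar>t - y\<bar> \<le> \<delta> \<Longrightarrow> R t * sgn (R y) \<ge> m1"
    using zero_nbhd[OF finZ, of "min \<epsilon> (z0 - T)"] T(1) \<open>\<epsilon> > 0\<close> by (auto simp: Z_def)
  obtain m2 where m2: "m2 > 0" "\<And>t. t \<ge> T \<Longrightarrow> \<bar>W t\<bar> \<ge> m2 \<or> (\<exists>y\<in>Z. \<bar>t - y\<bar> \<le> \<delta>)"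
    using W_away_from_zeros[OF \<delta>(1), of T] by (auto simp: Z_def Bex_def conj_ac)
  have RZ': "m1 \<le> \<bar>R t\<bar>" if "y \<in> Z" "\<bar>t - y\<bar> \<le> \<delta>" for y t
    using RZ[OF that] m1 by (auto simp: sgn_if split: if_splits)
  \<comment> \<open>Below \<delta> m1, \<open>V\<close> inherits the sign change of \<open>W\<close>
    across a zero; below m1, P cannot vanish near a zero of \<open>W\<close>; below m2, zeros of
    \<open>V\<close> lie near zeros of \<open>W\<close>.\<close>
  define \<eta> where "\<eta> = min (\<delta> * m1) (min m1 m2) / 2"
  have "0 < min (\<delta> * m1) (min m1 m2)" using \<delta> m1 m2 by simp
  then have \<eta>: "0 < \<eta>" "\<eta> < \<delta> * m1" "\<eta> < m1" "\<eta> < m2" unfolding \<eta>_def by linarith+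
  show thesis
  proof (rule that[OF \<eta>(1)])
    fix \<gamma> z V P
    assume cont: "continuous_on {z..} V" and Vz: "V z = 0"
      and dV: "\<And>t. t > z \<Longrightarrow> (V has_real_derivative exp (\<gamma> * t) * P t) (at t)"
      and fin: "finite {t. t > z \<and> V t = 0}" and card: "card {t. t > z \<and> V t = 0} = n"
      and close: "\<And>t. t > z \<Longrightarrow> t > T \<Longrightarrow> \<bar>V t - W t\<bar> \<le> \<eta> \<and> \<bar>P t - R t\<bar> \<le> \<eta>"
    have contV: "continuous_on {a..b} V" if "z \<le> a" for a b
      by (rule continuous_on_subset[OF cont]) (use that in auto)
    show "\<bar>z - z0\<bar> < \<epsilon>"
    proof (cases "z < T")
      case True
      \<comment> \<open>If \<open>V\<close> started left of \<open>T\<close>, each of the n + 1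
        zeros of \<open>W\<close> would produce a zero of \<open>V\<close> after z, one more than
        allowed.\<close>
      have "\<exists>x. \<bar>x - y\<bar> \<le> \<delta> \<and> V x = 0" if y: "y \<in> Z" for y
      proof -
        define \<sigma> where "\<sigma> = sgn (R y)"
        have Wy: "W y = 0" using y by (simp add: Z_def)
        then have \<sigma>: "\<sigma> * \<sigma> = 1" "\<bar>\<sigma>\<bar> = 1"
          using W_zero_simple by (auto simp: \<sigma>_def sgn_if)
        have yT: "T < y - \<delta>" using Z_ge[OF y] \<delta> by simp
        have "\<exists>\<xi>>y. \<xi> < y + \<delta> \<and> W (y + \<delta>) - W y = (y + \<delta> - y) * R \<xi>"
          by (rule MVT2) (use \<delta> DERIV_W in auto)
        then obtain \<xi>1 where \<xi>1: "y < \<xi>1" "\<xi>1 < y + \<delta>" "W (y + \<delta>) = \<delta> * R \<xi>1" using Wy by auto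
        have "\<exists>\<xi>>y - \<delta>. \<xi> < y \<and> W y - W (y - \<delta>) = (y - (y - \<delta>)) * R \<xi>"
          by (rule MVT2) (use \<delta> DERIV_W in auto)
        then obtain \<xi>2 where \<xi>2: "y - \<delta> < \<xi>2" "\<xi>2 < y" "W (y - \<delta>) = - \<delta> * R \<xi>2" using Wy by auto
        have "\<delta> * m1 \<le> \<delta> * (R \<xi>1 * \<sigma>)" "\<delta> * m1 \<le> \<delta> * (R \<xi>2 * \<sigma>)"
          unfolding \<sigma>_def using RZ[OF y, of \<xi>1] RZ[OF y, of \<xi>2] \<xi>1 \<xi>2 \<delta> by (auto intro!: mult_left_mono)
        moreover have "\<sigma> * W (y + \<delta>) = \<delta> * (R \<xi>1 * \<sigma>)" "\<sigma> * W (y - \<delta>) = - (\<delta> * (R \<xi>2 * \<sigma>))"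
          using \<xi>1(3) \<xi>2(3) by simp_all
        ultimately have W: "\<eta> < \<sigma> * W (y + \<delta>)" "\<sigma> * W (y - \<delta>) < - \<eta>"
          using \<eta>(2) by linarith+
        have cl: "\<bar>\<sigma> * V t - \<sigma> * W t\<bar> \<le> \<eta>" if "t > T" for t
          using close[of t] that True \<sigma> by (simp add: right_diff_distrib[symmetric] abs_mult)
        have "0 < \<sigma> * V (y + \<delta>)" "\<sigma> * V (y - \<delta>) < 0"
          using cl[of "y + \<delta>"] cl[of "y - \<delta>"] yT \<delta> W by linarith+
        then have "\<exists>x\<ge>y - \<delta>. x \<le> y + \<delta> \<and> \<sigma> * V x = 0"
          using yT True \<delta> by (intro IVT' continuous_on_mult continuous_on_const contV) auto
        then obtain x where "y - \<delta> \<le> x" "x \<le> y + \<delta>" "\<sigma> * V x = 0" by blast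
        then show ?thesis using \<sigma> by (intro exI[of _ x]) auto
      qed
      then obtain x where x: "\<And>y. y \<in> Z \<Longrightarrow> \<bar>x y - y\<bar> \<le> \<delta>" "\<And>y. y \<in> Z \<Longrightarrow> V (x y) = 0"
        by metis
      \<comment> \<open>A common nearby zero would put two zeros of \<open>W\<close> so close that
        the critical point between them lies within \<delta> of one of them.\<close>
      have inj: "False" if yz: "y \<in> Z" "y' \<in> Z" "x y = x y'" "y < y'" for y y'
      proof -
        have "\<exists>\<xi>>y. \<xi> < y' \<and> W y' - W y = (y' - y) * R \<xi>"
          by (rule MVT2) (use yz DERIV_W in auto)
        then obtain \<xi> where \<xi>: "y < \<xi>" "\<xi> < y'" "R \<xi> = 0" using yz by (auto simp: Z_def)
        have "\<bar>\<xi> - y\<bar> \<le> \<delta> \<or> \<bar>\<xi> - y'\<bar> \<le> \<delta>"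
          using \<xi> x(1)[OF yz(1)] x(1)[OF yz(2)] yz(3) by linarith
        then show False using RZ'[of y \<xi>] RZ'[of y' \<xi>] yz \<xi> m1 by auto
      qed
      have "inj_on x Z" by (rule linorder_inj_onI) (use inj in \<open>auto simp: not_le\<close>)
      moreover have "x ` Z \<subseteq> {t. t > z \<and> V t = 0}"
      proof safe
        fix y assume y: "y \<in> Z"
        show "z < x y" using x(1)[OF y] Z_ge[OF y] \<delta> True by linarith
        show "V (x y) = 0" by (rule x(2)[OF y])
      qed
      ultimately have "card Z \<le> n" using card_inj_on_le[OF _ _ fin] card by metis
      then show ?thesis using cardZ by simp
    next
      case False
      define A where "A = insert z {t. t > z \<and> V t = 0}"
      have A: "finite A" "card A = Suc n" using fin card by (auto simp: A_def)
      have "\<exists>y\<in>Z. \<bar>t - y\<bar> \<le> \<delta>" if t: "t \<in> A" for t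
      proof -
        have "\<bar>V t - W t\<bar> \<le> \<eta>"
        proof (cases "t = z")
          case True
          \<comment> \<open>Closeness is assumed only to the right of \<open>z\<close>; at
            \<open>z\<close> itself it follows from one-sided continuity.\<close>
          have "((\<lambda>s. \<bar>V s - W s\<bar>) \<longlongrightarrow> \<bar>V z - W z\<bar>) (at_right z)"
          proof (intro tendsto_intros)
            show "(V \<longlongrightarrow> V z) (at_right z)"
              using cont by (auto simp: continuous_on_def intro: tendsto_within_subset[of _ _ _ "{z..}"])
            show "(W \<longlongrightarrow> W z) (at_right z)"
              using isCont_W[of z] by (auto simp: isCont_def intro: filterlim_mono at_le)
          qed
          moreover have "\<forall>\<^sub>F s in at_right z. \<bar>V s - W s\<bar> \<le> \<eta>"
            using eventually_at_right_less[of z] by eventually_elim (use close False in auto)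
          ultimately show ?thesis using True tendsto_upperbound[of _ "\<bar>V z - W z\<bar>" "at_right z" \<eta>] by auto
        qed (use t close[of t] False in \<open>auto simp: A_def\<close>)
        moreover have "V t = 0" using t Vz by (auto simp: A_def)
        ultimately show ?thesis using m2(2)[of t] t False \<eta> by (auto simp: A_def)
      qed
      then obtain y where y: "\<And>t. t \<in> A \<Longrightarrow> y t \<in> Z" "\<And>t. t \<in> A \<Longrightarrow> \<bar>t - y t\<bar> \<le> \<delta>" by metis
      \<comment> \<open>Rolle's theorem gives a zero of \<open>P\<close> between two such zeros of
        \<open>V\<close>, near y s, where |R| exceeds \<eta>.\<close>
      have inj: "False" if st: "s \<in> A" "t \<in> A" "y s = y t" "s < t" for s t
      proof -
        have zs: "z \<le> s" "V s = 0" "V t = 0" using st Vz by (auto simp: A_def)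
        have "\<exists>\<xi>>s. \<xi> < t \<and> DERIV V \<xi> :> 0"
        proof (rule Rolle)
          show "continuous_on {s..t} V" by (rule contV[OF zs(1)])
          fix x assume "s < x" "x < t"
          then show "V differentiable (at x)" using dV[of x] zs by (auto simp: real_differentiable_def)
        qed (use st zs in auto)
        then obtain \<xi> where \<xi>: "s < \<xi>" "\<xi> < t" "DERIV V \<xi> :> 0" by blast
        then have "exp (\<gamma> * \<xi>) * P \<xi> = 0" using dV[of \<xi>] zs DERIV_unique by fastforce
        then have "P \<xi> = 0" by simp
        then have "\<bar>R \<xi>\<bar> \<le> \<eta>" using close[of \<xi>] \<xi> zs False by simp
        moreover have "\<bar>\<xi> - y s\<bar> \<le> \<delta>" using y(2)[OF st(1)] y(2)[OF st(2)] st \<xi> by simp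
        ultimately show False using RZ'[OF y(1)[OF st(1)]] \<eta> by fastforce
      qed
      have "inj_on y A" by (rule linorder_inj_onI) (use inj in \<open>auto simp: not_le\<close>)
      \<comment> \<open>Equal cardinalities make the injection onto, so some zero of
        \<open>V\<close> lies near z0. As z is the leftmost, z \<le> z0 + \<delta>; the lower bound
        holds because no element of \<open>Z\<close> is below z0.\<close>
      then have "card (y ` A) = card Z" using A cardZ by (simp add: card_image)
      then have "y ` A = Z" using y(1) by (intro card_subset_eq finZ) auto
      then obtain t where t: "t \<in> A" "y t = z0" using \<open>z0 \<in> Z\<close> by (metis imageE)
      have "z \<le> t" using t by (auto simp: A_def)
      moreover have "t \<le> z0 + \<delta>" using y(2)[OF t(1)] t(2) by linarith
      moreover have "z0 - \<delta> \<le> z"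
      proof -
        have "z \<in> A" by (simp add: A_def)
        then show ?thesis using y[of z] Z_ge[of "y z"] by fastforce
      qed
      ultimately show ?thesis using \<delta> by linarith
    qed
  qed
qed

end

section \<open>Nodal domains and the radial equation\<close>

text \<open>The radius is found between the k-th point of \<open>F\<close> and the next one.
  \<open>F\<close> need not contain all zeros of \<open>v\<close>, so a radius with v \<noteq> 0
  comes from density.\<close>

lemma ex_card_less_eq:
  fixes v :: "real \<Rightarrow> real"
  assumes F: "finite F" "F \<subseteq> {0<..<1}" and k: "k \<le> card F" and v0: "v 0 \<noteq> 0"
    and dense: "\<And>a b. 0 \<le> a \<Longrightarrow> a < b \<Longrightarrow> b \<le> 1 \<Longrightarrow> \<exists>r. a < r \<and> r < b \<and> v r \<noteq> 0"
  shows "\<exists>r. 0 \<le> r \<and> r < 1 \<and> v r \<noteq> 0 \<and> card {y\<in>F. y < r} = k"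
proof (cases "k = 0")
  case True
  have "{y\<in>F. y < 0} = {}" using F by force
  then show ?thesis using v0 True by (intro exI[of _ 0]) (auto simp del: Collect_empty_eq)
next
  case False
  define \<iota> where "\<iota> z = card {y\<in>F. y \<le> z}" for z
  have \<iota>_less: "\<iota> y < \<iota> z" if "y < z" "z \<in> F" for y z
  proof -
    have "{w\<in>F. w \<le> y} \<subseteq> {w\<in>F. w \<le> z}" "z \<in> {w\<in>F. w \<le> z}" "z \<notin> {w\<in>F. w \<le> y}"
      using that by auto
    then have "{w\<in>F. w \<le> y} \<subset> {w\<in>F. w \<le> z}" by blast
    then show ?thesis unfolding \<iota>_def using F by (intro psubset_card_mono) auto
  qed
  have "inj_on \<iota> F"
    by (rule linorder_inj_onI) (use \<iota>_less in \<open>fastforce simp: not_le\<close>)+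
  moreover have "\<iota> ` F \<subseteq> {1..card F}"
  proof safe
    fix z assume "z \<in> F"
    have "\<iota> z \<le> card F" unfolding \<iota>_def using F by (intro card_mono) auto
    moreover have "\<iota> z > 0" using \<open>z \<in> F\<close> F by (auto simp: \<iota>_def card_gt_0_iff)
    ultimately show "\<iota> z \<in> {1..card F}" by simp
  qed
  ultimately have "\<iota> ` F = {1..card F}" by (intro card_subset_eq) (auto simp: card_image)
  then obtain z where z: "z \<in> F" "\<iota> z = k" using k False by (metis atLeastAtMost_iff imageE less_one not_le)
  define b where "b = Min (insert 1 {y\<in>F. y > z})"
  have zb: "z < b" unfolding b_def using z F by (subst Min_gr_iff) auto
  have b: "b \<le> 1" "\<And>y. y \<in> F \<Longrightarrow> y > z \<Longrightarrow> b \<le> y" unfolding b_def using F by auto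
  obtain r where r: "z < r" "r < b" "v r \<noteq> 0" using dense[of z b] z F zb b by force
  have "{y\<in>F. y < r} = {y\<in>F. y \<le> z}" using r b(2) by force
  then show ?thesis using r z b F by (intro exI[of _ r]) (force simp: \<iota>_def)
qed

text \<open>The number of zeros below \<open>norm x\<close> is constant on components and separates them.\<close>

lemma card_nodal_domains_radial:
  fixes u :: "'a::euclidean_space \<Rightarrow> real" and v :: "real \<Rightarrow> real"
  assumes dim: "DIM('a) \<ge> 2" and uv: "\<And>x. x \<in> ball 0 1 \<Longrightarrow> u x = v (norm x)" and v0: "v 0 \<noteq> 0"
    and dense: "\<And>a b. 0 \<le> a \<Longrightarrow> a < b \<Longrightarrow> b \<le> 1 \<Longrightarrow> \<exists>r. a < r \<and> r < b \<and> v r \<noteq> 0"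
    and K: "card (nodal_domains u) = K" "K \<ge> 1"
  shows "finite {r\<in>{0<..<1}. v r = 0} \<and> card {r\<in>{0<..<1}. v r = 0} = K - 1"
proof -
  define S where "S = {x \<in> ball 0 1. u x \<noteq> 0}"
  define Z where "Z = {r\<in>{0<..<1}. v r = 0}"
  have fin: "finite (components S)" and cK: "card (components S) = K"
    using K card_ge_0_finite[of "components S"] by (auto simp: nodal_domains_def S_def)
  define \<iota> where "\<iota> F x = card {z\<in>F. z < norm x}" for F and x :: 'a
  have const: "\<iota> F x = \<iota> F y" if C: "C \<in> components S" "x \<in> C" "y \<in> C" "F \<subseteq> Z" for C x y F
  proof -
    have *: "{z\<in>F. z < norm x} = {z\<in>F. z < norm y}" if xy: "x \<in> C" "y \<in> C" "norm x \<le> norm y" for x y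
    proof -
      have "connected (norm ` C)"
        using C(1) by (intro connected_continuous_image continuous_intros in_components_connected)
      then have "{norm x..norm y} \<subseteq> norm ` C" using xy by (intro connected_contains_Icc) auto
      moreover have "z \<notin> norm ` C" if "z \<in> F" for z
      proof
        assume "z \<in> norm ` C"
        then obtain w where "w \<in> C" "z = norm w" by auto
        then have "w \<in> S" "v (norm w) = 0"
          using in_components_subset[OF C(1)] that \<open>F \<subseteq> Z\<close> by (auto simp: Z_def)
        then show False using uv[of w] by (simp add: S_def)
      qed
      ultimately have "z \<notin> {norm x..norm y}" if "z \<in> F" for z using that by blast
      then have "\<not> (norm x \<le> z \<and> z \<le> norm y)" if "z \<in> F" for z using that by simp
      then have "z < norm x \<longleftrightarrow> z < norm y" if "z \<in> F" for z
        using xy(3) that by (metis not_le less_le_trans less_imp_le)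
      then show ?thesis by blast
    qed
    show ?thesis
    proof (cases "norm x \<le> norm y")
      case True
      show ?thesis unfolding \<iota>_def *[OF C(2,3) True] ..
    next
      case False
      then have "norm y \<le> norm x" by simp
      from *[OF C(3,2) this] show ?thesis unfolding \<iota>_def by (rule arg_cong[where f = card, symmetric])
    qed
  qed
  \<comment> \<open>Formulated for finite subsets because finiteness of \<open>Z\<close> is deduced
    from it: K zeros would already require K + 1 components.\<close>
  have le: "Suc (card F) \<le> K" if F: "finite F" "F \<subseteq> Z" for F
  proof -
    have "{0..card F} \<subseteq> (\<lambda>C. \<iota> F (SOME x. x \<in> C)) ` components S"
    proof
      fix k assume "k \<in> {0..card F}"
      moreover have "F \<subseteq> {0<..<1}" using F by (auto simp: Z_def)
      ultimately obtain r where r: "0 \<le> r" "r < 1" "v r \<noteq> 0" "card {y\<in>F. y < r} = k"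
        using ex_card_less_eq[OF F(1) _ _ v0 dense, of k] by auto
      obtain e :: 'a where e: "e \<in> Basis" using nonempty_Basis by blast
      define x where "x = r *\<^sub>R e"
      have nx: "norm x = r" using r e by (simp add: x_def)
      then have "x \<in> S" using r uv[of x] by (simp add: S_def)
      then obtain C where C: "C \<in> components S" "x \<in> C"
        using Union_components[of S] by blast
      have "(SOME x. x \<in> C) \<in> C" using C(2) by (rule someI)
      then have "\<iota> F (SOME x. x \<in> C) = \<iota> F x" using C F by (intro const) auto
      also have "\<dots> = k" using r nx by (simp add: \<iota>_def)
      finally show "k \<in> (\<lambda>C. \<iota> F (SOME x. x \<in> C)) ` components S"
        using C(1) by (intro image_eqI[of _ _ C]) auto
    qed
    then have "card {0..card F} \<le> card (components S)" by (rule surj_card_le[OF fin])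
    then show ?thesis using cK by simp
  qed
  have finZ: "finite Z"
  proof (rule ccontr)
    assume "infinite Z"
    then obtain F where "finite F" "card F = K" "F \<subseteq> Z" using infinite_arbitrarily_large by blast
    then show False using le[of F] by simp
  qed
  \<comment> \<open>Equal ranks mean that the closed annulus between the two radii contains no zero.
    It is connected in dimension at least 2 and so lies in both components; \<open>v0\<close> covers
    the case where it is a full ball.\<close>
  have eq: "C = C'" if C: "C \<in> components S" "C' \<in> components S" "x \<in> C" "y \<in> C'" and
    xy: "\<iota> Z x = \<iota> Z y" "norm x \<le> norm y" for C C' x y
  proof -
    have S: "x \<in> S" "y \<in> S" using C in_components_subset by blast+
    have sub: "{z\<in>Z. z < norm x} = {z\<in>Z. z < norm y}"
      using xy finZ by (intro card_subset_eq) (auto simp: \<iota>_def)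
    define A where "A = {w::'a. norm x \<le> norm w \<and> norm w \<le> norm y}"
    have "A \<subseteq> S"
    proof
      fix w assume "w \<in> A"
      then have w: "norm x \<le> norm w" "norm w \<le> norm y" by (auto simp: A_def)
      have vx: "v (norm x) \<noteq> 0" "v (norm y) \<noteq> 0" "norm y < 1" using S uv by (auto simp: S_def)
      have "v (norm w) \<noteq> 0"
      proof
        assume vw: "v (norm w) = 0"
        then have "norm w \<noteq> 0" using v0 by metis
        moreover have "norm w \<noteq> norm y" using vx vw by metis
        ultimately have "norm w \<in> {z\<in>Z. z < norm y}" using w vx vw by (simp add: Z_def)
        then have "norm w < norm x" using sub by blast
        then show False using w by simp
      qed
      then show "w \<in> S" using uv[of w] w vx by (simp add: S_def)
    qed
    moreover have "connected A"
      unfolding A_def using connected_annulus(4)[OF dim, of "norm x" 0 "norm y"] by (simp add: dist_norm conj_commute)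
    moreover have "x \<in> A" "y \<in> A" using xy by (auto simp: A_def)
    ultimately have "A \<subseteq> C" "A \<subseteq> C'"
      using C components_maximal[OF C(1) \<open>connected A\<close> \<open>A \<subseteq> S\<close>]
        components_maximal[OF C(2) \<open>connected A\<close> \<open>A \<subseteq> S\<close>] by blast+
    then show ?thesis using components_nonoverlap[OF C(1,2)] \<open>x \<in> A\<close> by blast
  qed
  define j where "j C = \<iota> Z (SOME x. x \<in> C)" for C
  have "inj_on j (components S)"
  proof (rule inj_onI)
    fix C C' assume C: "C \<in> components S" "C' \<in> components S" "j C = j C'"
    have "(SOME x. x \<in> C) \<in> C" "(SOME x. x \<in> C') \<in> C'"
      using in_components_nonempty C by (metis some_in_eq)+
    then show "C = C'" using eq[of C C' "SOME x. x \<in> C" "SOME x. x \<in> C'"] eq[of C' C "SOME x. x \<in> C'" "SOME x. x \<in> C"] C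
      by (cases "norm (SOME x. x \<in> C) \<le> norm (SOME x. x \<in> C')") (simp_all add: j_def)
  qed
  moreover have "j ` components S \<subseteq> {0..card Z}"
    unfolding j_def \<iota>_def using finZ by (auto intro!: card_mono)
  ultimately have "K \<le> Suc (card Z)"
    using card_inj_on_le[of j "components S" "{0..card Z}"] cK by simp
  then show ?thesis using le[OF finZ] finZ by (simp add: Z_def)
qed

section \<open>From the Laplacian to the radial equation\<close>

lemma DERIV_partial_deriv:
  fixes w :: "'a::euclidean_space \<Rightarrow> real"
  assumes "w differentiable (at (x + r *\<^sub>R i))"
  shows "((\<lambda>s. w (x + s *\<^sub>R i)) has_real_derivative partial_deriv i w (x + r *\<^sub>R i)) (at r)"
proof -
  obtain D where D: "(w has_derivative D) (at (x + r *\<^sub>R i))"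
    using assms by (auto simp: differentiable_def)
  have "((\<lambda>s. w (x + s *\<^sub>R i)) has_derivative (\<lambda>s. D (s *\<^sub>R i))) (at r)"
    by (rule has_derivative_compose[where f = "\<lambda>s. x + s *\<^sub>R i" and g = w, OF _ D]) (auto intro!: derivative_eq_intros)
  moreover have "(\<lambda>s. D (s *\<^sub>R i)) = (*) (D i)"
    using linear_scale[OF has_derivative_linear[OF D]] by (auto simp: mult.commute)
  ultimately have d: "((\<lambda>s. w (x + s *\<^sub>R i)) has_real_derivative D i) (at r)"
    by (simp add: has_field_derivative_def)
  have "((\<lambda>t. w (x + r *\<^sub>R i + t *\<^sub>R i)) has_real_derivative D i) (at 0)"
    using DERIV_shift[of "\<lambda>s. w (x + s *\<^sub>R i)" "D i" 0 r] d by (simp add: algebra_simps)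
  then have "partial_deriv i w (x + r *\<^sub>R i) = D i"
    unfolding partial_deriv_def by (rule DERIV_imp_deriv)
  then show ?thesis using d by simp
qed

lemma norm_add_orthogonal_Basis:
  assumes "e \<in> Basis" "i \<in> Basis" "i \<noteq> e"
  shows "norm (r *\<^sub>R e + t *\<^sub>R i) = sqrt (r\<^sup>2 + t\<^sup>2)"
  using assms by (simp add: norm_eq_sqrt_inner inner_add_left inner_add_right inner_Basis power2_eq_square)

text \<open>Evaluated on the axis of \<open>e\<close> only. In each of the N - 1 orthogonal
  directions the radius is h(t) = sqrt(r^2 + t^2), which is stationary at t = 0, so only the
  derivative 1/r of t/h survives.\<close>

lemma laplacian_radial:
  fixes u :: "'a::euclidean_space \<Rightarrow> real"
  assumes uv: "\<And>x. x \<in> ball 0 1 \<Longrightarrow> u x = v (norm x)" and e: "e \<in> Basis"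
    and v': "\<And>r. 0 < r \<Longrightarrow> r < 1 \<Longrightarrow> (v has_real_derivative v' r) (at r)"
    and v'': "(v' has_real_derivative v'') (at r)"
    and ee: "partial_deriv e (partial_deriv e u) (r *\<^sub>R e) = v''"
    and r: "0 < r" "r < 1"
  shows "laplacian u (r *\<^sub>R e) = v'' + (real DIM('a) - 1) * (v' r / r)"
proof -
  have tangential: "partial_deriv i (partial_deriv i u) (r *\<^sub>R e) = v' r / r" if i: "i \<in> Basis" "i \<noteq> e" for i
  proof -
    define h where "h t = sqrt (r\<^sup>2 + t\<^sup>2)" for t
    have pos: "r\<^sup>2 + t\<^sup>2 > 0" for t using r by (simp add: add_pos_nonneg)
    have h_pos: "h t > 0" for t using pos by (simp add: h_def)
    have dh: "(h has_real_derivative t / h t) (at t)" for t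
      unfolding h_def using pos[of t] by (auto intro!: derivative_eq_intros simp: field_simps)
    have norm_h: "norm (r *\<^sub>R e + t *\<^sub>R i) = h t" for t
      using norm_add_orthogonal_Basis[OF e i] by (simp add: h_def)
    have "isCont h 0" using dh by (rule DERIV_isCont)
    then have "\<forall>\<^sub>F t in nhds 0. h t < 1"
      using r by (intro order_tendstoD(2)[of h "h 0"])
        (simp_all add: isCont_def tendsto_at_iff_tendsto_nhds, simp add: h_def)
    \<comment> \<open>Nested neighbourhoods, since the first partial derivative at \<open>t\<close>
      requires the radial formula around \<open>t\<close> and not merely at it.\<close>
    then have ev: "\<forall>\<^sub>F t in nhds 0. \<forall>\<^sub>F s in nhds t. h s < 1" by (simp add: eventually_eventually)
    have "\<forall>\<^sub>F t in nhds 0. partial_deriv i u (r *\<^sub>R e + t *\<^sub>R i) = v' (h t) * (t / h t)"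
      using ev
    proof eventually_elim
      case (elim t)
      have "h t < 1" using elim eventually_nhds_x_imp_x by blast
      have "((\<lambda>s. v (h s)) has_real_derivative v' (h t) * (t / h t)) (at t)"
        by (rule DERIV_chain2[OF v'[OF h_pos \<open>h t < 1\<close>] dh])
      moreover have "\<forall>\<^sub>F s in nhds t. v (h s) = u (r *\<^sub>R e + s *\<^sub>R i)"
        using elim by eventually_elim (simp add: uv norm_h)
      ultimately have "((\<lambda>s. u (r *\<^sub>R e + s *\<^sub>R i)) has_real_derivative v' (h t) * (t / h t)) (at t)"
        by (subst DERIV_cong_ev[OF refl _ refl, symmetric])
      then have "((\<lambda>s. u (r *\<^sub>R e + t *\<^sub>R i + s *\<^sub>R i)) has_real_derivative v' (h t) * (t / h t)) (at 0)"
        using DERIV_shift[of "\<lambda>s. u (r *\<^sub>R e + s *\<^sub>R i)" _ 0 t] by (simp add: algebra_simps)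
      then show ?case unfolding partial_deriv_def by (rule DERIV_imp_deriv)
    qed
    moreover have "((\<lambda>t. v' (h t) * (t / h t)) has_real_derivative v' r / r) (at 0)"
    proof -
      have h0: "h 0 = r" using r by (simp add: h_def)
      have "((\<lambda>t. v' (h t)) has_real_derivative v'' * (0 / h 0)) (at 0)"
        by (rule DERIV_chain2[OF _ dh]) (simp add: h0 v'')
      moreover have "((\<lambda>t. t / h t) has_real_derivative (1 * h 0 - 0 * (0 / h 0)) / (h 0 * h 0)) (at 0)"
        by (rule DERIV_divide[OF DERIV_ident dh]) (use r h0 in auto)
      ultimately have "((\<lambda>t. v' (h t) * (t / h t)) has_real_derivative
          v'' * (0 / h 0) * (0 / h 0) + (1 * h 0 - 0 * (0 / h 0)) / (h 0 * h 0) * v' (h 0)) (at 0)"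
        by (rule DERIV_mult)
      then show ?thesis using r by (simp add: h0)
    qed
    ultimately have "((\<lambda>t. partial_deriv i u (r *\<^sub>R e + t *\<^sub>R i)) has_real_derivative v' r / r) (at 0)"
      by (subst DERIV_cong_ev[OF refl _ refl])
    then show ?thesis unfolding partial_deriv_def[of i "partial_deriv i u"] by (rule DERIV_imp_deriv)
  qed
  have "laplacian u (r *\<^sub>R e) = v'' + (\<Sum>i\<in>Basis - {e}. partial_deriv i (partial_deriv i u) (r *\<^sub>R e))"
    unfolding laplacian_def using e ee by (simp add: sum.remove)
  also have "(\<Sum>i\<in>Basis - {e}. partial_deriv i (partial_deriv i u) (r *\<^sub>R e)) = (\<Sum>i\<in>Basis - {e}. v' r / r)"
    using tangential by (intro sum.cong) auto
  also have "\<dots> = (real DIM('a) - 1) * (v' r / r)"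
    using e by (simp add: card_Diff_singleton of_nat_diff DIM_positive Suc_leI)
  finally show ?thesis .
qed

text \<open>The derivative at the origin is left aside: the bound \<open>B\<close>, from the
  continuous extension of the gradient to the closed ball, makes r^(N-1) v' vanish as r tends to 0,
  which becomes P \<rightarrow> 0 at infinity.\<close>

lemma henon_radial_profile:
  fixes u :: "'a::euclidean_space \<Rightarrow> real"
  assumes u: "henon_radial_solution p \<alpha> K u"
  obtains v' B where
    "\<And>x. x \<in> cball 0 1 \<Longrightarrow> u x = radial_profile u (norm x)"
    "continuous_on {0..1} (radial_profile u)" "radial_profile u 0 = u 0" "radial_profile u 1 = 0"
    "\<And>r. 0 < r \<Longrightarrow> r < 1 \<Longrightarrow> (radial_profile u has_real_derivative v' r) (at r)"
    "\<And>r. 0 < r \<Longrightarrow> r < 1 \<Longrightarrow> \<bar>v' r\<bar> \<le> B"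
    "\<And>r. 0 < r \<Longrightarrow> r < 1 \<Longrightarrow> ((\<lambda>r. r ^ (DIM('a) - 1) * v' r) has_real_derivative
       - (r ^ (DIM('a) - 1) * (r powr \<alpha> * signed_powr (p - 2) (radial_profile u r)))) (at r)"
proof -
  define e :: 'a where "e = (SOME e. e \<in> Basis)"
  have e: "e \<in> Basis" unfolding e_def by (simp add: some_in_eq)
  define v where "v = radial_profile u"
  have v: "v r = u (r *\<^sub>R e)" for r by (simp add: v_def radial_profile_def e_def)
  have C2: "C2_closure (ball 0 1) u" and rad: "radial_on_ball u"
    and pde: "\<And>x. x \<in> ball 0 1 \<Longrightarrow> - laplacian u x = norm x powr \<alpha> * \<bar>u x\<bar> powr (p - 2) * u x"
    and bd: "\<And>x. x \<in> sphere 0 1 \<Longrightarrow> u x = 0"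
    using u by (auto simp: henon_radial_solution_def)
  have uv: "u x = v (norm x)" if "x \<in> cball 0 1" for x
  proof -
    have "u x = u (norm x *\<^sub>R e)"
      using rad[unfolded radial_on_ball_def, rule_format, of x "norm x *\<^sub>R e"] that e by simp
    then show ?thesis by (simp add: v)
  qed
  define v' where "v' r = partial_deriv e u (r *\<^sub>R e)" for r
  define v'' where "v'' r = partial_deriv e (partial_deriv e u) (r *\<^sub>R e)" for r
  have in_ball: "r *\<^sub>R e \<in> ball 0 1" if "0 < r" "r < 1" for r using that e by simp
  have dv: "(v has_real_derivative v' r) (at r)" if "0 < r" "r < 1" for r
    using DERIV_partial_deriv[of u 0 r e] C2 in_ball[OF that]
    by (auto simp: C2_closure_def v'_def v[abs_def])
  have dv': "(v' has_real_derivative v'' r) (at r)" if "0 < r" "r < 1" for r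
    using DERIV_partial_deriv[of "partial_deriv e u" 0 r e] C2 in_ball[OF that] e
    by (auto simp: C2_closure_def v'_def[abs_def] v''_def)
  have ode: "v'' r + (real DIM('a) - 1) * (v' r / r) = - (r powr \<alpha> * signed_powr (p - 2) (v r))"
    if r: "0 < r" "r < 1" for r
  proof -
    have "laplacian u (r *\<^sub>R e) = v'' r + (real DIM('a) - 1) * (v' r / r)"
      by (rule laplacian_radial[OF _ e dv dv'[OF r] _ r]) (auto simp: uv v''_def)
    then show ?thesis using pde[OF in_ball[OF r]] r e by (simp add: signed_powr_def v)
  qed
  have "\<exists>B. \<forall>r. 0 < r \<longrightarrow> r < 1 \<longrightarrow> \<bar>v' r\<bar> \<le> B"
  proof -
    obtain g where g: "continuous_on (cball 0 1) g" "\<And>x. x \<in> ball 0 1 \<Longrightarrow> g x = partial_deriv e u x"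
      using C2 e by (auto simp: C2_closure_def extends_continuously_def)
    have "bounded (g ` cball 0 1)"
      using g(1) by (intro compact_imp_bounded compact_continuous_image) auto
    then obtain B where B: "\<forall>x\<in>cball 0 1. \<bar>g x\<bar> \<le> B"
      by (auto simp: bounded_iff)
    then have "\<bar>v' r\<bar> \<le> B" if "0 < r" "r < 1" for r
      using g(2)[OF in_ball[OF that]] in_ball[OF that] B[rule_format, of "r *\<^sub>R e"]
      unfolding v'_def by simp
    then show ?thesis by blast
  qed
  then obtain B where B: "\<And>r. 0 < r \<Longrightarrow> r < 1 \<Longrightarrow> \<bar>v' r\<bar> \<le> B" by blast
  show thesis
  proof (rule that[of v' B, folded v_def])
    show "u x = v (norm x)" if "x \<in> cball 0 1" for x by (rule uv[OF that])
    have "continuous_on (cball 0 1) u" using C2 by (simp add: C2_closure_def)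
    then show "continuous_on {0..1} v" unfolding v[abs_def]
      by (rule continuous_on_compose2) (use e in \<open>auto intro!: continuous_intros\<close>)
    show "v 0 = u 0" by (simp add: v)
    show "v 1 = 0" unfolding v using e by (intro bd) simp
    fix r :: real assume r: "0 < r" "r < 1"
    show "(v has_real_derivative v' r) (at r)" "\<bar>v' r\<bar> \<le> B" by (fact dv[OF r], fact B[OF r])
    define k where "k = DIM('a) - 1"
    have k: "real k = real DIM('a) - 1" using DIM_positive[where 'a = 'a] by (simp add: k_def of_nat_diff Suc_leI)
    have pk: "real k * r ^ (k - 1) = r ^ k * (real k / r)" using r by (cases k) auto
    have "((\<lambda>r. r ^ k * v' r) has_real_derivative (real k * r ^ (k - 1)) * v' r + r ^ k * v'' r) (at r)"
      by (rule derivative_eq_intros dv'[OF r] refl)+ simp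
    also have "(real k * r ^ (k - 1)) * v' r + r ^ k * v'' r = r ^ k * (v'' r + real k * (v' r / r))"
      unfolding pk by (simp add: algebra_simps)
    also have "\<dots> = - (r ^ k * (r powr \<alpha> * signed_powr (p - 2) (v r)))"
      unfolding k ode[OF r] by simp
    finally show "((\<lambda>r. r ^ (DIM('a) - 1) * v' r) has_real_derivative
       - (r ^ (DIM('a) - 1) * (r powr \<alpha> * signed_powr (p - 2) (v r)))) (at r)" unfolding k_def .
  qed
qed

section \<open>Scaling and convergence\<close>

lemma zero_set_shift:
  fixes V :: "real \<Rightarrow> real"
  shows "{t. t > z \<and> V (t + s) = 0} = (\<lambda>t. t - s) ` {t. t > z + s \<and> V t = 0}"
    and "finite {t. t > z \<and> V (t + s) = 0} \<longleftrightarrow> finite {t. t > z + s \<and> V t = 0}"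
    and "card {t. t > z \<and> V (t + s) = 0} = card {t. t > z + s \<and> V t = 0}"
proof -
  show *: "{t. t > z \<and> V (t + s) = 0} = (\<lambda>t. t - s) ` {t. t > z + s \<and> V t = 0}"
    by (auto simp: image_iff intro!: exI[of _ "_ + s"])
  have inj: "inj_on (\<lambda>t. t - s) A" for A by (auto intro: inj_onI)
  show "finite {t. t > z \<and> V (t + s) = 0} \<longleftrightarrow> finite {t. t > z + s \<and> V t = 0}"
    unfolding * by (rule finite_image_iff[OF inj])
  show "card {t. t > z \<and> V (t + s) = 0} = card {t. t > z + s \<and> V t = 0}"
    unfolding * by (rule card_image[OF inj])
qed

text \<open>A shift by s multiplies the weight e^(-t) by e^(-s) and the momentum by e^(\<gamma>s);
  the equation is restored exactly when c^q = e^(-(1-\<gamma>)s).\<close>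

lemma emden_scale:
  assumes e: "emden (signed_powr q) \<gamma> T V P a" and q: "q > 0"
    and c: "c = exp (- ((1 - \<gamma>) * s / q))"
  shows "emden (signed_powr q) \<gamma> (T - s) (\<lambda>t. c * V (t + s)) (\<lambda>t. c * exp (\<gamma> * s) * P (t + s)) (c * a)"
  unfolding emden_def
proof (intro conjI allI impI)
  have cpos: "c > 0" by (simp add: c)
  have cq: "c powr q = exp (- ((1 - \<gamma>) * s))" using q by (simp add: c powr_def)
  fix t assume t: "T - s < t"
  have "T < t + s" using t by simp
  then have d: "(V has_real_derivative exp (\<gamma> * (t + s)) * P (t + s)) (at (t + s))"
    "(P has_real_derivative - (exp (- (t + s)) * signed_powr q (V (t + s)))) (at (t + s))"
    using e unfolding emden_def by blast+
  have d': "((\<lambda>t. V (t + s)) has_real_derivative exp (\<gamma> * (t + s)) * P (t + s)) (at t)"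
    "((\<lambda>t. P (t + s)) has_real_derivative - (exp (- (t + s)) * signed_powr q (V (t + s)))) (at t)"
    using d by (simp_all add: DERIV_shift)
  show "((\<lambda>t. c * V (t + s)) has_real_derivative exp (\<gamma> * t) * (c * exp (\<gamma> * s) * P (t + s))) (at t)"
    using DERIV_cmult[OF d'(1), of c] by (simp add: distrib_left exp_add mult_ac)
  have "- (exp (- t) * signed_powr q (c * V (t + s)))
      = c * exp (\<gamma> * s) * (- (exp (- (t + s)) * signed_powr q (V (t + s))))"
    using cpos by (simp add: signed_powr_mult cq left_diff_distrib exp_diff exp_add exp_minus field_simps)
  then show "((\<lambda>t. c * exp (\<gamma> * s) * P (t + s)) has_real_derivative
      - (exp (- t) * signed_powr q (c * V (t + s)))) (at t)"
    using DERIV_cmult[OF d'(2), of "c * exp (\<gamma> * s)"] by simp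
next
  have sh: "filterlim (\<lambda>t::real. t + s) at_top at_top"
    using filterlim_tendsto_add_at_top[OF tendsto_const filterlim_ident, of s] by (simp add: add.commute)
  have "(V \<longlongrightarrow> a) at_top" "(P \<longlongrightarrow> 0) at_top" using e by (auto simp: emden_def)
  from this[THEN filterlim_compose, OF sh]
  show "((\<lambda>t. c * V (t + s)) \<longlongrightarrow> c * a) at_top"
    "((\<lambda>t. c * exp (\<gamma> * s) * P (t + s)) \<longlongrightarrow> 0) at_top"
    by (auto intro!: tendsto_mult_right_zero tendsto_mult_left)
qed

text \<open>A solution normalised to limit 1 and started at one of its zeros. Nothing is asked to
  the left of \<open>z\<close>, because the rescaled Henon solutions exist on a half-line
  only.\<close>

definition shooting :: "real \<Rightarrow> real \<Rightarrow> nat \<Rightarrow> real \<Rightarrow> (real \<Rightarrow> real) \<Rightarrow> (real \<Rightarrow> real) \<Rightarrow> bool" where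
  "shooting q \<gamma> n z Y Q \<longleftrightarrow> emden (signed_powr q) \<gamma> z Y Q 1 \<and> continuous_on {z..} Y \<and> Y z = 0 \<and>
     finite {t. t > z \<and> Y t = 0} \<and> card {t. t > z \<and> Y t = 0} = n \<and> (\<forall>t>z. \<bar>Y t\<bar> \<le> 1)"

lemma shooting_normalise:
  assumes e: "emden (signed_powr q) \<gamma> 0 V P a" and q: "q > 0" and \<gamma>: "0 \<le> \<gamma>" "\<gamma> < 1" and a: "a > 0"
    and V: "continuous_on {0..} V" "V 0 = 0" "\<And>t. t > 0 \<Longrightarrow> \<bar>V t\<bar> \<le> M"
    and Z: "finite {t. t > 0 \<and> V t = 0}" "card {t. t > 0 \<and> V t = 0} = n"
  shows "\<exists>z Y Q. shooting q \<gamma> n z Y Q \<and> (\<forall>t\<ge>0. V t = exp (- ((1 - \<gamma>) * z / q)) * Y (t + z))"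
proof -
  define s where "s = q * ln a / (1 - \<gamma>)"
  define c where "c = exp (- ((1 - \<gamma>) * s / q))"
  define Y where "Y t = c * V (t + s)" for t
  define Q where "Q t = c * exp (\<gamma> * s) * P (t + s)" for t
  have "(1 - \<gamma>) * s / q = ln a" using q \<gamma> by (simp add: s_def)
  then have c: "c = 1 / a" and c': "exp (- ((1 - \<gamma>) * (- s) / q)) = a"
    using a by (simp_all add: c_def exp_minus inverse_eq_divide)
  have "emden (signed_powr q) \<gamma> (- s) Y Q 1"
    using emden_scale[OF e q c_def] a by (simp add: c Y_def[abs_def] Q_def[abs_def])
  moreover have "continuous_on {- s..} Y" unfolding Y_def
    by (intro continuous_intros continuous_on_compose2[OF V(1)]) auto
  moreover have "Y (- s) = 0" by (simp add: Y_def V)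
  moreover have Yz: "{t. t > - s \<and> Y t = 0} = {t. t > - s \<and> V (t + s) = 0}"
    using a by (simp add: Y_def c)
  have "finite {t. t > - s \<and> Y t = 0}" "card {t. t > - s \<and> Y t = 0} = n"
    unfolding Yz using zero_set_shift(2,3)[of "- s" V s] Z by simp_all
  moreover have "\<bar>Y t\<bar> \<le> 1" if "t > - s" for t
    using emden_abs_le[OF e V(3) q \<gamma>, of "t + s"] that a by (simp add: Y_def c abs_mult)
  ultimately have "shooting q \<gamma> n (- s) Y Q" by (simp add: shooting_def)
  moreover have "V t = exp (- ((1 - \<gamma>) * (- s) / q)) * Y (t + - s)" for t
    unfolding c' using a by (simp add: Y_def c)
  ultimately show ?thesis by blast
qed

section \<open>The rescaled Henon solution as a solution of the Emden--Fowler system\<close>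

text \<open>With r = e^(-t/m) and m = N + \<alpha> the powers r^(N-1), r^\<alpha> and the r from the
  chain rule combine to r^m = e^(-t). The amplitude satisfies c^(p-2) = m^(-2), which accounts for
  the two factors 1/m from differentiating twice.\<close>

lemma henon_emden:
  fixes u :: "'a::euclidean_space \<Rightarrow> real"
  assumes u: "henon_radial_solution p \<alpha> K u" and dim: "DIM('a) \<ge> 2" and p: "p > 2" and \<alpha>: "\<alpha> > 0"
    and K: "K \<ge> 1"
  shows "\<exists>P M.
    emden (signed_powr (p - 2)) ((real DIM('a) - 2) / (real DIM('a) + \<alpha>)) 0 (henon_rescaled p \<alpha> u) P
       ((real DIM('a) + \<alpha>) powr (- 2 / (p - 2)) * u 0) \<and>
    continuous_on {0..} (henon_rescaled p \<alpha> u) \<and> henon_rescaled p \<alpha> u 0 = 0 \<and>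
    (\<forall>t>0. \<bar>henon_rescaled p \<alpha> u t\<bar> \<le> M) \<and>
    finite {t. t > 0 \<and> henon_rescaled p \<alpha> u t = 0} \<and>
    card {t. t > 0 \<and> henon_rescaled p \<alpha> u t = 0} = K - 1"
proof -
  obtain v' B where
    uv: "\<And>x. x \<in> cball 0 1 \<Longrightarrow> u x = radial_profile u (norm x)"
    and v01: "continuous_on {0..1} (radial_profile u)" "radial_profile u 0 = u 0" "radial_profile u 1 = 0"
    and dv: "\<And>r. 0 < r \<Longrightarrow> r < 1 \<Longrightarrow> (radial_profile u has_real_derivative v' r) (at r)"
    and B: "\<And>r. 0 < r \<Longrightarrow> r < 1 \<Longrightarrow> \<bar>v' r\<bar> \<le> B"
    and dS: "\<And>r. 0 < r \<Longrightarrow> r < 1 \<Longrightarrow> ((\<lambda>r. r ^ (DIM('a) - 1) * v' r) has_real_derivative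
       - (r ^ (DIM('a) - 1) * (r powr \<alpha> * signed_powr (p - 2) (radial_profile u r)))) (at r)"
    using henon_radial_profile[OF u] by blast
  define v where "v = radial_profile u"
  define k where "k = DIM('a) - 2"
  define m where "m = real DIM('a) + \<alpha>"
  define c where "c = m powr (- 2 / (p - 2))"
  define \<gamma> where "\<gamma> = (real DIM('a) - 2) / m"
  define S where "S r = r ^ (DIM('a) - 1) * v' r" for r
  define r where "r t = exp (- t / m)" for t
  define U where "U t = c * v (r t)" for t
  \<comment> \<open>This is e^(-\<gamma>t) U', because e^(-\<gamma>t) = r^(N-2).\<close>
  define P where "P t = - (c / m) * S (r t)" for t
  have k: "DIM('a) - 1 = Suc k" "real k = real DIM('a) - 2" using dim by (auto simp: k_def of_nat_diff)
  have m: "m > 0" using \<alpha> by (simp add: m_def add_nonneg_pos)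
  have c: "c > 0" using m by (simp add: c_def)
  have \<gamma>0: "\<gamma> \<ge> 0" using m dim by (simp add: \<gamma>_def)
  have U: "henon_rescaled p \<alpha> u = U"
    by (auto simp: fun_eq_iff henon_rescaled_def U_def c_def m_def r_def v_def)
  have r01: "0 < r t" "t > 0 \<Longrightarrow> r t < 1" for t using m by (auto simp: r_def)
  have dr: "(r has_real_derivative - r t / m) (at t)" for t
    unfolding r_def using m by (auto intro!: derivative_eq_intros)
  have dU: "(U has_real_derivative exp (\<gamma> * t) * P t) (at t)" if t: "t > 0" for t
  proof -
    have "(U has_real_derivative c * (v' (r t) * (- r t / m))) (at t)"
      unfolding U_def v_def by (intro DERIV_cmult DERIV_chain2[OF dv dr] r01 t)
    moreover have "exp (\<gamma> * t) * r t ^ k = 1"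
      using m by (simp add: r_def exp_of_nat_mult[symmetric] mult_exp_exp \<gamma>_def k)
    moreover have "exp (\<gamma> * t) * P t = c * (v' (r t) * (- r t / m)) * (exp (\<gamma> * t) * r t ^ k)"
      unfolding P_def S_def k(1) by simp
    ultimately show ?thesis by simp
  qed
  have cm: "c powr (p - 2) = 1 / (m * m)"
  proof -
    have "p - 2 \<noteq> 0" using p by simp
    then have "- 2 / (p - 2) * (p - 2) = - 2" by (rule nonzero_eq_divide_eq[THEN iffD1]) (rule refl)
    then have "c powr (p - 2) = m powr (- 2)" unfolding c_def powr_powr by simp
    also have "\<dots> = 1 / (m * m)" using m by (simp add: powr_minus_divide power2_eq_square)
    finally show ?thesis .
  qed
  have dP: "(P has_real_derivative - (exp (- t) * signed_powr (p - 2) (U t))) (at t)" if t: "t > 0" for t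
  proof -
    have pw: "r t ^ (DIM('a) - 1) * r t powr \<alpha> * r t = exp (- t)"
    proof -
      have "r t ^ (DIM('a) - 1) * r t = r t ^ DIM('a)" using dim by (simp add: k k_def power_Suc[symmetric] mult.commute del: power_Suc)
      also have "\<dots> = r t powr (real DIM('a))" using r01(1)[of t] by (simp add: powr_realpow)
      finally have "r t ^ (DIM('a) - 1) * r t * r t powr \<alpha> = r t powr m"
        using r01(1)[of t] by (simp add: m_def powr_add)
      also have "\<dots> = exp (- t)" using m by (simp add: r_def powr_def)
      finally show ?thesis by (simp add: mult_ac)
    qed
    have Ut: "signed_powr (p - 2) (U t) = 1 / (m * m) * c * signed_powr (p - 2) (v (r t))"
      unfolding U_def using c by (simp add: signed_powr_mult cm)
    have "(P has_real_derivative - (c / m) * (- (r t ^ (DIM('a) - 1) * (r t powr \<alpha> * signed_powr (p - 2) (v (r t)))) * (- r t / m))) (at t)"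
      unfolding P_def S_def v_def by (intro DERIV_cmult DERIV_chain2[OF dS dr] r01 t)
    also have "- (c / m) * (- (r t ^ (DIM('a) - 1) * (r t powr \<alpha> * signed_powr (p - 2) (v (r t)))) * (- r t / m))
        = - ((r t ^ (DIM('a) - 1) * r t powr \<alpha> * r t) * signed_powr (p - 2) (U t))"
      unfolding Ut by simp
    finally show ?thesis unfolding pw .
  qed
  have r0: "(r \<longlongrightarrow> 0) at_top"
    using tendsto_exp_neg_mult_at_top[of "1 / m"] m by (simp add: r_def[abs_def])
  have emd: "emden (signed_powr (p - 2)) \<gamma> 0 U P (c * u 0)"
    unfolding emden_def
  proof (intro conjI allI impI)
    have "(v \<longlongrightarrow> v 0) (at 0 within {0..1})" using v01(1) by (simp add: v_def continuous_on_def)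
    moreover have "filterlim r (at 0 within {0..1}) at_top"
      unfolding filterlim_at
    proof (rule conjI[OF _ r0])
      show "\<forall>\<^sub>F x in at_top. r x \<in> {0..1} \<and> r x \<noteq> 0"
        using eventually_gt_at_top[of 0] by eventually_elim (use r01 in \<open>auto simp: less_imp_le less_imp_neq[symmetric]\<close>)
    qed
    ultimately have "((\<lambda>t. v (r t)) \<longlongrightarrow> v 0) at_top" by (rule filterlim_compose)
    then show "(U \<longlongrightarrow> c * u 0) at_top" unfolding U_def using v01(2) by (intro tendsto_mult_left) (simp add: v_def)
    have "((\<lambda>t. S (r t)) \<longlongrightarrow> 0) at_top"
    proof (rule Lim_null_comparison)
      show "\<forall>\<^sub>F t in at_top. norm (S (r t)) \<le> B * r t"
        using eventually_gt_at_top[of 0]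
      proof eventually_elim
        case (elim t)
        have rt: "0 < r t" "r t < 1" using r01 elim by auto
        have "norm (S (r t)) = r t ^ k * r t * \<bar>v' (r t)\<bar>"
          unfolding S_def k(1) using rt by (simp add: abs_mult)
        also have "\<dots> \<le> 1 * r t * B"
          using rt B[OF rt] by (intro mult_mono power_le_one) auto
        finally show ?case by (simp add: mult.commute)
      qed
      show "((\<lambda>t. B * r t) \<longlongrightarrow> 0) at_top" by (intro tendsto_mult_right_zero r0)
    qed
    then show "(P \<longlongrightarrow> 0) at_top" unfolding P_def by (intro tendsto_mult_right_zero)
  qed (use dU dP in auto)
  have cU: "continuous_on {0..} U" unfolding U_def v_def
    using m by (intro continuous_intros continuous_on_compose2[OF v01(1)]) (auto simp: r_def intro!: continuous_intros)
  obtain M0 where M0: "\<forall>x\<in>{0..1}. \<bar>v x\<bar> \<le> M0"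
    using compact_imp_bounded[OF compact_continuous_image[OF v01(1)]] by (auto simp: bounded_iff v_def)
  have UM: "\<bar>U t\<bar> \<le> c * M0" if "t > 0" for t
    using M0 r01[of t] that c by (auto simp: U_def abs_mult less_imp_le intro!: mult_left_mono)
  have "u 0 > 0" using u by (simp add: henon_radial_solution_def)
  then have a: "c * u 0 \<noteq> 0" using c by simp
  \<comment> \<open>Vanishing on an interval of radii would give zero Cauchy data at the
    \<open>t\<close> of its midpoint, hence limit 0 at infinity, against u 0 > 0.\<close>
  have dense: "\<exists>r. x < r \<and> r < y \<and> v r \<noteq> 0" if xy: "0 \<le> x" "x < y" "y \<le> 1" for x y
  proof (rule ccontr)
    assume no: "\<not> ?thesis"
    define t where "t = - m * ln ((x + y) / 2)"
    have xy2: "0 < (x + y) / 2" "(x + y) / 2 < 1" using xy by auto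
    have rt: "r t = (x + y) / 2" using m xy2 by (simp add: r_def t_def)
    have t: "t > 0" unfolding t_def using m xy2 by (simp add: mult_pos_neg ln_less_zero)
    have "isCont r t" using dr by (rule DERIV_isCont)
    then have lim: "(r \<longlongrightarrow> r t) (nhds t)"
      by (simp only: isCont_def tendsto_at_iff_tendsto_nhds)
    have "\<forall>\<^sub>F s in nhds t. x < r s" "\<forall>\<^sub>F s in nhds t. r s < y"
      using xy by (auto intro!: order_tendstoD[OF lim] simp: rt)
    then have ev: "\<forall>\<^sub>F s in nhds t. U s = 0" by eventually_elim (use no in \<open>auto simp: U_def\<close>)
    then have "U t = 0" by (rule eventually_nhds_x_imp_x)
    have "(U has_real_derivative 0) (at t)"
      by (subst DERIV_cong_ev[OF refl ev refl]) simp
    then have "exp (\<gamma> * t) * P t = 0" using dU[OF t] DERIV_unique by blast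
    then have "P t = 0" by simp
    then show False
      using emden_zero_imp_limit_zero[OF emd _ \<gamma>0 UM t \<open>U t = 0\<close>] p a by simp
  qed
  have Zr: "finite {r\<in>{0<..<1}. v r = 0} \<and> card {r\<in>{0<..<1}. v r = 0} = K - 1"
  proof (rule card_nodal_domains_radial[OF dim])
    show "u x = v (norm x)" if "x \<in> ball 0 1" for x using uv[of x] that by (simp add: v_def)
    show "v 0 \<noteq> 0" using v01(2) \<open>u 0 > 0\<close> by (simp add: v_def)
    show "card (nodal_domains u) = K" using u by (simp add: henon_radial_solution_def)
  qed (fact dense, fact K)
  have ZU: "{t. t > 0 \<and> U t = 0} = (\<lambda>r. - m * ln r) ` {r\<in>{0<..<1}. v r = 0}"
  proof (intro equalityI subsetI)
    fix t assume "t \<in> {t. t > 0 \<and> U t = 0}"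
    then show "t \<in> (\<lambda>r. - m * ln r) ` {r\<in>{0<..<1}. v r = 0}"
      using c m r01[of t] by (intro image_eqI[of _ _ "r t"]) (auto simp: U_def r_def)
  next
    fix t assume "t \<in> (\<lambda>r. - m * ln r) ` {r\<in>{0<..<1}. v r = 0}"
    then obtain x where x: "0 < x" "x < 1" "v x = 0" "t = - m * ln x" by auto
    then have "r t = x" using m by (simp add: r_def)
    then show "t \<in> {t. t > 0 \<and> U t = 0}" using x m by (auto simp: U_def mult_pos_neg)
  qed
  have inj: "inj_on (\<lambda>r. - m * ln r) {r\<in>{0<..<1}. v r = 0}"
    using m by (intro inj_onI) auto
  show ?thesis unfolding U
  proof (intro exI[of _ P] exI[of _ "c * M0"] conjI allI impI)
    show "emden (signed_powr (p - 2)) ((real DIM('a) - 2) / (real DIM('a) + \<alpha>)) 0 U P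
       ((real DIM('a) + \<alpha>) powr (- 2 / (p - 2)) * u 0)"
      using emd by (simp add: \<gamma>_def m_def c_def)
    show "U 0 = 0" using v01(3) by (simp add: U_def r_def v_def)
    show "finite {t. t > 0 \<and> U t = 0}" unfolding ZU using Zr by simp
    show "card {t. t > 0 \<and> U t = 0} = K - 1" unfolding ZU card_image[OF inj] using Zr by simp
  qed (fact cU, fact UM)
qed

section \<open>Existence and uniqueness for the limit problem\<close>

text \<open>P - F e^(-t) is nondecreasing, so an excess \<delta> at one time persists and makes V
  grow linearly.\<close>

lemma bounded_solution_deriv_le:
  fixes V P h :: "real \<Rightarrow> real"
  assumes dV: "\<And>t. t > T \<Longrightarrow> (V has_real_derivative P t) (at t)"
    and dP: "\<And>t. t > T \<Longrightarrow> (P has_real_derivative - (exp (- t) * h t)) (at t)"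
    and h: "\<And>t. t > T \<Longrightarrow> \<bar>h t\<bar> \<le> F" and M: "\<And>t. t > T \<Longrightarrow> \<bar>V t\<bar> \<le> M" and t: "t > T"
  shows "P t \<le> F * exp (- t)"
proof (rule ccontr)
  assume neg: "\<not> P t \<le> F * exp (- t)"
  define \<delta> where "\<delta> = P t - F * exp (- t)"
  have \<delta>: "\<delta> > 0" using neg by (simp add: \<delta>_def)
  have F: "F \<ge> 0" using h[OF t] by linarith
  have Ps: "\<delta> \<le> P s" if "t \<le> s" for s
  proof -
    have "P t - F * exp (- t) \<le> P s - F * exp (- s)"
    proof (rule DERIV_nonneg_imp_nondecreasing[OF that, of "\<lambda>x. P x - F * exp (- x)"])
      fix x assume x: "t \<le> x" "x \<le> s"
      then have "T < x" using t by simp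
      have "((\<lambda>x. P x - F * exp (- x)) has_real_derivative - (exp (- x) * h x) + F * exp (- x)) (at x)"
        by (auto intro!: derivative_eq_intros dP \<open>T < x\<close>)
      moreover have "h x \<le> F" using h[OF \<open>T < x\<close>] by linarith
      then have "exp (- x) * h x \<le> exp (- x) * F" by (intro mult_left_mono) auto
      ultimately show "\<exists>y. ((\<lambda>x. P x - F * exp (- x)) has_real_derivative y) (at x) \<and> 0 \<le> y"
        by (intro exI[of _ "- (exp (- x) * h x) + F * exp (- x)"]) (simp add: mult.commute)
    qed
    moreover have "0 \<le> F * exp (- s)" using F by simp
    ultimately show ?thesis by (simp add: \<delta>_def)
  qed
  \<comment> \<open>After this time V has risen by at least 2M + 1, more than |V| \<le> M
    permits.\<close>
  define s where "s = t + (2 * M + 1) / \<delta>"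
  have "M \<ge> 0" using M[OF t] by linarith
  then have ts: "t \<le> s" using \<delta> by (simp add: s_def)
  have "V t - \<delta> * t \<le> V s - \<delta> * s"
  proof (rule DERIV_nonneg_imp_nondecreasing[OF ts, of "\<lambda>x. V x - \<delta> * x"])
    fix x assume x: "t \<le> x" "x \<le> s"
    have "((\<lambda>x. V x - \<delta> * x) has_real_derivative P x - \<delta>) (at x)"
      using t x by (auto intro!: derivative_eq_intros dV)
    then show "\<exists>y. ((\<lambda>x. V x - \<delta> * x) has_real_derivative y) (at x) \<and> 0 \<le> y"
      using Ps[OF x(1)] by (intro exI[of _ "P x - \<delta>"]) auto
  qed
  moreover have "\<delta> * s = \<delta> * t + 2 * M + 1" using \<delta> by (simp add: s_def field_simps)
  ultimately show False using M[OF t] M[of s] t ts by linarith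
qed

lemma nonincreasing_bounded_convergent:
  fixes f :: "real \<Rightarrow> real"
  assumes dec: "\<And>s t. T \<le> s \<Longrightarrow> s \<le> t \<Longrightarrow> f t \<le> f s" and bd: "\<And>t. T \<le> t \<Longrightarrow> B \<le> f t"
  obtains l where "(f \<longlongrightarrow> l) at_top"
proof
  have bb: "bdd_below (f ` {T..})" using bd by (intro bdd_belowI2[where m = B]) auto
  show "(f \<longlongrightarrow> (INF t\<in>{T..}. f t)) at_top"
  proof (rule order_tendstoI)
    fix a assume a: "a < (INF t\<in>{T..}. f t)"
    show "\<forall>\<^sub>F t in at_top. a < f t"
      using eventually_ge_at_top[of T]
    proof eventually_elim
      case (elim t)
      then have "(INF t\<in>{T..}. f t) \<le> f t" by (intro cINF_lower[OF bb]) auto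
      then show ?case using a by simp
    qed
  next
    fix a assume "(INF t\<in>{T..}. f t) < a"
    then obtain s where s: "T \<le> s" "f s < a" using cINF_less_iff[OF _ bb, of a] by auto
    show "\<forall>\<^sub>F t in at_top. f t < a"
      using eventually_ge_at_top[of s] by eventually_elim (use dec[OF s(1)] s(2) in \<open>force intro: le_less_trans\<close>)
  qed
qed

text \<open>The limit problem only prescribes boundedness. It yields |P| \<le> F e^(-t), whence V +
  F e^(-t) is nonincreasing and bounded and therefore converges.\<close>

lemma bounded_solution_emden:
  assumes dV: "\<And>t. t > 0 \<Longrightarrow> (V has_real_derivative P t) (at t)"
    and dP: "\<And>t. t > 0 \<Longrightarrow> (P has_real_derivative - (exp (- t) * signed_powr q (V t))) (at t)"
    and M: "\<And>t. t > 0 \<Longrightarrow> \<bar>V t\<bar> \<le> M" and q: "q > 0"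
  obtains a where "emden (signed_powr q) 0 0 V P a"
proof -
  define F where "F = M powr q * M"
  have h: "\<bar>signed_powr q (V t)\<bar> \<le> F" if "t > 0" for t
    unfolding F_def using q M[OF that] by (intro signed_powr_abs_le) auto
  have 1: "P t \<le> F * exp (- t)" if "t > 0" for t
    by (rule bounded_solution_deriv_le[OF dV dP h M that])
  have 2: "- P t \<le> F * exp (- t)" if "t > 0" for t
    by (rule bounded_solution_deriv_le[where V = "\<lambda>t. - V t" and P = "\<lambda>t. - P t" and T = 0 and M = M
          and h = "\<lambda>t. - signed_powr q (V t)"])
      (use h M that in \<open>auto intro!: derivative_eq_intros dV dP\<close>)
  have ex: "((\<lambda>t. F * exp (- t)) \<longlongrightarrow> 0) at_top"
    using tendsto_mult_right_zero[OF tendsto_exp_neg_mult_at_top[of 1], of F] by simp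
  obtain l where l: "((\<lambda>t. V t + F * exp (- t)) \<longlongrightarrow> l) at_top"
  proof (rule nonincreasing_bounded_convergent[of 1 "\<lambda>t. V t + F * exp (- t)" "- M"])
    fix s t :: real assume st: "1 \<le> s" "s \<le> t"
    show "V t + F * exp (- t) \<le> V s + F * exp (- s)"
    proof (rule DERIV_nonpos_imp_nonincreasing[OF st(2), of "\<lambda>t. V t + F * exp (- t)"])
      fix x assume x: "s \<le> x" "x \<le> t"
      have "((\<lambda>t. V t + F * exp (- t)) has_real_derivative P x - F * exp (- x)) (at x)"
        using st x by (auto intro!: derivative_eq_intros dV)
      then show "\<exists>y. ((\<lambda>t. V t + F * exp (- t)) has_real_derivative y) (at x) \<and> y \<le> 0"
        using 1[of x] st x by (intro exI[of _ "P x - F * exp (- x)"]) auto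
    qed
  next
    fix t :: real assume t: "1 \<le> t"
    have "\<bar>V t\<bar> \<le> M" "\<bar>signed_powr q (V t)\<bar> \<le> F" using M[of t] h[of t] t by auto
    then have "- M \<le> V t" "0 \<le> F" by linarith+
    then show "- M \<le> V t + F * exp (- t)" by (simp add: add_increasing2)
  qed
  have "((\<lambda>t. V t + F * exp (- t) - F * exp (- t)) \<longlongrightarrow> l - 0) at_top"
    by (intro tendsto_diff l ex)
  moreover have "(P \<longlongrightarrow> 0) at_top"
  proof (rule Lim_null_comparison[OF _ ex])
    show "\<forall>\<^sub>F t in at_top. norm (P t) \<le> F * exp (- t)"
      using eventually_gt_at_top[of 0] by eventually_elim (use 1 2 in \<open>force simp: abs_le_iff\<close>)
  qed
  ultimately have "emden (signed_powr q) 0 0 V P l" using dV dP by (simp add: emden_def)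
  then show thesis by (rule that)
qed

lemma at_within_atLeast_interior: "t > (a::real) \<Longrightarrow> at t within {a..} = at t"
  by (intro at_within_interior) auto

context emden_profile
begin

text \<open>Scaling by s = z0 moves the selected zero to the origin; the sign factor makes the slope
  there positive, so the solution has the sign (-1)^(K-1) at infinity.\<close>

lemma limit_solution_profile:
  assumes z0: "W z0 = 0" "card {t. t > z0 \<and> W t = 0} = K - 1" "(- 1) ^ (K - 1) * R z0 > 0"
    and K: "K \<ge> 1" and p: "p = q + 2"
  shows "limit_solution p K (\<lambda>t. (- 1) ^ (K - 1) * (exp (- (z0 / q)) * W (t + z0)))"
proof -
  define \<sigma> where "\<sigma> = (- 1 :: real) ^ (K - 1)"
  define c where "c = exp (- (z0 / q))"
  have \<sigma>: "\<sigma> = 1 \<or> \<sigma> = - 1" by (simp add: \<sigma>_def minus_one_power_iff)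
  have c: "c > 0" "c = exp (- ((1 - 0) * z0 / q))" by (simp_all add: c_def)
  define X where "X t = c * W (t + z0)" for t
  define Y where "Y t = c * R (t + z0)" for t
  have e: "emden (signed_powr q) 0 (T - z0) X Y c" for T
    using emden_scale[OF emden q c(2)] by (simp add: X_def[abs_def] Y_def[abs_def])
  have d: "(X has_real_derivative Y t) (at t)" "(Y has_real_derivative - (exp (- t) * signed_powr q (X t))) (at t)" for t
    using e[of "t + z0 - 1"] by (auto simp: emden_def)
  have cX: "continuous_on S X" for S
    by (intro continuous_at_imp_continuous_on ballI DERIV_isCont[OF d(1)])
  have sg: "signed_powr q (\<sigma> * X t) = \<sigma> * signed_powr q (X t)" for t using \<sigma> by auto
  have XW: "\<sigma> * X t = 0 \<longleftrightarrow> W (t + z0) = 0" for t using \<sigma> c by (auto simp: X_def)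
  have "limit_solution p K (\<lambda>t. \<sigma> * X t)"
    unfolding limit_solution_def XW
  proof (intro conjI exI allI impI)
    fix t :: real
    show "((\<lambda>t. \<sigma> * X t) has_real_derivative \<sigma> * Y t) (at t within {0..})"
      by (intro DERIV_cmult DERIV_subset[OF d(1)]) auto
    show "((\<lambda>t. \<sigma> * Y t) has_real_derivative \<sigma> * (- (exp (- t) * signed_powr q (X t)))) (at t within {0..})"
      by (intro DERIV_cmult DERIV_subset[OF d(2)]) auto
    show "continuous_on {0..} (\<lambda>t. \<sigma> * (- (exp (- t) * signed_powr q (X t))))"
      by (intro continuous_intros q cX)
    have "- (\<sigma> * (- (exp (- t) * signed_powr q (X t)))) = exp (- t) * signed_powr q (\<sigma> * X t)"
      unfolding sg by simp
    also have "\<dots> = exp (- t) * \<bar>\<sigma> * X t\<bar> powr (p - 2) * (\<sigma> * X t)" by (simp add: signed_powr_def p)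
    finally show "- (\<sigma> * (- (exp (- t) * signed_powr q (X t)))) = exp (- t) * \<bar>\<sigma> * X t\<bar> powr (p - 2) * (\<sigma> * X t)" .
    have Y0: "\<sigma> * Y 0 = c * (\<sigma> * R z0)" by (simp add: Y_def)
    have "\<sigma> * R z0 > 0" unfolding \<sigma>_def by (rule z0(3))
    then show "\<sigma> * Y 0 > 0" unfolding Y0 by (rule mult_pos_pos[OF c(1)])
    have "\<bar>\<sigma> * X t\<bar> \<le> c * 1" for t
      using \<sigma> c W_le[of "t + z0"] by (auto simp: X_def abs_mult)
    then show "bounded ((\<lambda>t. \<sigma> * X t) ` {0..})" by (intro boundedI[of _ "c * 1"]) auto
    show "W (0 + z0) = 0" using z0 by simp
    show "finite {t. 0 < t \<and> W (t + z0) = 0}" "card {t. 0 < t \<and> W (t + z0) = 0} = K - 1"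
      using zero_set_shift(2,3)[of 0 W z0] finite_W_zeros' z0 by simp_all
  qed
  then show ?thesis by (simp add: \<sigma>_def X_def c_def)
qed

text \<open>Up to sign, normalisation turns V into a solution with limit 1, which is
  \<open>W\<close> to the right of its start z. Then z is a zero of \<open>W\<close> with the same
  count as z0, and the slope at 0 decides the sign.\<close>

lemma limit_solution_unique:
  assumes z0: "W z0 = 0" "card {t. t > z0 \<and> W t = 0} = K - 1" "(- 1) ^ (K - 1) * R z0 > 0"
    and K: "K \<ge> 1" and p: "p = q + 2" and V: "limit_solution p K V" and t: "t \<ge> 0"
  shows "V t = (- 1) ^ (K - 1) * (exp (- (z0 / q)) * W (t + z0))"
proof -
  obtain P P' where dV: "\<And>t. t \<ge> 0 \<Longrightarrow> (V has_real_derivative P t) (at t within {0..})"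
    and dP: "\<And>t. t \<ge> 0 \<Longrightarrow> (P has_real_derivative P' t) (at t within {0..})"
    and P': "\<And>t. t \<ge> 0 \<Longrightarrow> - P' t = exp (- t) * \<bar>V t\<bar> powr (p - 2) * V t"
    and P0: "P 0 > 0" and V0: "V 0 = 0" and bd: "bounded (V ` {0..})"
    and Z: "finite {t. t > 0 \<and> V t = 0}" "card {t. t > 0 \<and> V t = 0} = K - 1"
    using V unfolding limit_solution_def by blast
  have P'': "P' t = - (exp (- t) * signed_powr q (V t))" if "t \<ge> 0" for t
    using P'[OF that] by (simp add: signed_powr_def p)
  have d: "(V has_real_derivative P t) (at t)" "(P has_real_derivative - (exp (- t) * signed_powr q (V t))) (at t)"
    if "t > 0" for t
    using dV[of t] dP[of t] P''[of t] that by (simp_all add: at_within_atLeast_interior)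
  obtain M where M: "\<And>t. t \<ge> 0 \<Longrightarrow> \<bar>V t\<bar> \<le> M" using bd by (auto simp: bounded_iff)
  obtain a where e: "emden (signed_powr q) 0 0 V P a"
    by (rule bounded_solution_emden[of V P q M]) (use d M q in auto)
  \<comment> \<open>Limit 0 would force V = 0 by the energy bound, contradicting the finiteness of
    the zero set.\<close>
  have "a \<noteq> 0"
  proof
    assume "a = 0"
    have "V t = 0" if "t > 0" for t
      using emden_abs_le[OF e _ q, of M t] M that \<open>a = 0\<close> by simp
    then have "{t. t > 0 \<and> V t = 0} = {0<..}" by auto
    then show False using Z(1) infinite_Ioi[of "0::real"] by simp
  qed
  define \<sigma> where "\<sigma> = sgn a"
  have \<sigma>: "\<sigma> = 1 \<or> \<sigma> = - 1" using \<open>a \<noteq> 0\<close> by (auto simp: \<sigma>_def sgn_if)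
  have sg: "signed_powr q (\<sigma> * x) = \<sigma> * signed_powr q x" for x using \<sigma> by auto
  have e': "emden (signed_powr q) 0 0 (\<lambda>t. \<sigma> * V t) (\<lambda>t. \<sigma> * P t) \<bar>a\<bar>"
    unfolding emden_def sg
  proof (intro conjI allI impI)
    fix t :: real assume "t > 0"
    show "((\<lambda>t. \<sigma> * V t) has_real_derivative exp (0 * t) * (\<sigma> * P t)) (at t)"
      using DERIV_cmult[OF d(1)[OF \<open>t > 0\<close>]] by simp
    show "((\<lambda>t. \<sigma> * P t) has_real_derivative - (exp (- t) * (\<sigma> * signed_powr q (V t)))) (at t)"
      using DERIV_cmult[OF d(2)[OF \<open>t > 0\<close>], of \<sigma>] by (simp add: mult_ac)
  next
    have "\<bar>a\<bar> = \<sigma> * a" by (simp add: \<sigma>_def abs_sgn mult.commute)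
    then show "((\<lambda>t. \<sigma> * V t) \<longlongrightarrow> \<bar>a\<bar>) at_top"
      using e by (auto simp: emden_def intro!: tendsto_mult_left)
    show "((\<lambda>t. \<sigma> * P t) \<longlongrightarrow> 0) at_top"
      using e by (auto simp: emden_def intro!: tendsto_mult_right_zero)
  qed
  have cV: "continuous_on {0..} V"
    unfolding continuous_on_eq_continuous_within using dV by (auto intro: DERIV_continuous)
  have "\<sigma> * x = 0 \<longleftrightarrow> x = 0" for x using \<sigma> by auto
  then have Z': "finite {t. t > 0 \<and> \<sigma> * V t = 0}" "card {t. t > 0 \<and> \<sigma> * V t = 0} = K - 1"
    using Z by simp_all
  have "\<exists>z Y Q. shooting q 0 (K - 1) z Y Q \<and> (\<forall>t\<ge>0. \<sigma> * V t = exp (- ((1 - 0) * z / q)) * Y (t + z))"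
    by (rule shooting_normalise[OF e' q _ _ _ _ _ _ Z', of M])
      (use \<open>a \<noteq> 0\<close> V0 M \<sigma> in \<open>auto simp: abs_mult intro!: continuous_intros cV\<close>)
  then obtain z Y Q where sh: "shooting q 0 (K - 1) z Y Q"
    and VY: "\<And>t. t \<ge> 0 \<Longrightarrow> \<sigma> * V t = exp (- ((1 - 0) * z / q)) * Y (t + z)" by blast
  have YW: "Y t = W t" if "t > z" for t
    by (rule emden_unique[OF q _ emden]) (use sh that W_le in \<open>auto simp: shooting_def\<close>)
  have Wz: "W z = 0"
  proof (rule tendsto_unique)
    show "(W \<longlongrightarrow> W z) (at_right z)"
      using isCont_W[of z] by (auto simp: isCont_def intro: filterlim_mono at_le)
    have "(Y \<longlongrightarrow> Y z) (at z within {z..})" "Y z = 0"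
      using sh atLeast_iff[of z z] unfolding shooting_def continuous_on_def by blast+
    then have "(Y \<longlongrightarrow> 0) (at_right z)" by (simp add: at_within_Ici_at_right)
    moreover have "\<forall>\<^sub>F t in at_right z. Y t = W t"
      using eventually_at_right_less[of z] by eventually_elim (rule YW)
    ultimately show "(W \<longlongrightarrow> 0) (at_right z)" by (rule Lim_transform_eventually)
  qed simp
  have "{t. t > z \<and> W t = 0} = {t. t > z \<and> Y t = 0}" using YW by auto
  then have "z = z0" using W_zero_unique[OF Wz z0(1)] z0 sh by (simp add: shooting_def)
  define c where "c = exp (- (z0 / q))"
  have VW: "V t = \<sigma> * (c * W (t + z0))" if "t \<ge> 0" for t
  proof -
    have "Y (t + z0) = W (t + z0)"
      using YW[of "t + z0"] that sh Wz by (cases "t = 0") (auto simp: \<open>z = z0\<close> shooting_def)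
    then have "\<sigma> * V t = c * W (t + z0)" using VY[OF that] by (simp add: \<open>z = z0\<close> c_def)
    then show ?thesis using \<sigma> by auto
  qed
  \<comment> \<open>One-sided derivatives at 0 are compared: \<sigma> times the slope of
    \<open>W\<close> at z0 must be positive, as P 0 is.\<close>
  have "((\<lambda>t. W (t + z0)) has_real_derivative R z0) (at 0)"
    using DERIV_shift[of W "R z0" 0 z0] DERIV_W[of z0] by simp
  then have "((\<lambda>t. \<sigma> * (c * W (t + z0))) has_real_derivative \<sigma> * (c * R z0)) (at 0 within {0..})"
    by (rule DERIV_cmult[OF DERIV_cmult, THEN has_field_derivative_at_within])
  moreover have "(V has_real_derivative P 0) (at 0 within {0..})" using dV[of 0] by simp
  then have "((\<lambda>t. \<sigma> * (c * W (t + z0))) has_real_derivative P 0) (at 0 within {0..})"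
    by (rule has_field_derivative_transform_within[of _ _ _ _ 1]) (auto simp: VW)
  ultimately have "\<sigma> * (c * R z0) = P 0"
    by (rule has_field_derivative_unique) (simp add: at_within_Ici_at_right)
  then have "0 < c * (\<sigma> * R z0)" using P0 by (simp add: mult_ac)
  then have "0 < \<sigma> * R z0" by (simp add: c_def zero_less_mult_iff)
  then have "\<sigma> = (- 1) ^ (K - 1)" using z0(3) \<sigma> by (auto simp: minus_one_power_iff split: if_splits)
  then show ?thesis using VW[OF t] by (simp add: c_def)
qed

section \<open>Convergence of the starting zeros and of the rescaled solutions\<close>

text \<open>A bootstrap: comparison is first available only right of max z T with \<open>T\<close>
  fixed slightly below z0. This suffices to locate z, and once z > T the estimate covers the whole
  half-line (z,\<infinity>).\<close>

lemma shooting_zero_tendsto: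
  assumes z0: "W z0 = 0" "card {t. t > z0 \<and> W t = 0} = n"
    and \<gamma>: "(\<gamma> \<longlongrightarrow> 0) F" "\<forall>\<^sub>F x in F. 0 \<le> \<gamma> x"
    and sh: "\<forall>\<^sub>F x in F. shooting q (\<gamma> x) n (z x) (Y x) (Q x)"
  shows "(z \<longlongrightarrow> z0) F"
    and "\<exists>C\<ge>0. \<forall>\<^sub>F x in F. \<forall>t>z x. \<bar>Y x t - W t\<bar> \<le> sqrt (\<gamma> x * C)"
proof -
  obtain T where T: "T < z0" "\<And>t. T \<le> t \<Longrightarrow> t < z0 \<Longrightarrow> W t \<noteq> 0" using zero_gap[of z0] by blast
  obtain C where C: "C \<ge> 0" "\<forall>\<gamma> T' V P W R a. 0 \<le> \<gamma> \<and> \<gamma> \<le> 1/4 \<and> T \<le> T' \<and> emden (signed_powr q) \<gamma> T' V P a \<and>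
       emden (signed_powr q) 0 T' W R a \<and> (\<forall>t>T'. \<bar>V t\<bar> \<le> 1 \<and> \<bar>W t\<bar> \<le> 1) \<longrightarrow>
       (\<forall>t>T'. (V t - W t)\<^sup>2 + exp t * (P t - R t)\<^sup>2 \<le> \<gamma> * C)"
    using signed_powr_comparison[OF q, of T] by blast
  have ev4: "\<forall>\<^sub>F x in F. \<gamma> x < 1/4" using order_tendstoD(2)[OF \<gamma>(1), of "1/4"] by simp
  have cmp: "\<forall>\<^sub>F x in F. \<forall>t. z x < t \<and> T < t \<longrightarrow>
      (Y x t - W t)\<^sup>2 \<le> \<gamma> x * C \<and> (Q x t - R t)\<^sup>2 \<le> \<gamma> x * C * exp (- T)"
    using ev4 \<gamma>(2) sh
  proof eventually_elim
    case (elim x)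
    have "emden (signed_powr q) (\<gamma> x) (max (z x) T) (Y x) (Q x) 1"
      using elim(3) by (auto simp: shooting_def intro: emden_mono)
    then have *: "(Y x t - W t)\<^sup>2 + exp t * (Q x t - R t)\<^sup>2 \<le> \<gamma> x * C" if "z x < t" "T < t" for t
      using C(2)[rule_format, of "\<gamma> x" "max (z x) T" "Y x" "Q x" 1 W R t] elim emden W_le that
      by (auto simp: shooting_def)
    show ?case
    proof (intro allI impI conjI; elim conjE)
      fix t assume t: "z x < t" "T < t"
      have "0 \<le> (Y x t - W t)\<^sup>2" "0 \<le> exp t * (Q x t - R t)\<^sup>2" by simp_all
      then show "(Y x t - W t)\<^sup>2 \<le> \<gamma> x * C" using *[OF t] by linarith
      have "exp T * (Q x t - R t)\<^sup>2 \<le> exp t * (Q x t - R t)\<^sup>2" using t by (intro mult_right_mono) auto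
      also have "\<dots> \<le> \<gamma> x * C" using *[OF t] \<open>0 \<le> (Y x t - W t)\<^sup>2\<close> by linarith
      finally have "exp (- T) * (exp T * (Q x t - R t)\<^sup>2) \<le> exp (- T) * (\<gamma> x * C)" by (intro mult_left_mono) auto
      moreover have "exp (- T) * (exp T * (Q x t - R t)\<^sup>2) = (Q x t - R t)\<^sup>2"
        by (simp add: mult.assoc[symmetric] mult_exp_exp)
      ultimately show "(Q x t - R t)\<^sup>2 \<le> \<gamma> x * C * exp (- T)" by (simp add: mult.commute)
    qed
  qed
  show z: "(z \<longlongrightarrow> z0) F"
  proof (rule tendstoI)
    fix \<epsilon> :: real assume "\<epsilon> > 0"
    obtain \<eta> where \<eta>: "\<eta> > 0" and pert: "\<And>\<gamma> z V P. continuous_on {z..} V \<Longrightarrow> V z = 0 \<Longrightarrow>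
      (\<And>t. t > z \<Longrightarrow> (V has_real_derivative exp (\<gamma> * t) * P t) (at t)) \<Longrightarrow>
      finite {t. t > z \<and> V t = 0} \<Longrightarrow> card {t. t > z \<and> V t = 0} = n \<Longrightarrow>
      (\<And>t. t > z \<Longrightarrow> t > T \<Longrightarrow> \<bar>V t - W t\<bar> \<le> \<eta> \<and> \<bar>P t - R t\<bar> \<le> \<eta>) \<Longrightarrow> \<bar>z - z0\<bar> < \<epsilon>"
      using zero_perturbation[OF z0 T \<open>\<epsilon> > 0\<close>] by blast
    have "((\<lambda>x. \<gamma> x * C) \<longlongrightarrow> 0 * C) F" "((\<lambda>x. \<gamma> x * C * exp (- T)) \<longlongrightarrow> 0 * C * exp (- T)) F"
      by (intro tendsto_intros \<gamma>(1))+
    then have "\<forall>\<^sub>F x in F. \<gamma> x * C < \<eta>\<^sup>2" "\<forall>\<^sub>F x in F. \<gamma> x * C * exp (- T) < \<eta>\<^sup>2"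
      using \<eta> by (auto intro!: order_tendstoD(2)[where y = 0])
    then show "\<forall>\<^sub>F x in F. dist (z x) z0 < \<epsilon>"
      using cmp sh
    proof eventually_elim
      case (elim x)
      have cl: "\<bar>Y x t - W t\<bar> \<le> \<eta> \<and> \<bar>Q x t - R t\<bar> \<le> \<eta>" if "z x < t" "T < t" for t
      proof -
        have "(Y x t - W t)\<^sup>2 \<le> \<gamma> x * C" "(Q x t - R t)\<^sup>2 \<le> \<gamma> x * C * exp (- T)"
          using elim(3) that by blast+
        then have "(Y x t - W t)\<^sup>2 \<le> \<eta>\<^sup>2" "(Q x t - R t)\<^sup>2 \<le> \<eta>\<^sup>2" using elim(1,2) by linarith+
        then show ?thesis using \<eta> by (simp add: abs_le_square_iff[symmetric])
      qed
      have "\<bar>z x - z0\<bar> < \<epsilon>"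
        by (rule pert[of "z x" "Y x" "\<gamma> x" "Q x"])
          (use elim(4) cl in \<open>auto simp: shooting_def emden_def\<close>)
      then show ?case by (simp add: dist_real_def)
    qed
  qed
  have "\<forall>\<^sub>F x in F. T < z x" by (rule order_tendstoD(1)[OF z T(1)])
  then have "\<forall>\<^sub>F x in F. \<forall>t>z x. \<bar>Y x t - W t\<bar> \<le> sqrt (\<gamma> x * C)"
    using cmp
  proof eventually_elim
    case (elim x)
    then show ?case by (auto intro: real_le_rsqrt)
  qed
  then show "\<exists>C\<ge>0. \<forall>\<^sub>F x in F. \<forall>t>z x. \<bar>Y x t - W t\<bar> \<le> sqrt (\<gamma> x * C)" using C(1) by blast
qed

lemma rescaled_uniform_limit:
  assumes z0: "W z0 = 0" "card {t. t > z0 \<and> W t = 0} = n"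
    and \<gamma>: "(\<gamma> \<longlongrightarrow> 0) F" "\<forall>\<^sub>F x in F. 0 \<le> \<gamma> x"
    and sh: "\<forall>\<^sub>F x in F. shooting q (\<gamma> x) n (z x) (Y x) (Q x) \<and>
      (\<forall>t\<ge>0. U x t = exp (- ((1 - \<gamma> x) * z x / q)) * Y x (t + z x))"
  shows "uniform_limit {0..} U (\<lambda>t. exp (- (z0 / q)) * W (t + z0)) F"
proof (rule uniform_limitI)
  fix \<epsilon> :: real assume \<epsilon>: "\<epsilon> > 0"
  have sh': "\<forall>\<^sub>F x in F. shooting q (\<gamma> x) n (z x) (Y x) (Q x)" using sh by eventually_elim simp
  note z = shooting_zero_tendsto(1)[OF z0 \<gamma> sh']
  obtain C where C: "\<forall>\<^sub>F x in F. \<forall>t>z x. \<bar>Y x t - W t\<bar> \<le> sqrt (\<gamma> x * C)"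
    using shooting_zero_tendsto(2)[OF z0 \<gamma> sh'] by blast
  define c where "c x = exp (- ((1 - \<gamma> x) * z x / q))" for x
  define c0 where "c0 = exp (- (z0 / q))"
  \<comment> \<open>Three errors: the scaling factor (with |Y| \<le> 1), the distance of the
    profiles, and the shift of \<open>W\<close> by z - z0, whose Lipschitz constant is taken on [z0
    - 1,\<infinity>).\<close>
  define b where "b x = \<bar>c x - c0\<bar> + c0 * (sqrt (\<gamma> x * C) + exp (- (z0 - 1)) * \<bar>z x - z0\<bar>)" for x
  have "(c \<longlongrightarrow> exp (- ((1 - 0) * z0 / q))) F"
    unfolding c_def using q by (intro tendsto_intros \<gamma>(1) z) auto
  then have "(b \<longlongrightarrow> \<bar>c0 - c0\<bar> + c0 * (sqrt (0 * C) + exp (- (z0 - 1)) * \<bar>z0 - z0\<bar>)) F"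
    unfolding b_def by (intro tendsto_intros \<gamma>(1) z) (simp add: c0_def)
  then have "\<forall>\<^sub>F x in F. b x < \<epsilon>" using \<epsilon> by (intro order_tendstoD(2)[of b 0]) auto
  moreover have "\<forall>\<^sub>F x in F. z0 - 1 < z x" by (rule order_tendstoD(1)[OF z]) simp
  ultimately show "\<forall>\<^sub>F x in F. \<forall>t\<in>{0..}. dist (U x t) (exp (- (z0 / q)) * W (t + z0)) < \<epsilon>"
    using C sh
  proof eventually_elim
    case (elim x)
    show ?case
    proof
      fix t :: real assume "t \<in> {0..}"
      then have t: "t \<ge> 0" by simp
      have U: "U x t = c x * Y x (t + z x)" using elim(4) t by (simp add: c_def)
      show "dist (U x t) (exp (- (z0 / q)) * W (t + z0)) < \<epsilon>"
      proof (cases "t = 0")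
        \<comment> \<open>The profile estimate holds strictly right of z only; at t = 0 both
          functions vanish.\<close>
        case True
        then show ?thesis using U elim(4) z0 \<epsilon> by (simp add: shooting_def)
      next
        case False
        then have tz: "t + z x > z x" using t by simp
        have Y: "\<bar>Y x (t + z x)\<bar> \<le> 1" "\<bar>Y x (t + z x) - W (t + z x)\<bar> \<le> sqrt (\<gamma> x * C)"
          using elim(3,4) tz unfolding shooting_def by blast+
        have W: "\<bar>W (t + z x) - W (t + z0)\<bar> \<le> exp (- (z0 - 1)) * \<bar>z x - z0\<bar>"
          using W_Lipschitz[of "z0 - 1" "t + z x" "t + z0"] elim(2) t by simp
        have "U x t - c0 * W (t + z0) = (c x - c0) * Y x (t + z x)
            + c0 * ((Y x (t + z x) - W (t + z x)) + (W (t + z x) - W (t + z0)))"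
          unfolding U by (simp add: algebra_simps)
        also have "\<bar>\<dots>\<bar> \<le> \<bar>c x - c0\<bar> * \<bar>Y x (t + z x)\<bar>
            + c0 * \<bar>(Y x (t + z x) - W (t + z x)) + (W (t + z x) - W (t + z0))\<bar>"
          by (rule order_trans[OF abs_triangle_ineq]) (simp add: abs_mult c0_def)
        also have "\<dots> \<le> b x" unfolding b_def
        proof (intro add_mono mult_left_mono)
          show "\<bar>c x - c0\<bar> * \<bar>Y x (t + z x)\<bar> \<le> \<bar>c x - c0\<bar>" using Y(1) by (simp add: mult_left_le)
          show "\<bar>(Y x (t + z x) - W (t + z x)) + (W (t + z x) - W (t + z0))\<bar>
            \<le> sqrt (\<gamma> x * C) + exp (- (z0 - 1)) * \<bar>z x - z0\<bar>"
            using Y(2) W by linarith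
        qed (simp add: c0_def)
        finally show ?thesis using elim(1) by (simp add: dist_real_def c0_def)
      qed
    qed
  qed
qed

end

theorem proposition1p1:
  fixes u :: "real \<Rightarrow> real ^ 'n \<Rightarrow> real" and p :: real and K :: nat
  assumes "CARD('n) \<ge> 3" and "p > 2" and "K \<ge> 1"
    and "\<And>\<alpha>. \<alpha> > alpha_crit CARD('n) p \<Longrightarrow> henon_radial_solution p \<alpha> K (u \<alpha>)"
  shows "\<exists>U. limit_solution p K U \<and>
             (\<forall>V. limit_solution p K V \<longrightarrow> (\<forall>t\<ge>0. V t = U t)) \<and>
             uniform_limit {0..} (\<lambda>\<alpha>. henon_rescaled p \<alpha> (u \<alpha>))
               (\<lambda>t. (- 1) ^ (K - 1) * U t) at_top"
proof -
  define q where "q = p - 2"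
  have q_pos: "q > 0" and p_eq: "p = q + 2" using \<open>p > 2\<close> by (auto simp: q_def)
  obtain W R where WR: "\<And>T. emden (signed_powr q) 0 T W R 1" "\<And>t. \<bar>W t\<bar> \<le> 1"
    using emden_profile_exists[OF q_pos] by blast
  interpret emden_profile q W R by unfold_locales (fact q_pos, fact WR(1), fact WR(2))
  obtain z0 where z0: "W z0 = 0" "card {t. t > z0 \<and> W t = 0} = K - 1" "(- 1) ^ (K - 1) * R z0 > 0"
    using W_nth_zero[of "K - 1"] by blast
  define N where "N = real CARD('n)"
  define \<gamma> where "\<gamma> \<alpha> = (N - 2) / (N + \<alpha>)" for \<alpha>
  have N: "N \<ge> 3" using assms(1) by (simp add: N_def)
  have DIM: "DIM(real ^ 'n) = CARD('n)" by simp
  have ex: "\<exists>z Y Q. shooting q (\<gamma> \<alpha>) (K - 1) z Y Q \<and>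
      (\<forall>t\<ge>0. henon_rescaled p \<alpha> (u \<alpha>) t = exp (- ((1 - \<gamma> \<alpha>) * z / q)) * Y (t + z))"
    if \<alpha>: "\<alpha> > alpha_crit CARD('n) p" for \<alpha>
  proof -
    have \<alpha>0: "\<alpha> > 0" using \<alpha> by (simp add: alpha_crit_def)
    have \<gamma>: "0 \<le> \<gamma> \<alpha>" "\<gamma> \<alpha> < 1" using N \<alpha>0 by (simp_all add: \<gamma>_def)
    have "u \<alpha> 0 > 0" using assms(4)[OF \<alpha>] by (simp add: henon_radial_solution_def)
    \<comment> \<open>The limit at infinity is positive, so normalisation involves no change of
      sign, unlike for solutions of the limit problem.\<close>
    then have pos: "(N + \<alpha>) powr (- 2 / (p - 2)) * u \<alpha> 0 > 0" using N \<alpha>0 by simp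
    have "DIM(real ^ 'n) \<ge> 2" using assms(1) by simp
    from henon_emden[OF assms(4)[OF \<alpha>] this \<open>p > 2\<close> \<alpha>0 \<open>K \<ge> 1\<close>]
    obtain P M where U: "emden (signed_powr q) (\<gamma> \<alpha>) 0 (henon_rescaled p \<alpha> (u \<alpha>)) P
        ((N + \<alpha>) powr (- 2 / (p - 2)) * u \<alpha> 0)"
      "continuous_on {0..} (henon_rescaled p \<alpha> (u \<alpha>))" "henon_rescaled p \<alpha> (u \<alpha>) 0 = 0"
      "\<forall>t>0. \<bar>henon_rescaled p \<alpha> (u \<alpha>) t\<bar> \<le> M"
      "finite {t. t > 0 \<and> henon_rescaled p \<alpha> (u \<alpha>) t = 0}"
      "card {t. t > 0 \<and> henon_rescaled p \<alpha> (u \<alpha>) t = 0} = K - 1"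
      unfolding DIM N_def[symmetric] \<gamma>_def[symmetric] q_def[symmetric] by blast
    show ?thesis
      by (rule shooting_normalise[OF U(1) q_pos \<gamma> pos U(2,3) _ U(5,6)]) (use U(4) in blast)
  qed
  then obtain z Y Q where zYQ: "\<And>\<alpha>. \<alpha> > alpha_crit CARD('n) p \<Longrightarrow> shooting q (\<gamma> \<alpha>) (K - 1) (z \<alpha>) (Y \<alpha>) (Q \<alpha>) \<and>
      (\<forall>t\<ge>0. henon_rescaled p \<alpha> (u \<alpha>) t = exp (- ((1 - \<gamma> \<alpha>) * z \<alpha> / q)) * Y \<alpha> (t + z \<alpha>))"
    by metis
  \<comment> \<open>The sign makes \<open>U\<close> increasing at 0; multiplied by it once more,
    \<open>U\<close> becomes the scaled profile that is positive at infinity.\<close>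
  define U where "U t = (- 1) ^ (K - 1) * (exp (- (z0 / q)) * W (t + z0))" for t
  have sgn: "(- 1) ^ (K - 1) * ((- 1) ^ (K - 1) * x) = x" for x :: real
    by (simp add: mult.assoc[symmetric] power_mult_distrib[symmetric])
  have "uniform_limit {0..} (\<lambda>\<alpha>. henon_rescaled p \<alpha> (u \<alpha>)) (\<lambda>t. exp (- (z0 / q)) * W (t + z0)) at_top"
  proof (rule rescaled_uniform_limit[OF z0(1,2), of \<gamma> _ z Y Q])
    have "filterlim (\<lambda>\<alpha>. N + \<alpha>) at_top at_top"
      by (rule filterlim_tendsto_add_at_top[OF tendsto_const filterlim_ident])
    then show "(\<gamma> \<longlongrightarrow> 0) at_top" unfolding \<gamma>_def
      by (rule tendsto_divide_0[OF tendsto_const filterlim_at_top_imp_at_infinity])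
    show "\<forall>\<^sub>F \<alpha> in at_top. 0 \<le> \<gamma> \<alpha>"
      using eventually_gt_at_top[of 0] by eventually_elim (use N in \<open>simp add: \<gamma>_def\<close>)
    show "\<forall>\<^sub>F \<alpha> in at_top. shooting q (\<gamma> \<alpha>) (K - 1) (z \<alpha>) (Y \<alpha>) (Q \<alpha>) \<and>
      (\<forall>t\<ge>0. henon_rescaled p \<alpha> (u \<alpha>) t = exp (- ((1 - \<gamma> \<alpha>) * z \<alpha> / q)) * Y \<alpha> (t + z \<alpha>))"
      using eventually_gt_at_top[of "alpha_crit CARD('n) p"] by eventually_elim (rule zYQ)
  qed
  then have "uniform_limit {0..} (\<lambda>\<alpha>. henon_rescaled p \<alpha> (u \<alpha>)) (\<lambda>t. (- 1) ^ (K - 1) * U t) at_top"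
    by (simp add: U_def sgn)
  then show ?thesis
    using limit_solution_profile[OF z0 \<open>K \<ge> 1\<close> p_eq] limit_solution_unique[OF z0 \<open>K \<ge> 1\<close> p_eq]
    unfolding U_def by (intro exI[of _ U]) (simp add: U_def[abs_def])
qed

end
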